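(* Let $\mathcal{A}$ be an abelian category and suppose given short exact sequences in $\mathcal{A}$ $$0\to P\to E\to R\to 0,\quad 0\to P\to H\to S\to 0,\quad 0\to R\to F\to Q\to 0,\quad 0\to S\to G\to Q\to 0 .$$ Then the following are equivalent: (i) There exist an object $X$ of $\mathcal{A}$ and morphisms $E\to X$, $H\to X$, $X\to F$, $X\to G$ such that the $3\times 3$ diagram with rows $$0\to P\to E\to R\to 0,\qquad 0\to H\to X\to F\to 0,\qquad 0\to S\to G\to Q\to 0$$ and columns $$0\to P\to H\to S\to 0,\qquad 0\to E\to X\to G\to 0,\qquad 0\to R\to F\to Q\to 0$$ is commutative with all rows and columns exact (the first and third rows and the first and third columns being the given sequences). (ii) The Baer sum of $[E]\cup[F]$ and $[H]\cup[G]$ is $0$ in $\mathrm{Ext}^2(Q,P)$.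
   Context: $\mathrm{Ext}^n$ denotes the Yoneda Ext groups of the abelian category $\mathcal{A}$. The given short exact sequences define classes $[E]\in \mathrm{Ext}^1(R,P)$, $[H]\in \mathrm{Ext}^1(S,P)$, $[F]\in \mathrm{Ext}^1(Q,R)$, $[G]\in \mathrm{Ext}^1(Q,S)$. The class $[E]\cup[F]\in \mathrm{Ext}^2(Q,P)$ is the class of the spliced exact sequence $0\to P\to E\to F\to Q\to 0$, where $E\to F$ is the composite $E\to R\to F$. Similarly $[H]\cup[G]\in \mathrm{Ext}^2(Q,P)$ is the class of $0\to P\to H\to G\to Q\to 0$, where $H\to G$ is the composite $H\to S\to G$. The Baer sum of $[0\to P\to T_1\to Z_1\to Q\to 0]$ and $[0\to P\to T_2\to Z_2\to Q\to 0]$ in $\mathrm{Ext}^2(Q,P)$ is the class of $0\to P\to T\to Z\to Q\to 0$, where $T$ is the pushout of $P\to T_1$ and $P\to T_2$ and $Z$ is the pullback of $Z_1\to Q$ and $Z_2\to Q$. It is the addition of $\mathrm{Ext}^2(Q,P)$. *)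

theory Defs
  imports "HOL-Algebra.Group"
begin

section \<open>Abelian categories\<close>

text \<open>A category is given by sets of objects and arrows inside two types; every arrow has a unique
  source and target. The last two components carry the preadditive structure: \<open>Add\<close> is the
  addition of parallel arrows and \<open>Zero C A B\<close> is the zero arrow from \<open>A\<close> to \<open>B\<close>.\<close>

record ('o, 'm) precat =
  Obj :: "'o set"
  Arr :: "'m set"
  Src :: "'m \<Rightarrow> 'o"
  Tgt :: "'m \<Rightarrow> 'o"
  Idn :: "'o \<Rightarrow> 'm"
  Cmp :: "'m \<Rightarrow> 'm \<Rightarrow> 'm"  (infixr \<open>\<cdot>\<index>\<close> 70)
  Add :: "'m \<Rightarrow> 'm \<Rightarrow> 'm"
  Zero :: "'o \<Rightarrow> 'o \<Rightarrow> 'm"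

definition Hom :: "('o, 'm) precat \<Rightarrow> 'o \<Rightarrow> 'o \<Rightarrow> 'm set" where
  "Hom C A B = {f \<in> Arr C. Src C f = A \<and> Tgt C f = B}"

definition Hom_group :: "('o, 'm) precat \<Rightarrow> 'o \<Rightarrow> 'o \<Rightarrow> 'm monoid" where
  "Hom_group C A B = \<lparr>carrier = Hom C A B, mult = Add C, one = Zero C A B\<rparr>"

definition is_monic :: "('o, 'm) precat \<Rightarrow> 'm \<Rightarrow> bool" where
  "is_monic C f \<longleftrightarrow> f \<in> Arr C \<and>
     (\<forall>A. \<forall>g \<in> Hom C A (Src C f). \<forall>h \<in> Hom C A (Src C f).
        f \<cdot>\<^bsub>C\<^esub> g = f \<cdot>\<^bsub>C\<^esub> h \<longrightarrow> g = h)"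

definition is_epic :: "('o, 'm) precat \<Rightarrow> 'm \<Rightarrow> bool" where
  "is_epic C f \<longleftrightarrow> f \<in> Arr C \<and>
     (\<forall>B. \<forall>g \<in> Hom C (Tgt C f) B. \<forall>h \<in> Hom C (Tgt C f) B.
        g \<cdot>\<^bsub>C\<^esub> f = h \<cdot>\<^bsub>C\<^esub> f \<longrightarrow> g = h)"

definition is_zero_object :: "('o, 'm) precat \<Rightarrow> 'o \<Rightarrow> bool" where
  "is_zero_object C Z \<longleftrightarrow> Z \<in> Obj C \<and>
     (\<forall>A \<in> Obj C. (\<exists>!f. f \<in> Hom C Z A) \<and> (\<exists>!f. f \<in> Hom C A Z))"

definition is_kernel :: "('o, 'm) precat \<Rightarrow> 'm \<Rightarrow> 'm \<Rightarrow> bool" where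
  "is_kernel C f k \<longleftrightarrow> f \<in> Arr C \<and> k \<in> Arr C \<and> Tgt C k = Src C f \<and>
     f \<cdot>\<^bsub>C\<^esub> k = Zero C (Src C k) (Tgt C f) \<and>
     (\<forall>A. \<forall>h \<in> Hom C A (Src C f). f \<cdot>\<^bsub>C\<^esub> h = Zero C A (Tgt C f) \<longrightarrow>
        (\<exists>!u. u \<in> Hom C A (Src C k) \<and> k \<cdot>\<^bsub>C\<^esub> u = h))"

definition is_cokernel :: "('o, 'm) precat \<Rightarrow> 'm \<Rightarrow> 'm \<Rightarrow> bool" where
  "is_cokernel C f c \<longleftrightarrow> f \<in> Arr C \<and> c \<in> Arr C \<and> Src C c = Tgt C f \<and>
     c \<cdot>\<^bsub>C\<^esub> f = Zero C (Src C f) (Tgt C c) \<and>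
     (\<forall>B. \<forall>h \<in> Hom C (Tgt C f) B. h \<cdot>\<^bsub>C\<^esub> f = Zero C (Src C f) B \<longrightarrow>
        (\<exists>!u. u \<in> Hom C (Tgt C c) B \<and> u \<cdot>\<^bsub>C\<^esub> c = h))"

locale abelian_category =
  fixes C :: "('o, 'm) precat" (structure)
  assumes Src_Obj: "f \<in> Arr C \<Longrightarrow> Src C f \<in> Obj C"
    and Tgt_Obj: "f \<in> Arr C \<Longrightarrow> Tgt C f \<in> Obj C"
    and Idn_Hom: "A \<in> Obj C \<Longrightarrow> Idn C A \<in> Hom C A A"
    and Cmp_Hom: "\<lbrakk>f \<in> Hom C A B; g \<in> Hom C B D\<rbrakk> \<Longrightarrow> g \<cdot> f \<in> Hom C A D"
    and Cmp_Idn: "f \<in> Hom C A B \<Longrightarrow> f \<cdot> Idn C A = f"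
    and Idn_Cmp: "f \<in> Hom C A B \<Longrightarrow> Idn C B \<cdot> f = f"
    and Cmp_assoc: "\<lbrakk>f \<in> Hom C A B; g \<in> Hom C B D; h \<in> Hom C D E\<rbrakk>
          \<Longrightarrow> (h \<cdot> g) \<cdot> f = h \<cdot> (g \<cdot> f)"
    and Hom_comm_group: "\<lbrakk>A \<in> Obj C; B \<in> Obj C\<rbrakk> \<Longrightarrow> comm_group (Hom_group C A B)"
    and Cmp_Add_right: "\<lbrakk>f \<in> Hom C A B; f' \<in> Hom C A B; g \<in> Hom C B D\<rbrakk>
          \<Longrightarrow> g \<cdot> Add C f f' = Add C (g \<cdot> f) (g \<cdot> f')"
    and Cmp_Add_left: "\<lbrakk>f \<in> Hom C A B; g \<in> Hom C B D; g' \<in> Hom C B D\<rbrakk>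
          \<Longrightarrow> Add C g g' \<cdot> f = Add C (g \<cdot> f) (g' \<cdot> f)"
    and zero_object_exists: "\<exists>Z. is_zero_object C Z"
    and biproduct_exists: "\<lbrakk>A \<in> Obj C; B \<in> Obj C\<rbrakk> \<Longrightarrow>
          \<exists>W. \<exists>i \<in> Hom C A W. \<exists>j \<in> Hom C B W. \<exists>p \<in> Hom C W A. \<exists>q \<in> Hom C W B.
            p \<cdot> i = Idn C A \<and> q \<cdot> j = Idn C B \<and>
            p \<cdot> j = Zero C B A \<and> q \<cdot> i = Zero C A B \<and>
            Add C (i \<cdot> p) (j \<cdot> q) = Idn C W"
    and kernel_exists: "f \<in> Arr C \<Longrightarrow> \<exists>k. is_kernel C f k"
    and cokernel_exists: "f \<in> Arr C \<Longrightarrow> \<exists>c. is_cokernel C f c"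
    and monic_is_kernel: "is_monic C f \<Longrightarrow> \<exists>g. is_kernel C g f"
    and epic_is_cokernel: "is_epic C f \<Longrightarrow> \<exists>g. is_cokernel C g f"

definition is_pushout :: "('o, 'm) precat \<Rightarrow> 'm \<Rightarrow> 'm \<Rightarrow> 'm \<Rightarrow> 'm \<Rightarrow> bool" where
  "is_pushout C f g i j \<longleftrightarrow>
     (\<exists>P A B T. f \<in> Hom C P A \<and> g \<in> Hom C P B \<and> i \<in> Hom C A T \<and> j \<in> Hom C B T \<and>
        i \<cdot>\<^bsub>C\<^esub> f = j \<cdot>\<^bsub>C\<^esub> g \<and>
        (\<forall>Y. \<forall>u \<in> Hom C A Y. \<forall>v \<in> Hom C B Y. u \<cdot>\<^bsub>C\<^esub> f = v \<cdot>\<^bsub>C\<^esub> g \<longrightarrow>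
           (\<exists>!w. w \<in> Hom C T Y \<and> w \<cdot>\<^bsub>C\<^esub> i = u \<and> w \<cdot>\<^bsub>C\<^esub> j = v)))"

definition is_pullback :: "('o, 'm) precat \<Rightarrow> 'm \<Rightarrow> 'm \<Rightarrow> 'm \<Rightarrow> 'm \<Rightarrow> bool" where
  "is_pullback C f g p q \<longleftrightarrow>
     (\<exists>Q A B Z. f \<in> Hom C A Q \<and> g \<in> Hom C B Q \<and> p \<in> Hom C Z A \<and> q \<in> Hom C Z B \<and>
        f \<cdot>\<^bsub>C\<^esub> p = g \<cdot>\<^bsub>C\<^esub> q \<and>
        (\<forall>Y. \<forall>u \<in> Hom C Y A. \<forall>v \<in> Hom C Y B. f \<cdot>\<^bsub>C\<^esub> u = g \<cdot>\<^bsub>C\<^esub> v \<longrightarrow>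
           (\<exists>!w. w \<in> Hom C Y Z \<and> p \<cdot>\<^bsub>C\<^esub> w = u \<and> q \<cdot>\<^bsub>C\<^esub> w = v)))"

section \<open>Exact sequences\<close>

text \<open>The image of an arrow is the kernel of its cokernel.\<close>

definition is_image :: "('o, 'm) precat \<Rightarrow> 'm \<Rightarrow> 'm \<Rightarrow> bool" where
  "is_image C f m \<longleftrightarrow> (\<exists>c. is_cokernel C f c \<and> is_kernel C c m)"

definition exact_pair :: "('o, 'm) precat \<Rightarrow> 'm \<Rightarrow> 'm \<Rightarrow> bool" where
  "exact_pair C f g \<longleftrightarrow> f \<in> Arr C \<and> g \<in> Arr C \<and> Tgt C f = Src C g \<and>
     (\<exists>m. is_image C f m \<and> is_kernel C g m)"

text \<open>For a list \<open>fs\<close> of consecutive arrows from \<open>A\<close> to \<open>B\<close>, exactness of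
  \<open>0 \<rightarrow> A \<rightarrow> \<dots> \<rightarrow> B \<rightarrow> 0\<close> at all places. That consecutive arrows are composable, that the first
  one starts at \<open>A\<close> and that the last one ends at \<open>B\<close> is part of \<open>exact_pair\<close>.\<close>

definition exact_from_to :: "('o, 'm) precat \<Rightarrow> 'o \<Rightarrow> 'm list \<Rightarrow> 'o \<Rightarrow> bool" where
  "exact_from_to C A fs B \<longleftrightarrow> A \<in> Obj C \<and> B \<in> Obj C \<and>
     (\<exists>Z. is_zero_object C Z \<and> successively (exact_pair C) (Zero C Z A # fs @ [Zero C B Z]))"

definition short_exact :: "('o, 'm) precat \<Rightarrow> 'o \<Rightarrow> 'm \<Rightarrow> 'o \<Rightarrow> 'm \<Rightarrow> 'o \<Rightarrow> bool" where
  "short_exact C A f B g D \<longleftrightarrow>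
     f \<in> Hom C A B \<and> g \<in> Hom C B D \<and> exact_from_to C A [f, g] D"

section \<open>Yoneda Ext\<close>

text \<open>An \<open>n\<close>-extension \<open>0 \<rightarrow> P \<rightarrow> X\<^sub>n \<rightarrow> \<dots> \<rightarrow> X\<^sub>1 \<rightarrow> Q \<rightarrow> 0\<close> (with \<open>n \<ge> 1\<close>) is represented by the
  list of its \<open>n + 1\<close> arrows between \<open>P\<close> and \<open>Q\<close>.\<close>

definition extensions :: "('o, 'm) precat \<Rightarrow> nat \<Rightarrow> 'o \<Rightarrow> 'o \<Rightarrow> 'm list set" where
  "extensions C n Q P = {xs. length xs = Suc n \<and> exact_from_to C P xs Q}"

text \<open>Morphisms of \<open>n\<close>-extensions that are the identity on \<open>P\<close> and on \<open>Q\<close>; \<open>us\<close> lists the \<open>n + 2\<close>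
  vertical arrows.\<close>

definition extension_morphism ::
  "('o, 'm) precat \<Rightarrow> nat \<Rightarrow> 'o \<Rightarrow> 'o \<Rightarrow> 'm list \<Rightarrow> 'm list \<Rightarrow> 'm list \<Rightarrow> bool" where
  "extension_morphism C n Q P xs ys us \<longleftrightarrow>
     length us = n + 2 \<and> us ! 0 = Idn C P \<and> us ! (n + 1) = Idn C Q \<and>
     (\<forall>i \<le> n. us ! i \<in> Hom C (Src C (xs ! i)) (Src C (ys ! i)) \<and>
              us ! (i + 1) \<in> Hom C (Tgt C (xs ! i)) (Tgt C (ys ! i)) \<and>
              ys ! i \<cdot>\<^bsub>C\<^esub> us ! i = us ! (i + 1) \<cdot>\<^bsub>C\<^esub> xs ! i)"

definition extension_rel ::
  "('o, 'm) precat \<Rightarrow> nat \<Rightarrow> 'o \<Rightarrow> 'o \<Rightarrow> ('m list \<times> 'm list) set" where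
  "extension_rel C n Q P =
     {(xs, ys). xs \<in> extensions C n Q P \<and> ys \<in> extensions C n Q P \<and>
        (\<exists>us. extension_morphism C n Q P xs ys us)}"

text \<open>Yoneda equivalence is the equivalence relation on \<open>n\<close>-extensions generated by
  these morphisms.\<close>

definition yoneda_equiv ::
  "('o, 'm) precat \<Rightarrow> nat \<Rightarrow> 'o \<Rightarrow> 'o \<Rightarrow> ('m list \<times> 'm list) set" where
  "yoneda_equiv C n Q P =
     Restr ((extension_rel C n Q P \<union> (extension_rel C n Q P)\<inverse>)\<^sup>*) (extensions C n Q P)"

lemma equiv_yoneda_equiv: "equiv (extensions C n Q P) (yoneda_equiv C n Q P)"
proof -
  let ?r = "(extension_rel C n Q P \<union> (extension_rel C n Q P)\<inverse>)\<^sup>*"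
  have "sym ?r"
    by (intro sym_rtrancl sym_Un_converse)
  then have "sym (yoneda_equiv C n Q P)"
    unfolding yoneda_equiv_def sym_def by blast
  moreover have "trans (yoneda_equiv C n Q P)"
    unfolding yoneda_equiv_def by (intro transI) (auto intro: rtrancl_trans)
  moreover have "refl_on (extensions C n Q P) (yoneda_equiv C n Q P)"
    unfolding yoneda_equiv_def refl_on_def by auto
  ultimately show ?thesis
    by (intro equivI) (auto simp: yoneda_equiv_def)
qed

definition Ext :: "('o, 'm) precat \<Rightarrow> nat \<Rightarrow> 'o \<Rightarrow> 'o \<Rightarrow> 'm list set set" where
  "Ext C n Q P = extensions C n Q P // yoneda_equiv C n Q P"

definition ext_class ::
  "('o, 'm) precat \<Rightarrow> nat \<Rightarrow> 'o \<Rightarrow> 'o \<Rightarrow> 'm list \<Rightarrow> 'm list set" where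
  "ext_class C n Q P xs = yoneda_equiv C n Q P `` {xs}"

text \<open>Splicing \<open>0 \<rightarrow> P \<rightarrow> \<dots> \<rightarrow> R \<rightarrow> 0\<close> and \<open>0 \<rightarrow> R \<rightarrow> \<dots> \<rightarrow> Q \<rightarrow> 0\<close> at \<open>R\<close>, and the induced product
  \<open>Ext\<^sup>m(R, P) \<times> Ext\<^sup>n(Q, R) \<rightarrow> Ext\<^sup>m\<^sup>+\<^sup>n(Q, P)\<close>. As usual for operations on quotients, the union over all
  representatives is the common class of the results.\<close>

definition ext_splice :: "('o, 'm) precat \<Rightarrow> 'm list \<Rightarrow> 'm list \<Rightarrow> 'm list" where
  "ext_splice C xs ys = butlast xs @ [hd ys \<cdot>\<^bsub>C\<^esub> last xs] @ tl ys"

definition ext_cup ::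
  "('o, 'm) precat \<Rightarrow> nat \<Rightarrow> nat \<Rightarrow> 'o \<Rightarrow> 'o \<Rightarrow> 'm list set \<Rightarrow> 'm list set \<Rightarrow> 'm list set" where
  "ext_cup C m n Q P X Y = (\<Union>xs \<in> X. \<Union>ys \<in> Y. ext_class C (m + n) Q P (ext_splice C xs ys))"

text \<open>\<open>[a, b, c]\<close> is a Baer sum of the 2-extensions \<open>[a\<^sub>1, b\<^sub>1, c\<^sub>1]\<close> and \<open>[a\<^sub>2, b\<^sub>2, c\<^sub>2]\<close>: \<open>T\<close> (with
  coprojections \<open>i\<^sub>1, i\<^sub>2\<close>) is a pushout of \<open>a\<^sub>1, a\<^sub>2\<close>, \<open>Z\<close> (with projections \<open>p\<^sub>1, p\<^sub>2\<close>) is a pullback of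
  \<open>c\<^sub>1, c\<^sub>2\<close>, and \<open>b : T \<rightarrow> Z\<close> is the arrow induced by \<open>b\<^sub>1\<close> and \<open>b\<^sub>2\<close>, whose components
  \<open>T\<^sub>1 \<rightarrow> Z\<^sub>2\<close> and \<open>T\<^sub>2 \<rightarrow> Z\<^sub>1\<close> vanish.\<close>

definition is_Baer_sum ::
  "('o, 'm) precat \<Rightarrow> 'm list \<Rightarrow> 'm list \<Rightarrow> 'm list \<Rightarrow> bool" where
  "is_Baer_sum C xs ys zs \<longleftrightarrow>
     (\<exists>a1 b1 c1 a2 b2 c2 a b c i1 i2 p1 p2.
        xs = [a1, b1, c1] \<and> ys = [a2, b2, c2] \<and> zs = [a, b, c] \<and>
        is_pushout C a1 a2 i1 i2 \<and> is_pullback C c1 c2 p1 p2 \<and>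
        a = i1 \<cdot>\<^bsub>C\<^esub> a1 \<and> c = c1 \<cdot>\<^bsub>C\<^esub> p1 \<and>
        b \<in> Hom C (Tgt C i1) (Src C p1) \<and>
        p1 \<cdot>\<^bsub>C\<^esub> b \<cdot>\<^bsub>C\<^esub> i1 = b1 \<and>
        p2 \<cdot>\<^bsub>C\<^esub> b \<cdot>\<^bsub>C\<^esub> i2 = b2 \<and>
        p2 \<cdot>\<^bsub>C\<^esub> b \<cdot>\<^bsub>C\<^esub> i1 = Zero C (Src C i1) (Tgt C p2) \<and>
        p1 \<cdot>\<^bsub>C\<^esub> b \<cdot>\<^bsub>C\<^esub> i2 = Zero C (Src C i2) (Tgt C p1))"

definition Baer_sum ::
  "('o, 'm) precat \<Rightarrow> 'o \<Rightarrow> 'o \<Rightarrow> 'm list set \<Rightarrow> 'm list set \<Rightarrow> 'm list set" where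
  "Baer_sum C Q P X Y =
     \<Union> {ext_class C 2 Q P zs | xs ys zs. xs \<in> X \<and> ys \<in> Y \<and> is_Baer_sum C xs ys zs}"

text \<open>The zero of \<open>Ext\<^sup>2(Q, P)\<close> is the class of \<open>0 \<rightarrow> P = P \<rightarrow> Q = Q \<rightarrow> 0\<close> with zero map in the middle.\<close>

definition Ext2_zero :: "('o, 'm) precat \<Rightarrow> 'o \<Rightarrow> 'o \<Rightarrow> 'm list set" where
  "Ext2_zero C Q P = ext_class C 2 Q P [Idn C P, Zero C P Q, Idn C Q]"

end

theory Submission
  imports Defs
begin

text \<open>
  Write \<open>0 \<rightarrow> P \<rightarrow> T \<rightarrow> Z \<rightarrow> Q \<rightarrow> 0\<close> for the Baer sum of the two spliced extensions, with arrows \<open>a\<close>, \<open>b\<close>,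
  \<open>c\<close>, where \<open>T\<close> is the pushout of \<open>E\<close> and \<open>H\<close> under \<open>P\<close> and \<open>Z\<close> is the pullback of \<open>F\<close> and \<open>G\<close>
  over \<open>Q\<close>. Both sides of the equivalence say the same thing about this sequence: there is an object
  \<open>X\<close> with arrows \<open>m : T \<rightarrow> X\<close> and \<open>n : X \<rightarrow> Z\<close> such that \<open>n \<cdot> m = b\<close> and
  \<open>0 \<rightarrow> P \<rightarrow> X \<rightarrow> Z \<rightarrow> 0\<close> is exact with first arrow \<open>m \<cdot> a\<close>. Such an \<open>X\<close> is called a bridge below.

  A bridge is the middle object of a \<open>3 \<times> 3\<close> diagram. An arrow \<open>T \<rightarrow> X\<close> is a pair of arrows
  \<open>E \<rightarrow> X\<close> and \<open>H \<rightarrow> X\<close> that agree on \<open>P\<close>, an arrow \<open>X \<rightarrow> Z\<close> is a pair of arrows \<open>X \<rightarrow> F\<close> and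
  \<open>X \<rightarrow> G\<close> that agree on \<open>Q\<close>, and \<open>n \<cdot> m = b\<close> says in components that the squares through \<open>R\<close> and
  \<open>S\<close> commute and that the middle row and column compose to zero. Diagram chases translate exactness of
  \<open>0 \<rightarrow> P \<rightarrow> X \<rightarrow> Z \<rightarrow> 0\<close> into exactness of the middle row and column and back
  (\<open>nine_diagram_bridge\<close>, \<open>bridge_nine_diagram\<close>).

  A bridge exists if and only if the class of the extension is zero (\<open>bridged_iff_class_zero\<close>). The
  trivial extension has the biproduct of \<open>P\<close> and \<open>Q\<close> as a bridge, and along a morphism of extensions
  bridges can be transported in both directions: forwards by pushout along the left middle arrow
  (\<open>bridged_pushout\<close>), backwards by pullback along the right one (\<open>bridged_pullback\<close>). So having a
  bridge depends only on the Yoneda class. Conversely, a bridge gives an extension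
  \<open>0 \<rightarrow> P \<rightarrow> W \<rightarrow> X \<rightarrow> Q \<rightarrow> 0\<close>, where \<open>W\<close> is the biproduct of \<open>P\<close> and \<open>T\<close>, which
  maps both to the given extension and to the trivial one (\<open>bridge_split_extension\<close>).

  It remains to see that the class in the statement is the class of the Baer sum of the two given
  splices. Splicing and Baer sums are functorial for morphisms of extensions, so the unions over
  representatives that define them are unions of a single class (\<open>ext_cup_class\<close>,
  \<open>Baer_sum_class\<close>).

  All chases use generalized elements. An arrow \<open>x : Y \<rightarrow> B\<close> is an element of \<open>B\<close>, and it lies in the
  image of \<open>f : A \<rightarrow> B\<close> if it lifts to \<open>A\<close> after precomposition with some epic arrow into \<open>Y\<close>. Epic
  arrows and exact pairs are characterized by such liftings because epic arrows are stable under
  pullback (\<open>epic_lift\<close>, \<open>epic_iff_in_image\<close>, \<open>exact_pair_iff\<close>).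
\<close>

context abelian_category
begin

section \<open>Arithmetic of arrows\<close>

abbreviation plus_arrow (infixl \<open>\<oplus>\<close> 65) where
  "f \<oplus> g \<equiv> Add C f g"

text \<open>Typing side conditions are decided by the simplifier once membership in a hom-set is
  split into equations for source and target. For this reason the laws of the category are restated
  below with such equations as premises, so that every variable of a premise occurs in the left-hand
  side of the rewrite rule.\<close>

lemma Hom_iff:
  "f \<in> Hom C A B \<longleftrightarrow> f \<in> Arr C \<and> A \<in> Obj C \<and> B \<in> Obj C \<and> Src C f = A \<and> Tgt C f = B"
  using Src_Obj Tgt_Obj by (auto simp: Hom_def)

lemma Cmp_typing [simp]:
  assumes "f \<in> Arr C" "g \<in> Arr C" "Src C g = Tgt C f"
  shows "g \<cdot> f \<in> Arr C" "Src C (g \<cdot> f) = Src C f" "Tgt C (g \<cdot> f) = Tgt C g"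
  using Cmp_Hom[of f "Src C f" "Tgt C f" g "Tgt C g"] assms by (auto simp: Hom_def)

lemma Idn_typing [simp]:
  assumes "A \<in> Obj C"
  shows "Idn C A \<in> Arr C" "Src C (Idn C A) = A" "Tgt C (Idn C A) = A"
  using Idn_Hom[OF assms] by (auto simp: Hom_def)

lemma Zero_typing [simp]:
  assumes "A \<in> Obj C" "B \<in> Obj C"
  shows "Zero C A B \<in> Arr C" "Src C (Zero C A B) = A" "Tgt C (Zero C A B) = B"
proof -
  interpret comm_group "Hom_group C A B" by (rule Hom_comm_group[OF assms])
  have "Zero C A B \<in> Hom C A B" using one_closed by (simp add: Hom_group_def)
  then show "Zero C A B \<in> Arr C" "Src C (Zero C A B) = A" "Tgt C (Zero C A B) = B"
    by (auto simp: Hom_def)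
qed

lemma Add_Hom:
  assumes "f \<in> Hom C A B" "g \<in> Hom C A B"
  shows "f \<oplus> g \<in> Hom C A B"
proof -
  interpret comm_group "Hom_group C A B" using assms by (intro Hom_comm_group) (auto simp: Hom_iff)
  show ?thesis using m_closed[of f g] assms by (simp add: Hom_group_def)
qed

lemma Add_typing [simp]:
  assumes "f \<in> Arr C" "g \<in> Arr C" "Src C g = Src C f" "Tgt C g = Tgt C f"
  shows "f \<oplus> g \<in> Arr C" "Src C (f \<oplus> g) = Src C f" "Tgt C (f \<oplus> g) = Tgt C f"
  using Add_Hom[of f "Src C f" "Tgt C f" g] assms by (auto simp: Hom_def)

lemma Src_in_Obj [simp]: "f \<in> Arr C \<Longrightarrow> Src C f \<in> Obj C"
  and Tgt_in_Obj [simp]: "f \<in> Arr C \<Longrightarrow> Tgt C f \<in> Obj C"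
  by (fact Src_Obj Tgt_Obj)+

lemma Cmp_ac [simp]:
  "\<lbrakk>f \<in> Arr C; g \<in> Arr C; h \<in> Arr C; Src C g = Tgt C f; Src C h = Tgt C g\<rbrakk>
     \<Longrightarrow> (h \<cdot> g) \<cdot> f = h \<cdot> (g \<cdot> f)"
  by (rule Cmp_assoc) (auto simp: Hom_def)

lemma Cmp_reassoc:
  assumes "g \<cdot> f = h" "f \<in> Arr C" "g \<in> Arr C" "Src C g = Tgt C f" "x \<in> Arr C" "Tgt C x = Src C f"
  shows "g \<cdot> (f \<cdot> x) = h \<cdot> x"
  using assms Cmp_ac[of x f g] by auto

lemma Cmp_units [simp]:
  "\<lbrakk>f \<in> Arr C; Src C f = A\<rbrakk> \<Longrightarrow> f \<cdot> Idn C A = f"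
  "\<lbrakk>f \<in> Arr C; Tgt C f = A\<rbrakk> \<Longrightarrow> Idn C A \<cdot> f = f"
  using Cmp_Idn[of f A "Tgt C f"] Idn_Cmp[of f "Src C f" A] by (auto simp: Hom_def)

lemma Cmp_distrib [simp]:
  "\<lbrakk>f \<in> Arr C; f' \<in> Arr C; g \<in> Arr C; Src C f' = Src C f; Tgt C f' = Tgt C f; Src C g = Tgt C f\<rbrakk>
     \<Longrightarrow> g \<cdot> (f \<oplus> f') = (g \<cdot> f) \<oplus> (g \<cdot> f')"
  "\<lbrakk>f \<in> Arr C; h \<in> Arr C; h' \<in> Arr C; Src C h' = Src C h; Tgt C h' = Tgt C h; Src C h = Tgt C f\<rbrakk>
     \<Longrightarrow> (h \<oplus> h') \<cdot> f = (h \<cdot> f) \<oplus> (h' \<cdot> f)"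
  using Cmp_Add_right[of f "Src C f" "Tgt C f" f' g "Tgt C g"]
    Cmp_Add_left[of f "Src C f" "Tgt C f" h "Tgt C h" h'] by (auto simp: Hom_def)

lemma Add_assoc:
  "\<lbrakk>f \<in> Arr C; g \<in> Arr C; h \<in> Arr C; Src C g = Src C f; Tgt C g = Tgt C f;
     Src C h = Src C f; Tgt C h = Tgt C f\<rbrakk> \<Longrightarrow> (f \<oplus> g) \<oplus> h = f \<oplus> (g \<oplus> h)"
  using comm_groupE(3)[OF Hom_comm_group[of "Src C f" "Tgt C f"], of f g h]
  by (simp add: Hom_group_def Hom_def)

lemma Add_commute:
  "\<lbrakk>f \<in> Arr C; g \<in> Arr C; Src C g = Src C f; Tgt C g = Tgt C f\<rbrakk> \<Longrightarrow> f \<oplus> g = g \<oplus> f"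
  using comm_groupE(4)[OF Hom_comm_group[of "Src C f" "Tgt C f"], of f g]
  by (simp add: Hom_group_def Hom_def)

lemma Add_left_commute:
  "\<lbrakk>f \<in> Arr C; g \<in> Arr C; h \<in> Arr C; Src C g = Src C f; Tgt C g = Tgt C f;
     Src C h = Src C f; Tgt C h = Tgt C f\<rbrakk> \<Longrightarrow> f \<oplus> (g \<oplus> h) = g \<oplus> (f \<oplus> h)"
  by (metis Add_assoc Add_commute)

lemmas Add_ac = Add_assoc Add_commute Add_left_commute

lemma Add_Zero [simp]:
  assumes "f \<in> Arr C" "Src C f = A" "Tgt C f = B"
  shows "Zero C A B \<oplus> f = f" "f \<oplus> Zero C A B = f"
proof -
  show *: "Zero C A B \<oplus> f = f"
    using comm_groupE(5)[OF Hom_comm_group[of A B], of f] assms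
    by (auto simp: Hom_group_def Hom_def)
  show "f \<oplus> Zero C A B = f"
    using * Add_commute[of f "Zero C A B"] assms by auto
qed

text \<open>Negatives are only ever needed to cancel or to form one difference, so an existence
  statement serves in place of an operation.\<close>

lemma Add_inverse:
  assumes "f \<in> Hom C A B"
  obtains g where "g \<in> Hom C A B" "f \<oplus> g = Zero C A B" "g \<oplus> f = Zero C A B"
proof -
  have AB: "A \<in> Obj C" "B \<in> Obj C" using assms by (auto simp: Hom_iff)
  obtain g where g: "g \<in> Hom C A B" "g \<oplus> f = Zero C A B"
    using comm_groupE(6)[OF Hom_comm_group[OF AB], of f] assms by (auto simp: Hom_group_def)
  moreover from this have "f \<oplus> g = Zero C A B" 
    using Add_commute[of f g] assms by (auto simp: Hom_iff)
  ultimately show ?thesis using that by blast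
qed

lemma Add_left_cancel:
  assumes "f \<in> Hom C A B" "g \<in> Hom C A B" "h \<in> Hom C A B" "f \<oplus> g = f \<oplus> h"
  shows "g = h"
proof -
  obtain k where k: "k \<in> Hom C A B" "k \<oplus> f = Zero C A B"
    using assms(1) by (rule Add_inverse)
  have "(k \<oplus> f) \<oplus> g = (k \<oplus> f) \<oplus> h"
    using assms k(1) Add_assoc[of k f g] Add_assoc[of k f h] by (simp add: Hom_iff)
  then show ?thesis using assms k by (simp add: Hom_iff)
qed

text \<open>Composition is additive in each argument, so \<open>f \<cdot> 0\<close> and \<open>0 \<cdot> f\<close> are
  idempotent for the addition and hence zero.\<close>

lemma Cmp_Zero [simp]:
  assumes "f \<in> Arr C"
  shows "\<lbrakk>Src C f = B; A \<in> Obj C\<rbrakk> \<Longrightarrow> f \<cdot> Zero C A B = Zero C A (Tgt C f)"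
    and "\<lbrakk>Tgt C f = B; D \<in> Obj C\<rbrakk> \<Longrightarrow> Zero C B D \<cdot> f = Zero C (Src C f) D"
proof -
  assume A: "Src C f = B" "A \<in> Obj C"
  then have B: "B \<in> Obj C" using assms by auto
  let ?z = "f \<cdot> Zero C A B"
  have "f \<cdot> (Zero C A B \<oplus> Zero C A B) = ?z \<oplus> ?z"
    using assms A B by (simp del: Add_Zero)
  then have "?z \<oplus> ?z = ?z \<oplus> Zero C A (Tgt C f)" using assms A B by simp
  moreover have "?z \<in> Hom C A (Tgt C f)" "Zero C A (Tgt C f) \<in> Hom C A (Tgt C f)"
    using assms A B by (auto simp: Hom_iff)
  ultimately show "?z = Zero C A (Tgt C f)" using Add_left_cancel by blast
next
  assume A: "Tgt C f = B" "D \<in> Obj C"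
  then have B: "B \<in> Obj C" using assms by auto
  let ?z = "Zero C B D \<cdot> f"
  have "(Zero C B D \<oplus> Zero C B D) \<cdot> f = ?z \<oplus> ?z"
    using assms A B by (simp del: Add_Zero)
  then have "?z \<oplus> ?z = ?z \<oplus> Zero C (Src C f) D" using assms A B by simp
  moreover have "?z \<in> Hom C (Src C f) D" "Zero C (Src C f) D \<in> Hom C (Src C f) D"
    using assms A B by (auto simp: Hom_iff)
  ultimately show "?z = Zero C (Src C f) D" using Add_left_cancel by blast
qed

section \<open>Monic and epic arrows, kernels and cokernels\<close>

lemma monic_iff:
  "is_monic C f \<longleftrightarrow> f \<in> Arr C \<and>
     (\<forall>Y. \<forall>x \<in> Hom C Y (Src C f). f \<cdot> x = Zero C Y (Tgt C f) \<longrightarrow> x = Zero C Y (Src C f))"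
    (is "_ \<longleftrightarrow> ?R")
proof
  assume f: "is_monic C f"
  show ?R
  proof (intro conjI allI ballI impI)
    show "f \<in> Arr C" using f by (simp add: is_monic_def)
    fix Y x assume x: "x \<in> Hom C Y (Src C f)" "f \<cdot> x = Zero C Y (Tgt C f)"
    then have "f \<cdot> x = f \<cdot> Zero C Y (Src C f)" using \<open>f \<in> Arr C\<close> by (simp add: Hom_iff)
    moreover have "Zero C Y (Src C f) \<in> Hom C Y (Src C f)"
      using x \<open>f \<in> Arr C\<close> by (auto simp: Hom_iff)
    ultimately show "x = Zero C Y (Src C f)"
      using f x(1) unfolding is_monic_def by blast
  qed
next
  assume R: ?R
  show "is_monic C f"
    unfolding is_monic_def
  proof (intro conjI allI ballI impI)
    show f: "f \<in> Arr C" using R by simp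
    fix Y x y assume xy: "x \<in> Hom C Y (Src C f)" "y \<in> Hom C Y (Src C f)" "f \<cdot> x = f \<cdot> y"
    obtain z where z: "z \<in> Hom C Y (Src C f)" "y \<oplus> z = Zero C Y (Src C f)" "z \<oplus> y = Zero C Y (Src C f)"
      using xy(2) by (rule Add_inverse)
    have "f \<cdot> (z \<oplus> x) = f \<cdot> (z \<oplus> y)" using xy z(1) f by (simp add: Hom_iff)
    then have "f \<cdot> (z \<oplus> x) = Zero C Y (Tgt C f)" using xy z f by (simp add: Hom_iff)
    moreover have "z \<oplus> x \<in> Hom C Y (Src C f)" using z(1) xy(1) by (rule Add_Hom)
    ultimately have "z \<oplus> x = Zero C Y (Src C f)" using R by blast
    then have "z \<oplus> x = z \<oplus> y" using z by simp
    then show "x = y" by (rule Add_left_cancel[OF z(1) xy(1,2)])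
  qed
qed

lemma epic_iff:
  "is_epic C f \<longleftrightarrow> f \<in> Arr C \<and>
     (\<forall>Y. \<forall>x \<in> Hom C (Tgt C f) Y. x \<cdot> f = Zero C (Src C f) Y \<longrightarrow> x = Zero C (Tgt C f) Y)"
    (is "_ \<longleftrightarrow> ?R")
proof
  assume f: "is_epic C f"
  show ?R
  proof (intro conjI allI ballI impI)
    show "f \<in> Arr C" using f by (simp add: is_epic_def)
    fix Y x assume x: "x \<in> Hom C (Tgt C f) Y" "x \<cdot> f = Zero C (Src C f) Y"
    then have "x \<cdot> f = Zero C (Tgt C f) Y \<cdot> f" using \<open>f \<in> Arr C\<close> by (simp add: Hom_iff)
    moreover have "Zero C (Tgt C f) Y \<in> Hom C (Tgt C f) Y"
      using x \<open>f \<in> Arr C\<close> by (auto simp: Hom_iff)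
    ultimately show "x = Zero C (Tgt C f) Y"
      using f x(1) unfolding is_epic_def by blast
  qed
next
  assume R: ?R
  show "is_epic C f"
    unfolding is_epic_def
  proof (intro conjI allI ballI impI)
    show f: "f \<in> Arr C" using R by simp
    fix Y x y assume xy: "x \<in> Hom C (Tgt C f) Y" "y \<in> Hom C (Tgt C f) Y" "x \<cdot> f = y \<cdot> f"
    obtain z where z: "z \<in> Hom C (Tgt C f) Y" "y \<oplus> z = Zero C (Tgt C f) Y" "z \<oplus> y = Zero C (Tgt C f) Y"
      using xy(2) by (rule Add_inverse)
    have "(z \<oplus> x) \<cdot> f = (z \<oplus> y) \<cdot> f" using xy z(1) f by (simp add: Hom_iff)
    then have "(z \<oplus> x) \<cdot> f = Zero C (Src C f) Y" using xy z f by (simp add: Hom_iff)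
    moreover have "z \<oplus> x \<in> Hom C (Tgt C f) Y" using z(1) xy(1) by (rule Add_Hom)
    ultimately have "z \<oplus> x = Zero C (Tgt C f) Y" using R by blast
    then have "z \<oplus> x = z \<oplus> y" using z by simp
    then show "x = y" by (rule Add_left_cancel[OF z(1) xy(1,2)])
  qed
qed

lemma monic_Arr: "is_monic C f \<Longrightarrow> f \<in> Arr C" and epic_Arr: "is_epic C f \<Longrightarrow> f \<in> Arr C"
  by (simp_all add: is_monic_def is_epic_def)

lemma epic_cancel:
  assumes "is_epic C f" "g \<cdot> f = h \<cdot> f" "g \<in> Hom C (Tgt C f) B" "h \<in> Hom C (Tgt C f) B"
  shows "g = h"
  using assms unfolding is_epic_def by blast

lemma monic_cancel:
  assumes "is_monic C f" "f \<cdot> g = f \<cdot> h" "g \<in> Hom C A (Src C f)" "h \<in> Hom C A (Src C f)"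
  shows "g = h"
  using assms unfolding is_monic_def by blast

lemma epic_Idn: "A \<in> Obj C \<Longrightarrow> is_epic C (Idn C A)"
  by (auto simp: is_epic_def Hom_iff)

lemma monic_Idn: "A \<in> Obj C \<Longrightarrow> is_monic C (Idn C A)"
  by (auto simp: is_monic_def Hom_iff)

lemma epic_Cmp:
  assumes "is_epic C f" "is_epic C g" "Src C g = Tgt C f"
  shows "is_epic C (g \<cdot> f)"
  unfolding epic_iff
proof (intro conjI allI ballI impI)
  note fg = epic_Arr[OF assms(1)] epic_Arr[OF assms(2)] assms(3)
  show "g \<cdot> f \<in> Arr C" using fg by simp
  fix Y x assume x: "x \<in> Hom C (Tgt C (g \<cdot> f)) Y" "x \<cdot> (g \<cdot> f) = Zero C (Src C (g \<cdot> f)) Y"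
  have "x \<cdot> g = Zero C (Tgt C f) Y"
    using assms(1) x fg unfolding epic_iff by (auto simp: Hom_iff)
  then show "x = Zero C (Tgt C (g \<cdot> f)) Y"
    using assms(2) x fg unfolding epic_iff by (auto simp: Hom_iff)
qed

lemma monic_Cmp:
  assumes "is_monic C f" "is_monic C g" "Src C g = Tgt C f"
  shows "is_monic C (g \<cdot> f)"
  unfolding monic_iff
proof (intro conjI allI ballI impI)
  note fg = monic_Arr[OF assms(1)] monic_Arr[OF assms(2)] assms(3)
  show "g \<cdot> f \<in> Arr C" using fg by simp
  fix Y x assume x: "x \<in> Hom C Y (Src C (g \<cdot> f))" "(g \<cdot> f) \<cdot> x = Zero C Y (Tgt C (g \<cdot> f))"
  have "f \<cdot> x = Zero C Y (Tgt C f)"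
    using assms(2) x fg unfolding monic_iff by (auto simp: Hom_iff)
  then show "x = Zero C Y (Src C (g \<cdot> f))"
    using assms(1) x fg unfolding monic_iff by (auto simp: Hom_iff)
qed

lemma epic_factor:
  assumes "is_epic C (g \<cdot> f)" "f \<in> Arr C" "g \<in> Arr C" "Src C g = Tgt C f"
  shows "is_epic C g"
  unfolding epic_iff
proof (intro conjI allI ballI impI)
  fix Y x assume x: "x \<in> Hom C (Tgt C g) Y" "x \<cdot> g = Zero C (Src C g) Y"
  have "x \<cdot> (g \<cdot> f) = (x \<cdot> g) \<cdot> f" using assms x(1) by (auto simp: Hom_iff)
  also have "\<dots> = Zero C (Src C f) Y" using assms x by (auto simp: Hom_iff)
  finally show "x = Zero C (Tgt C g) Y"
    using assms x(1) unfolding epic_iff by (auto simp: Hom_iff)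
qed (use assms in auto)

lemma kernel_monic:
  assumes "is_kernel C f k" shows "is_monic C k"
  unfolding is_monic_def
proof (intro conjI allI ballI impI)
  show k: "k \<in> Arr C" using assms by (simp add: is_kernel_def)
  fix A x y assume xy: "x \<in> Hom C A (Src C k)" "y \<in> Hom C A (Src C k)" "k \<cdot> x = k \<cdot> y"
  have f: "f \<in> Arr C" "Tgt C k = Src C f" "f \<cdot> k = Zero C (Src C k) (Tgt C f)"
    using assms by (auto simp: is_kernel_def)
  have "(f \<cdot> k) \<cdot> x = Zero C A (Tgt C f)" unfolding f(3) using f k xy by (auto simp: Hom_iff)
  then have "f \<cdot> (k \<cdot> x) = Zero C A (Tgt C f)" using f(1,2) k xy(1) by (auto simp: Hom_iff)
  moreover have "k \<cdot> x \<in> Hom C A (Src C f)" using f k xy by (auto simp: Hom_iff)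
  ultimately have "\<exists>!u. u \<in> Hom C A (Src C k) \<and> k \<cdot> u = k \<cdot> x"
    using assms by (simp add: is_kernel_def)
  then show "x = y" using xy by metis
qed

lemma cokernel_epic:
  assumes "is_cokernel C f k" shows "is_epic C k"
  unfolding is_epic_def
proof (intro conjI allI ballI impI)
  show k: "k \<in> Arr C" using assms by (simp add: is_cokernel_def)
  fix A x y assume xy: "x \<in> Hom C (Tgt C k) A" "y \<in> Hom C (Tgt C k) A" "x \<cdot> k = y \<cdot> k"
  have f: "f \<in> Arr C" "Src C k = Tgt C f" "k \<cdot> f = Zero C (Src C f) (Tgt C k)"
    using assms by (auto simp: is_cokernel_def)
  have "x \<cdot> (k \<cdot> f) = Zero C (Src C f) A" unfolding f(3) using f k xy(1) by (auto simp: Hom_iff)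
  then have "(x \<cdot> k) \<cdot> f = Zero C (Src C f) A" using f k xy(1) by (auto simp: Hom_iff)
  moreover have "x \<cdot> k \<in> Hom C (Tgt C f) A" using f k xy by (auto simp: Hom_iff)
  ultimately have "\<exists>!u. u \<in> Hom C (Tgt C k) A \<and> u \<cdot> k = x \<cdot> k"
    using assms by (simp add: is_cokernel_def)
  then show "x = y" using xy by metis
qed

lemma kernel_lift:
  assumes "is_kernel C f k" "x \<in> Hom C A (Src C f)" "f \<cdot> x = Zero C A (Tgt C f)"
  obtains u where "u \<in> Hom C A (Src C k)" "k \<cdot> u = x"
  using assms unfolding is_kernel_def by blast

lemma cokernel_extend:
  assumes "is_cokernel C f c" "x \<in> Hom C (Tgt C f) B" "x \<cdot> f = Zero C (Src C f) B"
  obtains u where "u \<in> Hom C (Tgt C c) B" "u \<cdot> c = x"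
  using assms unfolding is_cokernel_def by blast

lemma kernelI:
  assumes "f \<in> Arr C" "is_monic C k" "Tgt C k = Src C f" "f \<cdot> k = Zero C (Src C k) (Tgt C f)"
    and "\<And>A x. \<lbrakk>x \<in> Hom C A (Src C f); f \<cdot> x = Zero C A (Tgt C f)\<rbrakk> \<Longrightarrow> \<exists>u \<in> Hom C A (Src C k). k \<cdot> u = x"
  shows "is_kernel C f k"
  unfolding is_kernel_def
  using assms(1-4) monic_Arr[OF assms(2)] assms(5) monic_cancel[OF assms(2)] by metis

text \<open>A monic arrow is the kernel of some \<open>g\<close>, and \<open>g\<close> factors through the
  cokernel; hence whatever the cokernel kills is also killed by \<open>g\<close> and lifts.\<close>

lemma monic_kernel_of_cokernel:
  assumes "is_monic C k" "is_cokernel C k c"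
  shows "is_kernel C c k"
proof (rule kernelI)
  have c: "c \<in> Arr C" "k \<in> Arr C" "Src C c = Tgt C k" "c \<cdot> k = Zero C (Src C k) (Tgt C c)"
    using assms(2) by (auto simp: is_cokernel_def)
  then show "c \<in> Arr C" "is_monic C k" "Tgt C k = Src C c" "c \<cdot> k = Zero C (Src C k) (Tgt C c)"
    using assms(1) by auto
  obtain g where g: "is_kernel C g k" using monic_is_kernel[OF assms(1)] by blast
  then have g': "g \<in> Hom C (Tgt C k) (Tgt C g)" "g \<cdot> k = Zero C (Src C k) (Tgt C g)" "Src C g = Tgt C k"
    by (auto simp: is_kernel_def Hom_iff)
  obtain d where d: "d \<in> Hom C (Tgt C c) (Tgt C g)" "d \<cdot> c = g"
    using cokernel_extend[OF assms(2) g'(1,2)] by blast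
  fix A x assume x: "x \<in> Hom C A (Src C c)" "c \<cdot> x = Zero C A (Tgt C c)"
  have "(d \<cdot> c) \<cdot> x = Zero C A (Tgt C g)" using c d(1) x by (auto simp: Hom_iff)
  then have "g \<cdot> x = Zero C A (Tgt C g)" using d by simp
  moreover have "x \<in> Hom C A (Src C g)" using x c g' by simp
  ultimately show "\<exists>u \<in> Hom C A (Src C k). k \<cdot> u = x"
    by (metis kernel_lift[OF g])
qed

text \<open>Dually to the previous lemma, an epic arrow is the cokernel of its kernel.\<close>

lemma epic_extend:
  assumes "is_epic C c" "is_kernel C c k" "x \<in> Hom C (Src C c) B" "x \<cdot> k = Zero C (Src C k) B"
  obtains u where "u \<in> Hom C (Tgt C c) B" "u \<cdot> c = x"
proof -
  obtain g where g: "is_cokernel C g c" using epic_is_cokernel[OF assms(1)] by blast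
  then have g': "g \<in> Hom C (Src C g) (Src C c)" "c \<cdot> g = Zero C (Src C g) (Tgt C c)" "Tgt C g = Src C c"
    by (auto simp: is_cokernel_def Hom_iff)
  have k: "k \<in> Arr C" "Tgt C k = Src C c" using assms(2) by (auto simp: is_kernel_def)
  obtain d where d: "d \<in> Hom C (Src C g) (Src C k)" "k \<cdot> d = g"
    using kernel_lift[OF assms(2) g'(1,2)] by blast
  have "(x \<cdot> k) \<cdot> d = Zero C (Src C g) B" using d(1) assms(3,4) by (auto simp: Hom_iff)
  then have "x \<cdot> g = Zero C (Src C g) B" using d assms(3) k by (auto simp: Hom_iff)
  moreover have "x \<in> Hom C (Tgt C g) B" using assms(3) g'(3) by simp
  ultimately show ?thesis using cokernel_extend[OF g] that by metis
qed

section \<open>Images, and lifting along epic arrows\<close>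

text \<open>The factor \<open>e\<close> of \<open>f = m \<cdot> e\<close> is epic for the following reason. If
  \<open>x \<cdot> e = 0\<close>, then \<open>f\<close> factors through the subobject \<open>m \<cdot> k\<close>, where \<open>k\<close> is the kernel of \<open>x\<close>. This
  subobject is a kernel of some \<open>d\<close>, which kills \<open>f\<close> and therefore factors through the cokernel of \<open>f\<close>;
  so \<open>d\<close> kills \<open>m\<close> as well, \<open>m\<close> factors through \<open>m \<cdot> k\<close>, and \<open>k\<close> has a right inverse.\<close>

lemma image_factorization:
  assumes "is_image C f m"
  obtains e where "e \<in> Hom C (Src C f) (Src C m)" "m \<cdot> e = f" "is_epic C e"
proof -
  obtain c where c: "is_cokernel C f c" "is_kernel C c m" using assms by (auto simp: is_image_def)
  have f: "f \<in> Arr C" "c \<in> Arr C" "Src C c = Tgt C f" "c \<cdot> f = Zero C (Src C f) (Tgt C c)"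
    using c(1) by (auto simp: is_cokernel_def)
  have m: "m \<in> Arr C" "Tgt C m = Tgt C f" "c \<cdot> m = Zero C (Src C m) (Tgt C c)"
    using c(2) f by (auto simp: is_kernel_def)
  have "f \<in> Hom C (Src C f) (Src C c)" using f by (auto simp: Hom_iff)
  then obtain e where e: "e \<in> Hom C (Src C f) (Src C m)" "m \<cdot> e = f"
    using kernel_lift[OF c(2) _ f(4)] by blast
  have "is_epic C e" unfolding epic_iff
  proof (intro conjI allI ballI impI)
    show "e \<in> Arr C" using e by (simp add: Hom_iff)
    fix Y x assume x: "x \<in> Hom C (Tgt C e) Y" "x \<cdot> e = Zero C (Src C e) Y"
    obtain k where k: "is_kernel C x k" using kernel_exists x by (auto simp: Hom_iff)
    have k': "k \<in> Arr C" "Tgt C k = Src C m" "x \<cdot> k = Zero C (Src C k) Y"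
      using k x(1) e(1) by (auto simp: is_kernel_def Hom_iff)
    have "e \<in> Hom C (Src C f) (Src C x)" "x \<cdot> e = Zero C (Src C f) (Tgt C x)"
      using x e(1) by (auto simp: Hom_iff)
    then obtain e' where e': "e' \<in> Hom C (Src C f) (Src C k)" "k \<cdot> e' = e"
      using kernel_lift[OF k] by blast
    have "is_monic C (m \<cdot> k)"
      using kernel_monic[OF k] kernel_monic[OF c(2)] k' by (intro monic_Cmp) auto
    then obtain d where d: "is_kernel C d (m \<cdot> k)" using monic_is_kernel by blast
    have d': "d \<in> Hom C (Tgt C f) (Tgt C d)" "d \<cdot> (m \<cdot> k) = Zero C (Src C k) (Tgt C d)"
      using d m k' by (auto simp: is_kernel_def Hom_iff)
    have "d \<cdot> f = (d \<cdot> (m \<cdot> k)) \<cdot> e'"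
      using d'(1) m k' e' e by (auto simp: Hom_iff)
    also have "\<dots> = Zero C (Src C f) (Tgt C d)"
      unfolding d'(2) using e' d' by (auto simp: Hom_iff)
    finally obtain w where w: "w \<in> Hom C (Tgt C c) (Tgt C d)" "w \<cdot> c = d"
      using cokernel_extend[OF c(1) d'(1)] by blast
    have "d \<cdot> m = (w \<cdot> c) \<cdot> m" unfolding w(2) ..
    also have "\<dots> = w \<cdot> (c \<cdot> m)" using w(1) m(1,2) f(1-3) by (intro Cmp_ac) (auto simp: Hom_iff)
    also have "\<dots> = Zero C (Src C m) (Tgt C d)" unfolding m(3) using m(1) w(1) by (auto simp: Hom_iff)
    finally have dm: "d \<cdot> m = Zero C (Src C m) (Tgt C d)" .
    have "m \<in> Hom C (Src C m) (Src C d)" using m d' by (auto simp: Hom_iff)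
    then obtain v where v: "v \<in> Hom C (Src C m) (Src C k)" "(m \<cdot> k) \<cdot> v = m"
      using kernel_lift[OF d _ dm] m k' by auto
    have "k \<cdot> v = Idn C (Src C m)"
      using kernel_monic[OF c(2)]
      by (rule monic_cancel[where A = "Src C m"]) (use v m k' in \<open>auto simp: Hom_iff\<close>)
    then have "x = x \<cdot> (k \<cdot> v)" using x(1) e(1) by (auto simp: Hom_iff)
    also have "\<dots> = (x \<cdot> k) \<cdot> v" using x(1) e(1) v(1) k'(1,2) by (auto simp: Hom_iff)
    also have "\<dots> = Zero C (Tgt C e) Y" unfolding k'(3) using x(1) v(1) e(1) by (auto simp: Hom_iff)
    finally show "x = Zero C (Tgt C e) Y" .
  qed
  with e show ?thesis using that by blast
qed

text \<open>Stability of epic arrows under pullback. The pullback of \<open>f\<close> and \<open>x\<close> is the kernel \<open>k\<close> of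
  \<open>g = (f, -x)\<close> on the biproduct. Since \<open>g\<close> is epic, it is the cokernel of \<open>k\<close>. An arrow \<open>h\<close> that kills
  the projection \<open>q \<cdot> k\<close> to \<open>Y\<close> therefore makes \<open>h \<cdot> q\<close> factor through \<open>g\<close>, by an arrow \<open>w\<close>, and
  restriction to the first summand shows that \<open>w \<cdot> f = 0\<close>; as \<open>f\<close> is epic, \<open>w = 0\<close>.\<close>

lemma epic_lift:
  assumes "is_epic C f" "x \<in> Hom C Y (Tgt C f)"
  obtains Z p y where "p \<in> Hom C Z Y" "is_epic C p" "y \<in> Hom C Z (Src C f)" "f \<cdot> y = x \<cdot> p"
proof -
  have f: "f \<in> Arr C" "f \<in> Hom C (Src C f) (Tgt C f)" using epic_Arr[OF assms(1)] by (auto simp: Hom_iff)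
  have Y: "Y \<in> Obj C" using assms by (auto simp: Hom_iff)
  obtain W i j p q where W: "i \<in> Hom C (Src C f) W" "j \<in> Hom C Y W" "p \<in> Hom C W (Src C f)"
      "q \<in> Hom C W Y" "p \<cdot> i = Idn C (Src C f)" "q \<cdot> j = Idn C Y"
      "p \<cdot> j = Zero C Y (Src C f)" "q \<cdot> i = Zero C (Src C f) Y"
    using biproduct_exists[of "Src C f" Y] f Y by auto
  obtain x' where x': "x' \<in> Hom C Y (Tgt C f)" "x \<oplus> x' = Zero C Y (Tgt C f)"
    using assms(2) by (rule Add_inverse)
  define g where "g = (f \<cdot> p) \<oplus> (x' \<cdot> q)"
  have g: "g \<in> Hom C W (Tgt C f)" using W x' f by (auto simp: g_def Hom_iff)
  have gi: "g \<cdot> i = f" using W x' f by (auto simp: g_def Hom_iff)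
  then have ge: "is_epic C g" 
    using epic_factor[of g i] assms(1) g W(1) by (auto simp: Hom_iff)
  obtain k where k: "is_kernel C g k" using kernel_exists g by (auto simp: Hom_iff)
  have k': "k \<in> Hom C (Src C k) W" "g \<cdot> k = Zero C (Src C k) (Tgt C f)"
    using k g by (auto simp: is_kernel_def Hom_iff)
  have epi: "is_epic C (q \<cdot> k)" unfolding epic_iff
  proof (intro conjI allI ballI impI)
    show "q \<cdot> k \<in> Arr C" using W k' by (auto simp: Hom_iff)
    fix B h assume "h \<in> Hom C (Tgt C (q \<cdot> k)) B" "h \<cdot> (q \<cdot> k) = Zero C (Src C (q \<cdot> k)) B"
    then have h: "h \<in> Hom C Y B" "(h \<cdot> q) \<cdot> k = Zero C (Src C k) B"
      using W k' by (auto simp: Hom_iff)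
    have "h \<cdot> q \<in> Hom C (Src C g) B" using h W g by (auto simp: Hom_iff)
    then obtain w where w: "w \<in> Hom C (Tgt C g) B" "w \<cdot> g = h \<cdot> q"
      using epic_extend[OF ge k _ h(2)] by blast
    have "w \<cdot> f = (w \<cdot> g) \<cdot> i" using w(1) g W(1) gi by (auto simp: Hom_iff)
    also have "\<dots> = h \<cdot> (q \<cdot> i)" unfolding w(2) using h W by (auto simp: Hom_iff)
    also have "\<dots> = Zero C (Src C f) B" unfolding W(8) using h W by (auto simp: Hom_iff)
    finally have "w = Zero C (Tgt C f) B"
      using assms(1) w(1) g unfolding epic_iff by (auto simp: Hom_iff)
    then have hq: "h \<cdot> q = Zero C W B" using w g by (auto simp: Hom_iff)
    have "h = (h \<cdot> q) \<cdot> j" using h W by (auto simp: Hom_iff)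
    also have "\<dots> = Zero C Y B" unfolding hq using h W by (auto simp: Hom_iff)
    finally show "h = Zero C (Tgt C (q \<cdot> k)) B" using W k' by (auto simp: Hom_iff)
  qed
  have pk: "p \<cdot> k \<in> Hom C (Src C k) (Src C f)" and qk: "q \<cdot> k \<in> Hom C (Src C k) Y"
    using W k' by (auto simp: Hom_iff)
  let ?X = "x \<cdot> (q \<cdot> k)" and ?X1 = "x' \<cdot> (q \<cdot> k)" and ?F = "f \<cdot> (p \<cdot> k)"
  have tp: "?X \<in> Hom C (Src C k) (Tgt C f)" "?X1 \<in> Hom C (Src C k) (Tgt C f)"
      "?F \<in> Hom C (Src C k) (Tgt C f)"
    using Cmp_Hom[OF qk assms(2)] Cmp_Hom[OF qk x'(1)] Cmp_Hom[OF pk f(2)] by blast+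
  \<comment> \<open>With \<open>x'\<close> the negative of \<open>x\<close>, the equation \<open>g \<cdot> k = 0\<close> says that the two legs of \<open>k\<close> agree.\<close>
  have "?X \<oplus> ?X1 = (x \<oplus> x') \<cdot> (q \<cdot> k)"
    using Cmp_Add_left[OF qk assms(2) x'(1)] by simp
  also have "\<dots> = Zero C (Src C k) (Tgt C f)"
    unfolding x'(2) using qk f by (auto simp: Hom_iff)
  also have "\<dots> = ?F \<oplus> ?X1"
    using k' W f x' unfolding g_def by (auto simp: Hom_iff)
  finally have "?X1 \<oplus> ?F = ?X1 \<oplus> ?X"
    using Add_commute[of ?X1 ?X] Add_commute[of ?X1 ?F] tp unfolding Hom_iff by metis
  then have "?F = ?X"
    by (rule Add_left_cancel[OF tp(2) tp(3) tp(1)])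
  then show ?thesis using that[OF qk epi pk] by blast
qed

section \<open>Exactness in terms of generalized elements\<close>

text \<open>Membership of the generalized element \<open>x\<close> in the image of \<open>f\<close>: a lift exists after
  passing to an epic cover \<open>p\<close> of the domain of \<open>x\<close>.\<close>

definition in_image :: "'m \<Rightarrow> 'm \<Rightarrow> bool" where
  "in_image f x \<longleftrightarrow>
     (\<exists>Z p y. p \<in> Hom C Z (Src C x) \<and> is_epic C p \<and> y \<in> Hom C Z (Src C f) \<and> f \<cdot> y = x \<cdot> p)"

lemma in_imageI:
  assumes "f \<in> Arr C" "y \<in> Hom C Y (Src C f)"
  shows "in_image f (f \<cdot> y)"
  unfolding in_image_def
  by (rule exI[of _ Y], rule exI[of _ "Idn C Y"], rule exI[of _ y])
     (use assms epic_Idn[of Y] in \<open>auto simp: Hom_iff\<close>)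

text \<open>Membership in an image is local. In a chase this allows elements to be replaced by their
  restrictions to epic covers as often as necessary.\<close>

lemma in_image_cover:
  assumes "in_image f (x \<cdot> p)" "p \<in> Hom C Z Y" "is_epic C p" "x \<in> Hom C Y B"
  shows "in_image f x"
proof -
  have "Src C (x \<cdot> p) = Z" using assms by (auto simp: Hom_iff)
  then obtain W q y where q: "q \<in> Hom C W Z" "is_epic C q" "y \<in> Hom C W (Src C f)" "f \<cdot> y = (x \<cdot> p) \<cdot> q"
    using assms(1) unfolding in_image_def by auto
  have "is_epic C (p \<cdot> q)" using assms q by (intro epic_Cmp) (auto simp: Hom_iff)
  moreover have "p \<cdot> q \<in> Hom C W (Src C x)" "(x \<cdot> p) \<cdot> q = x \<cdot> (p \<cdot> q)"
    using assms(2,4) q(1) by (auto simp: Hom_iff)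
  ultimately show ?thesis unfolding in_image_def using q by metis
qed

lemma epic_iff_in_image:
  "is_epic C f \<longleftrightarrow> f \<in> Arr C \<and> (\<forall>Y. \<forall>x \<in> Hom C Y (Tgt C f). in_image f x)" (is "_ \<longleftrightarrow> ?R")
proof
  assume f: "is_epic C f"
  have "in_image f x" if x: "x \<in> Hom C Y (Tgt C f)" for Y x
  proof -
    have "Src C x = Y" using x by (simp add: Hom_def)
    then show ?thesis unfolding in_image_def using epic_lift[OF f x] by metis
  qed
  then show ?R using epic_Arr[OF f] by blast
next
  assume R: ?R
  then have f: "f \<in> Arr C" by simp
  then have T: "Idn C (Tgt C f) \<in> Hom C (Tgt C f) (Tgt C f)" by (simp add: Hom_iff)
  then obtain Z p y where p: "p \<in> Hom C Z (Tgt C f)" "is_epic C p" "y \<in> Hom C Z (Src C f)"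
      "f \<cdot> y = Idn C (Tgt C f) \<cdot> p"
    using R f unfolding in_image_def by fastforce
  then have "f \<cdot> y = p" by (simp add: Hom_iff)
  then show "is_epic C f" using epic_factor[of f y] p f by (auto simp: Hom_iff)
qed

text \<open>Both directions rest on the factorization \<open>f = m \<cdot> e\<close> with \<open>e\<close> epic. Elements of the
  kernel of \<open>g\<close> lift along \<open>m\<close> without a cover, and then along \<open>e\<close> after a cover. Conversely, an
  element that lifts along \<open>f\<close> after a cover is killed by the cokernel of \<open>f\<close>, since epic arrows can be
  cancelled, and so lies in the image.\<close>

lemma exact_pair_iff:
  "exact_pair C f g \<longleftrightarrow> f \<in> Arr C \<and> g \<in> Arr C \<and> Tgt C f = Src C g \<and>
     g \<cdot> f = Zero C (Src C f) (Tgt C g) \<and>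
     (\<forall>Y. \<forall>x \<in> Hom C Y (Src C g). g \<cdot> x = Zero C Y (Tgt C g) \<longrightarrow> in_image f x)" (is "_ \<longleftrightarrow> ?R")
proof
  assume ex: "exact_pair C f g"
  then obtain m where m: "is_image C f m" "is_kernel C g m" and
    fg: "f \<in> Arr C" "g \<in> Arr C" "Tgt C f = Src C g" by (auto simp: exact_pair_def)
  obtain e where e: "e \<in> Hom C (Src C f) (Src C m)" "m \<cdot> e = f" "is_epic C e"
    using image_factorization[OF m(1)] by blast
  have m': "m \<in> Hom C (Src C m) (Src C g)" "g \<cdot> m = Zero C (Src C m) (Tgt C g)"
    using m(2) by (auto simp: is_kernel_def Hom_iff)
  show ?R
  proof (intro conjI allI ballI impI fg)
    have "g \<cdot> (m \<cdot> e) = Zero C (Src C m) (Tgt C g) \<cdot> e"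
      using Cmp_reassoc[OF m'(2), of e] m'(1) e(1) fg(2) by (simp add: Hom_iff)
    then show "g \<cdot> f = Zero C (Src C f) (Tgt C g)"
      unfolding e(2) using e(1) fg by (simp add: Hom_iff)
    fix Y x assume x: "x \<in> Hom C Y (Src C g)" "g \<cdot> x = Zero C Y (Tgt C g)"
    then obtain u where u: "u \<in> Hom C Y (Src C m)" "m \<cdot> u = x" using kernel_lift[OF m(2)] by blast
    then have "u \<in> Hom C Y (Tgt C e)" using e(1) by (simp add: Hom_iff)
    then obtain Z p y where p: "p \<in> Hom C Z Y" "is_epic C p" "y \<in> Hom C Z (Src C e)" "e \<cdot> y = u \<cdot> p"
      using epic_lift[OF e(3)] by blast
    have "f \<cdot> y = m \<cdot> (e \<cdot> y)"
      using Cmp_reassoc[OF e(2), of y] m'(1) e(1) p(3) by (simp add: Hom_iff)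
    also have "\<dots> = m \<cdot> (u \<cdot> p)" unfolding p(4) ..
    also have "\<dots> = x \<cdot> p"
      using Cmp_reassoc[OF u(2), of p] m'(1) u(1) p(1) by (simp add: Hom_iff)
    finally have "f \<cdot> y = x \<cdot> p" .
    moreover have "Src C x = Y" "Src C e = Src C f" using x e(1) by (auto simp: Hom_iff)
    ultimately show "in_image f x" unfolding in_image_def using p by metis
  qed
next
  assume R: ?R
  then have fg: "f \<in> Arr C" "g \<in> Arr C" "Tgt C f = Src C g" "g \<cdot> f = Zero C (Src C f) (Tgt C g)"
    by auto
  obtain c where c: "is_cokernel C f c" using cokernel_exists fg by blast
  then have c': "c \<in> Arr C" "Src C c = Tgt C f" "c \<cdot> f = Zero C (Src C f) (Tgt C c)"
    by (auto simp: is_cokernel_def)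
  obtain m where m: "is_kernel C c m" using kernel_exists c' by blast
  then have m': "m \<in> Arr C" "Tgt C m = Src C c" by (auto simp: is_kernel_def)
  have im: "is_image C f m" using c m by (auto simp: is_image_def)
  then obtain e where e: "e \<in> Hom C (Src C f) (Src C m)" "m \<cdot> e = f" "is_epic C e"
    using image_factorization by blast
  have "is_kernel C g m"
  proof (rule kernelI)
    show "g \<in> Arr C" "is_monic C m" "Tgt C m = Src C g"
      using fg kernel_monic[OF m] m' c' by auto
    have "(g \<cdot> m) \<cdot> e = g \<cdot> f"
      using Cmp_ac[of e m g] e(1) m' c'(2) fg(1-3) unfolding e(2) by (simp add: Hom_iff)
    also have "\<dots> = Zero C (Src C m) (Tgt C g) \<cdot> e" unfolding fg(4) using e(1) fg(1,2) by (simp add: Hom_iff)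
    finally show "g \<cdot> m = Zero C (Src C m) (Tgt C g)"
      by (rule epic_cancel[OF e(3)]) (use e(1) m' c'(1,2) fg(1-3) in \<open>auto simp: Hom_iff\<close>)
    fix A x assume x: "x \<in> Hom C A (Src C g)" "g \<cdot> x = Zero C A (Tgt C g)"
    then have "in_image f x" "Src C x = A" using R by (blast, simp add: Hom_iff)
    then obtain Z p y where p: "p \<in> Hom C Z A" "is_epic C p" "y \<in> Hom C Z (Src C f)" "f \<cdot> y = x \<cdot> p"
      unfolding in_image_def by auto
    have "(c \<cdot> x) \<cdot> p = c \<cdot> (x \<cdot> p)" using c'(1,2) x(1) p(1) fg(3) by (simp add: Hom_iff)
    also have "\<dots> = c \<cdot> (f \<cdot> y)" unfolding p(4) ..
    also have "\<dots> = Zero C (Src C f) (Tgt C c) \<cdot> y"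
      using Cmp_reassoc[OF c'(3), of y] fg(1-3) c'(1,2) p(3) by (simp add: Hom_iff)
    also have "\<dots> = Zero C A (Tgt C c) \<cdot> p" using c'(1) p(1,3) by (simp add: Hom_iff)
    finally have "c \<cdot> x = Zero C A (Tgt C c)"
      by (rule epic_cancel[OF p(2), where B = "Tgt C c"]) (use p(1) x(1) c'(1,2) fg(1-3) in \<open>auto simp: Hom_iff\<close>)
    moreover have "x \<in> Hom C A (Src C c)" using x(1) c'(2) fg(3) by simp
    ultimately show "\<exists>u\<in>Hom C A (Src C m). m \<cdot> u = x" using kernel_lift[OF m] by metis
  qed
  then show "exact_pair C f g" using im fg by (auto simp: exact_pair_def)
qed

lemma exact_pairI:
  assumes "f \<in> Hom C A B" "g \<in> Hom C B D" "g \<cdot> f = Zero C A D"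
    and "\<And>Y x. \<lbrakk>x \<in> Hom C Y B; g \<cdot> x = Zero C Y D\<rbrakk> \<Longrightarrow> in_image f x"
  shows "exact_pair C f g"
  unfolding exact_pair_iff using assms by (auto simp: Hom_def)

lemma exact_pair_Zero: "exact_pair C f g \<Longrightarrow> g \<cdot> f = Zero C (Src C f) (Tgt C g)"
  by (simp add: exact_pair_iff)

lemma exact_lift:
  assumes "exact_pair C f g" "f \<in> Hom C A B" "g \<in> Hom C B D" "x \<in> Hom C Y B" "g \<cdot> x = Zero C Y D"
  obtains Z p y where "p \<in> Hom C Z Y" "is_epic C p" "y \<in> Hom C Z A" "f \<cdot> y = x \<cdot> p"
proof -
  have "in_image f x" "Src C x = Y" "Src C f = A"
    using assms unfolding exact_pair_iff by (metis Hom_iff)+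
  then show ?thesis using that unfolding in_image_def by auto
qed

text \<open>Two elements with the same image under \<open>g\<close> differ by an element of the image of \<open>f\<close>.
  Stating the difference as a sum keeps negatives out of the chases.\<close>

lemma exact_difference:
  assumes "exact_pair C f g" "f \<in> Hom C A B" "g \<in> Hom C B D"
    and "x \<in> Hom C Y B" "y \<in> Hom C Y B" "g \<cdot> x = g \<cdot> y"
  obtains Z p a where "p \<in> Hom C Z Y" "is_epic C p" "a \<in> Hom C Z A" "x \<cdot> p = (y \<cdot> p) \<oplus> (f \<cdot> a)"
proof -
  obtain z where z: "z \<in> Hom C Y B" "y \<oplus> z = Zero C Y B" using assms(5) by (rule Add_inverse)
  have xz: "x \<oplus> z \<in> Hom C Y B" using assms(4) z(1) by (rule Add_Hom)
  have "g \<cdot> (x \<oplus> z) = g \<cdot> (y \<oplus> z)"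
    using Cmp_Add_right[OF assms(4) z(1) assms(3)] Cmp_Add_right[OF assms(5) z(1) assms(3)]
      assms(6) by simp
  also have "\<dots> = Zero C Y D" unfolding z(2) using assms(3,4) by (simp add: Hom_iff)
  finally obtain Z p a where p: "p \<in> Hom C Z Y" "is_epic C p" "a \<in> Hom C Z A" "f \<cdot> a = (x \<oplus> z) \<cdot> p"
    using exact_lift[OF assms(1-3) xz] by blast
  have "x = (y \<oplus> z) \<oplus> x" unfolding z(2) using assms(4) by (simp add: Hom_iff)
  also have "\<dots> = y \<oplus> (x \<oplus> z)" using assms(4,5) z(1) by (simp add: Hom_iff Add_ac)
  finally have "x \<cdot> p = (y \<oplus> (x \<oplus> z)) \<cdot> p" by simp
  also have "\<dots> = (y \<cdot> p) \<oplus> (f \<cdot> a)"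
    unfolding p(4) by (rule Cmp_Add_left[OF p(1) assms(5) xz])
  finally show ?thesis using that[OF p(1-3)] by blast
qed

text \<open>When \<open>f\<close> is monic it represents its own image, so lifts along \<open>f\<close> need no cover.\<close>

lemma monic_exact_kernel:
  assumes "is_monic C f" "exact_pair C f g"
  shows "is_kernel C g f"
proof (rule kernelI)
  have fg: "f \<in> Arr C" "g \<in> Arr C" "Tgt C f = Src C g" "g \<cdot> f = Zero C (Src C f) (Tgt C g)"
    using assms(2) by (auto simp: exact_pair_iff)
  then show "g \<in> Arr C" "is_monic C f" "Tgt C f = Src C g" "g \<cdot> f = Zero C (Src C f) (Tgt C g)"
    using assms(1) by auto
  obtain m where m: "is_image C f m" "is_kernel C g m" using assms(2) by (auto simp: exact_pair_def)
  obtain c where c: "is_cokernel C f c" "is_kernel C c m" using m(1) by (auto simp: is_image_def)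
  have fc: "is_kernel C c f" using monic_kernel_of_cokernel[OF assms(1) c(1)] .
  fix A x assume x: "x \<in> Hom C A (Src C g)" "g \<cdot> x = Zero C A (Tgt C g)"
  then obtain u where u: "u \<in> Hom C A (Src C m)" "m \<cdot> u = x" using kernel_lift[OF m(2)] by blast
  have m': "m \<in> Hom C (Src C m) (Src C c)" "c \<cdot> m = Zero C (Src C m) (Tgt C c)" "c \<in> Arr C"
    using c(2) by (auto simp: is_kernel_def Hom_iff)
  have "c \<cdot> (m \<cdot> u) = Zero C (Src C m) (Tgt C c) \<cdot> u"
    by (rule Cmp_reassoc[OF m'(2)]) (use m'(1,3) u(1) in \<open>auto simp: Hom_iff\<close>)
  then have "c \<cdot> x = Zero C A (Tgt C c)" unfolding u(2) using m'(3) u(1) by (simp add: Hom_iff)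
  moreover have "x \<in> Hom C A (Src C c)" using u m'(1) Cmp_Hom[OF u(1) m'(1)] by simp
  ultimately show "\<exists>u\<in>Hom C A (Src C f). f \<cdot> u = x" using kernel_lift[OF fc] by metis
qed

lemma monic_exact_difference:
  assumes "is_monic C f" "exact_pair C f g" "f \<in> Hom C A B" "g \<in> Hom C B D"
    and "x \<in> Hom C Y B" "y \<in> Hom C Y B" "g \<cdot> x = g \<cdot> y"
  obtains a where "a \<in> Hom C Y A" "x = y \<oplus> (f \<cdot> a)"
proof -
  obtain z where z: "z \<in> Hom C Y B" "y \<oplus> z = Zero C Y B" using assms(6) by (rule Add_inverse)
  have xz: "x \<oplus> z \<in> Hom C Y B" using assms(5) z(1) by (rule Add_Hom)
  have ST: "Src C g = B" "Tgt C g = D" "Src C f = A" using assms(3,4) by (auto simp: Hom_iff)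
  have "g \<cdot> (x \<oplus> z) = g \<cdot> (y \<oplus> z)"
    using Cmp_Add_right[OF assms(5) z(1) assms(4)] Cmp_Add_right[OF assms(6) z(1) assms(4)]
      assms(7) by simp
  also have "\<dots> = Zero C Y D" unfolding z(2) using assms(4,5) by (simp add: Hom_iff)
  finally obtain a where a: "a \<in> Hom C Y A" "f \<cdot> a = x \<oplus> z"
    using kernel_lift[OF monic_exact_kernel[OF assms(1,2)], of "x \<oplus> z" Y] xz unfolding ST by blast
  have "x = (y \<oplus> z) \<oplus> x" unfolding z(2) using assms(5) by (simp add: Hom_iff)
  also have "\<dots> = y \<oplus> (x \<oplus> z)" using assms(5,6) z(1) by (simp add: Hom_iff Add_ac)
  finally show ?thesis using that[OF a(1)] a(2) by simp
qed

section \<open>Exact sequences with zero ends\<close>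

text \<open>All elements of a zero object vanish, so exactness says that \<open>f\<close> has trivial
  kernel.\<close>

lemma exact_pair_Zero_left:
  assumes Z: "is_zero_object C Z" and A: "A \<in> Obj C"
  shows "exact_pair C (Zero C Z A) f \<longleftrightarrow> is_monic C f \<and> Src C f = A"
proof
  have ZO: "Z \<in> Obj C" using Z by (simp add: is_zero_object_def)
  assume ex: "exact_pair C (Zero C Z A) f"
  then have f: "f \<in> Arr C" "Src C f = A" using ZO A by (auto simp: exact_pair_iff)
  have "x = Zero C Y A" if x: "x \<in> Hom C Y A" "f \<cdot> x = Zero C Y (Tgt C f)" for Y x
  proof -
    have "Zero C Z A \<in> Hom C Z A" "f \<in> Hom C A (Tgt C f)" using ZO A f by (auto simp: Hom_iff)
    then obtain W p y where p: "p \<in> Hom C W Y" "is_epic C p" "y \<in> Hom C W Z" "Zero C Z A \<cdot> y = x \<cdot> p"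
      using exact_lift[OF ex _ _ x] by blast
    have "x \<cdot> p = Zero C W A" using p(1,3) A unfolding p(4)[symmetric] by (simp add: Hom_iff)
    also have "\<dots> = Zero C Y A \<cdot> p" using p(1) A by (simp add: Hom_iff)
    finally show ?thesis
      by (rule epic_cancel[OF p(2)]) (use p(1) x(1) A in \<open>auto simp: Hom_iff\<close>)
  qed
  then show "is_monic C f \<and> Src C f = A" unfolding monic_iff using f by auto
next
  have ZO: "Z \<in> Obj C" using Z by (simp add: is_zero_object_def)
  assume f: "is_monic C f \<and> Src C f = A"
  show "exact_pair C (Zero C Z A) f"
  proof (rule exact_pairI)
    show "Zero C Z A \<in> Hom C Z A" "f \<in> Hom C A (Tgt C f)" "f \<cdot> Zero C Z A = Zero C Z (Tgt C f)"
      using f monic_Arr[of f] ZO A by (auto simp: Hom_iff)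
    fix Y x assume x: "x \<in> Hom C Y A" "f \<cdot> x = Zero C Y (Tgt C f)"
    then have "x = Zero C Y A" using f by (auto simp: monic_iff)
    also have "\<dots> = Zero C Z A \<cdot> Zero C Y Z" using x(1) ZO by (simp add: Hom_iff)
    finally show "in_image (Zero C Z A) x"
      using in_imageI[of "Zero C Z A" "Zero C Y Z" Y] x(1) ZO A by (auto simp: Hom_iff)
  qed
qed

text \<open>Every element is killed by an arrow to a zero object, so exactness says that every
  element lies in the image of \<open>f\<close>.\<close>

lemma exact_pair_Zero_right:
  assumes Z: "is_zero_object C Z" and B: "B \<in> Obj C"
  shows "exact_pair C f (Zero C B Z) \<longleftrightarrow> is_epic C f \<and> Tgt C f = B"
proof -
  have ZO: "Z \<in> Obj C" using Z by (simp add: is_zero_object_def)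
  have "Zero C B Z \<cdot> x = Zero C Y Z" if "x \<in> Hom C Y B" for x Y
    using that ZO by (auto simp: Hom_iff)
  then show ?thesis
    unfolding exact_pair_iff epic_iff_in_image using ZO B by (auto simp: Hom_iff)
qed

lemma exact_from_to_2:
  "exact_from_to C A [f, g] B \<longleftrightarrow>
     is_monic C f \<and> Src C f = A \<and> exact_pair C f g \<and> is_epic C g \<and> Tgt C g = B"
  (is "?L \<longleftrightarrow> ?R")
proof
  assume ?L then show ?R by (auto simp: exact_from_to_def exact_pair_Zero_left exact_pair_Zero_right)
next
  assume R: ?R
  then have "A \<in> Obj C" "B \<in> Obj C" using monic_Arr[of f] epic_Arr[of g] by auto
  then show ?L using R zero_object_exists
    by (auto simp: exact_from_to_def exact_pair_Zero_left exact_pair_Zero_right)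
qed

lemma exact_from_to_3:
  "exact_from_to C A [f, g, h] B \<longleftrightarrow>
     is_monic C f \<and> Src C f = A \<and> exact_pair C f g \<and> exact_pair C g h \<and> is_epic C h \<and> Tgt C h = B"
  (is "?L \<longleftrightarrow> ?R")
proof
  assume ?L then show ?R by (auto simp: exact_from_to_def exact_pair_Zero_left exact_pair_Zero_right)
next
  assume R: ?R
  then have "A \<in> Obj C" "B \<in> Obj C" using monic_Arr[of f] epic_Arr[of h] by auto
  then show ?L using R zero_object_exists
    by (auto simp: exact_from_to_def exact_pair_Zero_left exact_pair_Zero_right)
qed

lemma short_exact_iff:
  "short_exact C A f B g D \<longleftrightarrow>
     f \<in> Hom C A B \<and> g \<in> Hom C B D \<and> is_monic C f \<and> exact_pair C f g \<and> is_epic C g"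
  unfolding short_exact_def exact_from_to_2 by (auto simp: Hom_def)

lemma extensions_1_iff:
  "xs \<in> extensions C 1 Q P \<longleftrightarrow> (\<exists>f g A. xs = [f, g] \<and> short_exact C P f A g Q)"
  unfolding extensions_def short_exact_def
  by (auto simp: length_Suc_conv exact_from_to_2 exact_pair_iff Hom_def numeral_2_eq_2)

lemma extensions_2_iff:
  "xs \<in> extensions C 2 Q P \<longleftrightarrow> (\<exists>a b c T Z. xs = [a, b, c] \<and>
     a \<in> Hom C P T \<and> b \<in> Hom C T Z \<and> c \<in> Hom C Z Q \<and>
     is_monic C a \<and> exact_pair C a b \<and> exact_pair C b c \<and> is_epic C c)" (is "?L \<longleftrightarrow> ?R")
proof
  assume ?L
  then obtain a b c where "xs = [a, b, c]" "exact_from_to C P [a, b, c] Q"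
    by (auto simp: extensions_def length_Suc_conv numeral_2_eq_2)
  then show ?R
    unfolding exact_from_to_3 by (auto simp: exact_pair_iff Hom_def)
next
  assume ?R then show ?L by (auto simp: extensions_def exact_from_to_3 Hom_def)
qed

section \<open>Pushouts and pullbacks\<close>

lemma epic_Hom_cancel:
  "\<lbrakk>is_epic C p; p \<in> Hom C Z Y; x \<in> Hom C Y B; y \<in> Hom C Y B; x \<cdot> p = y \<cdot> p\<rbrakk> \<Longrightarrow> x = y"
  using epic_cancel[of p x y B] by (auto simp: Hom_def)

lemma monic_Hom_Zero:
  "\<lbrakk>is_monic C f; f \<in> Hom C A B; x \<in> Hom C Y A; f \<cdot> x = Zero C Y B\<rbrakk> \<Longrightarrow> x = Zero C Y A"
  by (auto simp: monic_iff Hom_def)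

lemma pushout_typing:
  assumes "is_pushout C f g i j" "f \<in> Hom C P A" "g \<in> Hom C P B"
  obtains T where "i \<in> Hom C A T" "j \<in> Hom C B T" "i \<cdot> f = j \<cdot> g"
  using assms unfolding is_pushout_def by (auto simp: Hom_def)

lemma pushout_universal:
  assumes "is_pushout C f g i j" "i \<in> Hom C A T" "j \<in> Hom C B T"
  obtains P where "f \<in> Hom C P A" "g \<in> Hom C P B" "i \<cdot> f = j \<cdot> g"
    "\<forall>Y. \<forall>u \<in> Hom C A Y. \<forall>v \<in> Hom C B Y. u \<cdot> f = v \<cdot> g \<longrightarrow>
       (\<exists>!w. w \<in> Hom C T Y \<and> w \<cdot> i = u \<and> w \<cdot> j = v)"
proof -
  obtain P' A' B' T' where *: "f \<in> Hom C P' A' \<and> g \<in> Hom C P' B' \<and> i \<in> Hom C A' T' \<and>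
    j \<in> Hom C B' T' \<and> i \<cdot> f = j \<cdot> g \<and>
    (\<forall>Y. \<forall>u \<in> Hom C A' Y. \<forall>v \<in> Hom C B' Y. u \<cdot> f = v \<cdot> g \<longrightarrow>
       (\<exists>!w. w \<in> Hom C T' Y \<and> w \<cdot> i = u \<and> w \<cdot> j = v))"
    using assms(1) unfolding is_pushout_def by (elim exE) (rule that)
  have "i \<in> Hom C A' T'" using * by (elim conjE)
  moreover have "j \<in> Hom C B' T'" using * by (elim conjE)
  ultimately have eq: "A' = A" "B' = B" "T' = T" using assms(2,3) by (auto simp: Hom_def)
  from *[unfolded eq] show ?thesis by (elim conjE) (rule that)
qed

lemma pushout_induced:
  assumes "is_pushout C f g i j" "i \<in> Hom C A T" "j \<in> Hom C B T"
    and "u \<in> Hom C A Y" "v \<in> Hom C B Y" "u \<cdot> f = v \<cdot> g"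
  obtains w where "w \<in> Hom C T Y" "w \<cdot> i = u" "w \<cdot> j = v"
proof -
  from assms(1-3) obtain P where "\<exists>!w. w \<in> Hom C T Y \<and> w \<cdot> i = u \<and> w \<cdot> j = v"
    by (rule pushout_universal) (use assms(4-6) in blast)
  then show ?thesis using that by blast
qed

lemma pushout_joint_epic:
  assumes "is_pushout C f g i j" "i \<in> Hom C A T" "j \<in> Hom C B T"
    and "w \<in> Hom C T Y" "w' \<in> Hom C T Y" "w \<cdot> i = w' \<cdot> i" "w \<cdot> j = w' \<cdot> j"
  shows "w = w'"
proof -
  from assms(1-3) obtain P where *: "f \<in> Hom C P A" "g \<in> Hom C P B" "i \<cdot> f = j \<cdot> g"
    "\<forall>Y. \<forall>u \<in> Hom C A Y. \<forall>v \<in> Hom C B Y. u \<cdot> f = v \<cdot> g \<longrightarrow>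
       (\<exists>!w. w \<in> Hom C T Y \<and> w \<cdot> i = u \<and> w \<cdot> j = v)"
    by (rule pushout_universal)
  have "(w \<cdot> i) \<cdot> f = (w \<cdot> j) \<cdot> g"
    using Cmp_assoc[OF *(1) assms(2,4)] Cmp_assoc[OF *(2) assms(3,4)] *(3) by simp
  then have "\<exists>!x. x \<in> Hom C T Y \<and> x \<cdot> i = w \<cdot> i \<and> x \<cdot> j = w \<cdot> j"
    by (rule *(4)[rule_format, OF Cmp_Hom[OF assms(2,4)] Cmp_Hom[OF assms(3,4)]])
  then show ?thesis using assms(4-7) by (metis (no_types))
qed

lemma is_pushout_commute:
  assumes "is_pushout C f g i j"
  shows "is_pushout C g f j i"
proof -
  obtain A B T where ij: "i \<in> Hom C A T" "j \<in> Hom C B T"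
    using assms unfolding is_pushout_def by blast
  obtain P where *: "f \<in> Hom C P A" "g \<in> Hom C P B" "i \<cdot> f = j \<cdot> g"
    "\<forall>Y. \<forall>u \<in> Hom C A Y. \<forall>v \<in> Hom C B Y. u \<cdot> f = v \<cdot> g \<longrightarrow>
       (\<exists>!w. w \<in> Hom C T Y \<and> w \<cdot> i = u \<and> w \<cdot> j = v)"
    using assms ij by (rule pushout_universal)
  have "\<exists>!w. w \<in> Hom C T Y \<and> w \<cdot> j = v \<and> w \<cdot> i = u"
    if "v \<in> Hom C B Y" "u \<in> Hom C A Y" "v \<cdot> g = u \<cdot> f" for Y u v
    using *(4)[rule_format, OF that(2,1) that(3)[symmetric]] by (simp only: conj_commute)
  then show ?thesis unfolding is_pushout_def using *(1,2) *(3)[symmetric] ij by blast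
qed

lemma pullback_typing:
  assumes "is_pullback C f g p q" "f \<in> Hom C A Q" "g \<in> Hom C B Q"
  obtains Z where "p \<in> Hom C Z A" "q \<in> Hom C Z B" "f \<cdot> p = g \<cdot> q"
  using assms unfolding is_pullback_def by (auto simp: Hom_def)

lemma pullback_universal:
  assumes "is_pullback C f g p q" "p \<in> Hom C Z A" "q \<in> Hom C Z B"
  obtains Q where "f \<in> Hom C A Q" "g \<in> Hom C B Q" "f \<cdot> p = g \<cdot> q"
    "\<forall>Y. \<forall>u \<in> Hom C Y A. \<forall>v \<in> Hom C Y B. f \<cdot> u = g \<cdot> v \<longrightarrow>
       (\<exists>!w. w \<in> Hom C Y Z \<and> p \<cdot> w = u \<and> q \<cdot> w = v)"
proof -
  obtain Q' A' B' Z' where *: "f \<in> Hom C A' Q' \<and> g \<in> Hom C B' Q' \<and> p \<in> Hom C Z' A' \<and>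
    q \<in> Hom C Z' B' \<and> f \<cdot> p = g \<cdot> q \<and>
    (\<forall>Y. \<forall>u \<in> Hom C Y A'. \<forall>v \<in> Hom C Y B'. f \<cdot> u = g \<cdot> v \<longrightarrow>
       (\<exists>!w. w \<in> Hom C Y Z' \<and> p \<cdot> w = u \<and> q \<cdot> w = v))"
    using assms(1) unfolding is_pullback_def by (elim exE) (rule that)
  have "p \<in> Hom C Z' A'" using * by (elim conjE)
  moreover have "q \<in> Hom C Z' B'" using * by (elim conjE)
  ultimately have eq: "A' = A" "B' = B" "Z' = Z" using assms(2,3) by (auto simp: Hom_def)
  from *[unfolded eq] show ?thesis by (elim conjE) (rule that)
qed

lemma pullback_induced:
  assumes "is_pullback C f g p q" "p \<in> Hom C Z A" "q \<in> Hom C Z B"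
    and "u \<in> Hom C Y A" "v \<in> Hom C Y B" "f \<cdot> u = g \<cdot> v"
  obtains w where "w \<in> Hom C Y Z" "p \<cdot> w = u" "q \<cdot> w = v"
proof -
  from assms(1-3) obtain Q where "\<exists>!w. w \<in> Hom C Y Z \<and> p \<cdot> w = u \<and> q \<cdot> w = v"
    by (rule pullback_universal) (use assms(4-6) in blast)
  then show ?thesis using that by blast
qed

lemma pullback_joint_monic:
  assumes "is_pullback C f g p q" "p \<in> Hom C Z A" "q \<in> Hom C Z B"
    and "w \<in> Hom C Y Z" "w' \<in> Hom C Y Z" "p \<cdot> w = p \<cdot> w'" "q \<cdot> w = q \<cdot> w'"
  shows "w = w'"
proof -
  from assms(1-3) obtain Q where *: "f \<in> Hom C A Q" "g \<in> Hom C B Q" "f \<cdot> p = g \<cdot> q"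
    "\<forall>Y. \<forall>u \<in> Hom C Y A. \<forall>v \<in> Hom C Y B. f \<cdot> u = g \<cdot> v \<longrightarrow>
       (\<exists>!w. w \<in> Hom C Y Z \<and> p \<cdot> w = u \<and> q \<cdot> w = v)"
    by (rule pullback_universal)
  have "f \<cdot> (p \<cdot> w) = g \<cdot> (q \<cdot> w)"
    using Cmp_assoc[OF assms(4,2) *(1)] Cmp_assoc[OF assms(4,3) *(2)] *(3) by simp
  then have "\<exists>!x. x \<in> Hom C Y Z \<and> p \<cdot> x = p \<cdot> w \<and> q \<cdot> x = q \<cdot> w"
    by (rule *(4)[rule_format, OF Cmp_Hom[OF assms(4,2)] Cmp_Hom[OF assms(4,3)]])
  then show ?thesis using assms(4-7) by (metis (no_types))
qed

lemma is_pullback_commute: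
  assumes "is_pullback C f g p q"
  shows "is_pullback C g f q p"
proof -
  obtain A B Z where pq: "p \<in> Hom C Z A" "q \<in> Hom C Z B"
    using assms unfolding is_pullback_def by blast
  obtain Q where *: "f \<in> Hom C A Q" "g \<in> Hom C B Q" "f \<cdot> p = g \<cdot> q"
    "\<forall>Y. \<forall>u \<in> Hom C Y A. \<forall>v \<in> Hom C Y B. f \<cdot> u = g \<cdot> v \<longrightarrow>
       (\<exists>!w. w \<in> Hom C Y Z \<and> p \<cdot> w = u \<and> q \<cdot> w = v)"
    using assms pq by (rule pullback_universal)
  have "\<exists>!w. w \<in> Hom C Y Z \<and> q \<cdot> w = v \<and> p \<cdot> w = u"
    if "v \<in> Hom C Y B" "u \<in> Hom C Y A" "g \<cdot> v = f \<cdot> u" for Y u v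
    using *(4)[rule_format, OF that(2,1) that(3)[symmetric]] by (simp only: conj_commute)
  then show ?thesis unfolding is_pullback_def using *(1,2) *(3)[symmetric] pq by blast
qed

lemma biproduct_obtain:
  assumes "A \<in> Obj C" "B \<in> Obj C"
  obtains W i j p q where "i \<in> Hom C A W" "j \<in> Hom C B W" "p \<in> Hom C W A" "q \<in> Hom C W B"
    "p \<cdot> i = Idn C A" "q \<cdot> j = Idn C B" "p \<cdot> j = Zero C B A" "q \<cdot> i = Zero C A B"
    "(i \<cdot> p) \<oplus> (j \<cdot> q) = Idn C W"
  using biproduct_exists[OF assms] by auto

text \<open>The pushout is covered by the biproduct: the arrow \<open>s = (i, j)\<close> is epic by the uniqueness
  part of the universal property. Hence each element is locally a sum of elements of the two legs.\<close>

lemma pushout_element: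
  assumes po: "is_pushout C f g i j" and i: "i \<in> Hom C A T" and j: "j \<in> Hom C B T"
    and x: "x \<in> Hom C Y T"
  obtains Z p a b where "p \<in> Hom C Z Y" "is_epic C p" "a \<in> Hom C Z A" "b \<in> Hom C Z B"
    "x \<cdot> p = (i \<cdot> a) \<oplus> (j \<cdot> b)"
proof -
  obtain W k l p q where W: "k \<in> Hom C A W" "l \<in> Hom C B W" "p \<in> Hom C W A" "q \<in> Hom C W B"
    "p \<cdot> k = Idn C A" "q \<cdot> l = Idn C B" "p \<cdot> l = Zero C B A" "q \<cdot> k = Zero C A B"
    using biproduct_obtain[of A B] i j unfolding Hom_iff by metis
  define s where "s = (i \<cdot> p) \<oplus> (j \<cdot> q)"
  have s: "s \<in> Hom C W T" unfolding s_def using W(1-4) i j by (simp add: Hom_iff)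
  have sk: "s \<cdot> k = i" unfolding s_def using W i j by (simp add: Hom_iff)
  have sl: "s \<cdot> l = j" unfolding s_def using W i j by (simp add: Hom_iff)
  have "is_epic C s" unfolding is_epic_def
  proof (intro conjI allI ballI impI)
    show "s \<in> Arr C" using s by (simp add: Hom_iff)
    fix Y w w' assume "w \<in> Hom C (Tgt C s) Y" "w' \<in> Hom C (Tgt C s) Y" and eq: "w \<cdot> s = w' \<cdot> s"
    then have w: "w \<in> Hom C T Y" "w' \<in> Hom C T Y" using s by (auto simp: Hom_iff)
    have "w \<cdot> i = w' \<cdot> i"
      using Cmp_assoc[OF W(1) s w(1)] Cmp_assoc[OF W(1) s w(2)] eq sk by simp
    moreover have "w \<cdot> j = w' \<cdot> j"
      using Cmp_assoc[OF W(2) s w(1)] Cmp_assoc[OF W(2) s w(2)] eq sl by simp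
    ultimately show "w = w'" by (rule pushout_joint_epic[OF po i j w])
  qed
  moreover have "x \<in> Hom C Y (Tgt C s)" "Src C s = W" using x s by (auto simp: Hom_iff)
  ultimately obtain Z r y where r: "r \<in> Hom C Z Y" "is_epic C r" "y \<in> Hom C Z W" "s \<cdot> y = x \<cdot> r"
    using epic_lift by metis
  have "x \<cdot> r = (i \<cdot> (p \<cdot> y)) \<oplus> (j \<cdot> (q \<cdot> y))"
    unfolding r(4)[symmetric] s_def using W(1-4) i j r(3) by (simp add: Hom_iff)
  then show ?thesis using that[OF r(1,2)] Cmp_Hom[OF r(3) W(3)] Cmp_Hom[OF r(3) W(4)] by blast
qed

text \<open>The usual construction of the pushout as the cokernel of \<open>(f, -g)\<close> into the
  biproduct.\<close>

lemma antidiagonal_cokernel: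
  assumes f: "f \<in> Hom C P A" and g: "g \<in> Hom C P B"
    and W: "k \<in> Hom C A W" "l \<in> Hom C B W" "p \<in> Hom C W A" "q \<in> Hom C W B"
      "p \<cdot> k = Idn C A" "q \<cdot> l = Idn C B" "p \<cdot> l = Zero C B A" "q \<cdot> k = Zero C A B"
      "(k \<cdot> p) \<oplus> (l \<cdot> q) = Idn C W"
    and g': "g' \<in> Hom C P B" "g \<oplus> g' = Zero C P B"
    and c: "is_cokernel C ((k \<cdot> f) \<oplus> (l \<cdot> g')) c"
  shows "is_pushout C f g (c \<cdot> k) (c \<cdot> l)"
proof -
  let ?d = "(k \<cdot> f) \<oplus> (l \<cdot> g')"
  have d: "?d \<in> Hom C P W" using W(1,2) f g' by (simp add: Hom_iff)
  define T where "T = Tgt C c"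
  have c': "c \<in> Hom C W T" "c \<cdot> ?d = Zero C P T"
    using c d unfolding is_cokernel_def T_def by (auto simp: Hom_iff)
  have comm: "u \<cdot> f = v \<cdot> g \<longleftrightarrow> (u \<cdot> f) \<oplus> (v \<cdot> g') = Zero C P Y"
    if u: "u \<in> Hom C A Y" and v: "v \<in> Hom C B Y" for u v Y
  proof -
    have ty: "u \<cdot> f \<in> Hom C P Y" "v \<cdot> g \<in> Hom C P Y" "v \<cdot> g' \<in> Hom C P Y"
      using Cmp_Hom[OF f u] Cmp_Hom[OF g v] Cmp_Hom[OF g'(1) v] by auto
    have *: "(v \<cdot> g') \<oplus> (v \<cdot> g) = Zero C P Y"
    proof -
      have "(v \<cdot> g) \<oplus> (v \<cdot> g') = v \<cdot> Zero C P B"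
        using Cmp_Add_right[OF g g'(1) v] g'(2) by simp
      also have "\<dots> = Zero C P Y" using v g by (simp add: Hom_iff)
      finally show ?thesis using Add_commute[of "v \<cdot> g'" "v \<cdot> g"] ty unfolding Hom_iff by simp
    qed
    have "(u \<cdot> f) \<oplus> (v \<cdot> g') = (v \<cdot> g') \<oplus> (u \<cdot> f)"
      using Add_commute[of "u \<cdot> f" "v \<cdot> g'"] ty unfolding Hom_iff by simp
    then show ?thesis using * Add_left_cancel[OF ty(3,1,2)] by metis
  qed
  have kl: "c \<cdot> k \<in> Hom C A T" "c \<cdot> l \<in> Hom C B T" using Cmp_Hom[OF _ c'(1)] W(1,2) by auto
  have "((c \<cdot> k) \<cdot> f) \<oplus> ((c \<cdot> l) \<cdot> g') = c \<cdot> ?d"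
    using c'(1) W(1,2) f g'(1) by (simp add: Hom_iff)
  then have eq: "(c \<cdot> k) \<cdot> f = (c \<cdot> l) \<cdot> g" using comm[OF kl] c'(2) by simp
  have "\<exists>!w. w \<in> Hom C T Y \<and> w \<cdot> (c \<cdot> k) = u \<and> w \<cdot> (c \<cdot> l) = v"
    if u: "u \<in> Hom C A Y" and v: "v \<in> Hom C B Y" and uv: "u \<cdot> f = v \<cdot> g" for Y u v
  proof -
    define h where "h = (u \<cdot> p) \<oplus> (v \<cdot> q)"
    have h: "h \<in> Hom C W Y" unfolding h_def using u v W(3,4) by (simp add: Hom_iff)
    have hk: "h \<cdot> k = u" unfolding h_def using u v W by (simp add: Hom_iff)
    have hl: "h \<cdot> l = v" unfolding h_def using u v W by (simp add: Hom_iff)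
    have "h \<cdot> ?d = ((h \<cdot> k) \<cdot> f) \<oplus> ((h \<cdot> l) \<cdot> g')"
      using h W(1,2) f g'(1) by (simp add: Hom_iff)
    also have "\<dots> = Zero C P Y" unfolding hk hl using comm[OF u v] uv by simp
    finally have "h \<cdot> ?d = Zero C (Src C ?d) Y" using d by (simp add: Hom_iff)
    moreover have "h \<in> Hom C (Tgt C ?d) Y" using h d by (simp add: Hom_iff)
    ultimately obtain w where w: "w \<in> Hom C T Y" "w \<cdot> c = h"
      using cokernel_extend[OF c] unfolding T_def by metis
    show ?thesis
    proof (rule ex1I[of _ w], intro conjI)
      show "w \<in> Hom C T Y" by (rule w)
      show "w \<cdot> (c \<cdot> k) = u" "w \<cdot> (c \<cdot> l) = v"
        using Cmp_assoc[OF W(1) c'(1) w(1)] Cmp_assoc[OF W(2) c'(1) w(1)] w(2) hk hl by auto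
      fix w' assume w': "w' \<in> Hom C T Y \<and> w' \<cdot> (c \<cdot> k) = u \<and> w' \<cdot> (c \<cdot> l) = v"
      have "w' \<cdot> c = (w' \<cdot> c) \<cdot> ((k \<cdot> p) \<oplus> (l \<cdot> q))"
        unfolding W(9) using w' c' by (simp add: Hom_iff)
      also have "\<dots> = ((w' \<cdot> (c \<cdot> k)) \<cdot> p) \<oplus> ((w' \<cdot> (c \<cdot> l)) \<cdot> q)"
        using conjunct1[OF w'] c'(1) W(1-4) by (simp add: Hom_iff)
      also have "\<dots> = w \<cdot> c" using w' w(2) unfolding h_def by simp
      finally show "w' = w"
        using epic_Hom_cancel[OF cokernel_epic[OF c] c'(1)] w' w(1) by blast
    qed
  qed
  then show ?thesis unfolding is_pushout_def using f g kl eq by blast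
qed

lemma pushout_exists:
  assumes f: "f \<in> Hom C P A" and g: "g \<in> Hom C P B"
  obtains i j T where "is_pushout C f g i j" "i \<in> Hom C A T" "j \<in> Hom C B T" "i \<cdot> f = j \<cdot> g"
proof -
  obtain W k l p q where W: "k \<in> Hom C A W" "l \<in> Hom C B W" "p \<in> Hom C W A" "q \<in> Hom C W B"
    "p \<cdot> k = Idn C A" "q \<cdot> l = Idn C B" "p \<cdot> l = Zero C B A" "q \<cdot> k = Zero C A B"
    "(k \<cdot> p) \<oplus> (l \<cdot> q) = Idn C W"
    using biproduct_obtain[of A B] f g unfolding Hom_iff by metis
  obtain g' where g': "g' \<in> Hom C P B" "g \<oplus> g' = Zero C P B" using g by (rule Add_inverse)
  have "(k \<cdot> f) \<oplus> (l \<cdot> g') \<in> Arr C" using W(1,2) f g' by (simp add: Hom_iff)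
  then obtain c where c: "is_cokernel C ((k \<cdot> f) \<oplus> (l \<cdot> g')) c" using cokernel_exists by blast
  have po: "is_pushout C f g (c \<cdot> k) (c \<cdot> l)" using antidiagonal_cokernel[OF f g W g' c] .
  then show ?thesis using pushout_typing[OF po f g] that by metis
qed

text \<open>The arrow \<open>(f, -g)\<close> is monic because \<open>g\<close> is, so it is the kernel of its cokernel, which is
  a pushout. If \<open>i\<close> kills \<open>x\<close>, then \<open>(x, 0)\<close> comes from some \<open>y\<close> with \<open>g \<cdot> y = 0\<close>; hence \<open>y = 0\<close>
  and \<open>x = f \<cdot> y = 0\<close>.\<close>

lemma pushout_monic:
  assumes po: "is_pushout C f g i j" and f: "f \<in> Hom C P A" and g: "g \<in> Hom C P B"
    and mono: "is_monic C g"
  shows "is_monic C i"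
proof -
  obtain T where ij: "i \<in> Hom C A T" "j \<in> Hom C B T" "i \<cdot> f = j \<cdot> g"
    using pushout_typing[OF po f g] .
  obtain W k l p q where W: "k \<in> Hom C A W" "l \<in> Hom C B W" "p \<in> Hom C W A" "q \<in> Hom C W B"
    "p \<cdot> k = Idn C A" "q \<cdot> l = Idn C B" "p \<cdot> l = Zero C B A" "q \<cdot> k = Zero C A B"
    "(k \<cdot> p) \<oplus> (l \<cdot> q) = Idn C W"
    using biproduct_obtain[of A B] f g unfolding Hom_iff by metis
  obtain g' where g': "g' \<in> Hom C P B" "g \<oplus> g' = Zero C P B" using g by (rule Add_inverse)
  let ?d = "(k \<cdot> f) \<oplus> (l \<cdot> g')"
  have d: "?d \<in> Hom C P W" using W(1,2) f g' by (simp add: Hom_iff)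
  have qd: "q \<cdot> ?d = g'"
    using W f g'(1) Cmp_reassoc[OF W(8), of f] Cmp_reassoc[OF W(6), of g'] by (simp add: Hom_iff)
  have pd: "p \<cdot> ?d = f"
    using W f g'(1) Cmp_reassoc[OF W(5), of f] Cmp_reassoc[OF W(7), of g'] by (simp add: Hom_iff)
  have g'0: "y = Zero C Y P" if y: "y \<in> Hom C Y P" "g' \<cdot> y = Zero C Y B" for y Y
  proof -
    have "g \<cdot> y = (g \<cdot> y) \<oplus> (g' \<cdot> y)" unfolding y(2) using g y(1) by (simp add: Hom_iff)
    also have "\<dots> = Zero C P B \<cdot> y" using Cmp_Add_left[OF y(1) g g'(1)] g'(2) by simp
    also have "\<dots> = Zero C Y B" using y(1) g by (simp add: Hom_iff)
    finally show ?thesis by (rule monic_Hom_Zero[OF mono g y(1)])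
  qed
  have d_monic: "is_monic C ?d" unfolding monic_iff
  proof (intro conjI allI ballI impI)
    show "?d \<in> Arr C" using d by (simp add: Hom_iff)
    fix Y y assume "y \<in> Hom C Y (Src C ?d)" "?d \<cdot> y = Zero C Y (Tgt C ?d)"
    then have y: "y \<in> Hom C Y P" "?d \<cdot> y = Zero C Y W" using d by (auto simp: Hom_iff)
    have "g' \<cdot> y = q \<cdot> (?d \<cdot> y)" using Cmp_assoc[OF y(1) d W(4)] qd by simp
    also have "\<dots> = Zero C Y B" unfolding y(2) using W(4) y(1) by (simp add: Hom_iff)
    finally show "y = Zero C Y (Src C ?d)" using g'0[OF y(1)] d by (simp add: Hom_iff)
  qed
  obtain c where c: "is_cokernel C ?d c" using cokernel_exists d by (auto simp: Hom_iff)
  define K where "K = Tgt C c"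
  have c': "c \<in> Hom C W K" using c d unfolding is_cokernel_def K_def by (auto simp: Hom_iff)
  have po': "is_pushout C f g (c \<cdot> k) (c \<cdot> l)" using antidiagonal_cokernel[OF f g W g' c] .
  have ck: "c \<cdot> k \<in> Hom C A K" "c \<cdot> l \<in> Hom C B K"
    using Cmp_Hom[OF W(1) c'] Cmp_Hom[OF W(2) c'] by auto
  have "(c \<cdot> k) \<cdot> f = (c \<cdot> l) \<cdot> g" using pushout_typing[OF po' f g] by metis
  then obtain w where w: "w \<in> Hom C T K" "w \<cdot> i = c \<cdot> k"
    using pushout_induced[OF po ij(1,2) ck] by blast
  show ?thesis unfolding monic_iff
  proof (intro conjI allI ballI impI)
    show "i \<in> Arr C" using ij by (simp add: Hom_iff)
    fix Y x assume "x \<in> Hom C Y (Src C i)" "i \<cdot> x = Zero C Y (Tgt C i)"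
    then have x: "x \<in> Hom C Y A" "i \<cdot> x = Zero C Y T" using ij by (auto simp: Hom_iff)
    have "c \<cdot> (k \<cdot> x) = (w \<cdot> i) \<cdot> x" unfolding w(2) using Cmp_assoc[OF x(1) W(1) c'] by simp
    also have "\<dots> = w \<cdot> Zero C Y T" using Cmp_assoc[OF x(1) ij(1) w(1)] x(2) by simp
    also have "\<dots> = Zero C Y K" using w(1) x(1) by (simp add: Hom_iff)
    finally have "c \<cdot> (k \<cdot> x) = Zero C Y (Tgt C c)" unfolding K_def .
    moreover have "k \<cdot> x \<in> Hom C Y (Src C c)" using x(1) W(1) c' by (simp add: Hom_iff)
    moreover have "Src C ?d = P" using d by (simp add: Hom_iff)
    ultimately obtain y where y: "y \<in> Hom C Y P" "?d \<cdot> y = k \<cdot> x"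
      using kernel_lift[OF monic_kernel_of_cokernel[OF d_monic c]] by metis
    have "g' \<cdot> y = q \<cdot> (k \<cdot> x)" using Cmp_assoc[OF y(1) d W(4)] qd y(2) by simp
    also have "\<dots> = Zero C Y B" 
      using Cmp_assoc[OF x(1) W(1) W(4)] W(8) x(1) W(4) by (simp add: Hom_iff)
    finally have y0: "y = Zero C Y P" by (rule g'0[OF y(1)])
    have "x = p \<cdot> (k \<cdot> x)"
      using Cmp_assoc[OF x(1) W(1) W(3)] W(5) x(1) by (simp add: Hom_iff)
    also have "\<dots> = f \<cdot> y" unfolding y(2)[symmetric] using Cmp_assoc[OF y(1) d W(3)] pd by simp
    also have "\<dots> = Zero C Y (Src C i)" unfolding y0 using f x(1) ij(1) by (simp add: Hom_iff)
    finally show "x = Zero C Y (Src C i)" .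
  qed
qed

lemma pullback_exists:
  assumes f: "f \<in> Hom C A Q" and g: "g \<in> Hom C B Q"
  obtains p q Z where "is_pullback C f g p q" "p \<in> Hom C Z A" "q \<in> Hom C Z B" "f \<cdot> p = g \<cdot> q"
proof -
  obtain W k l p q where W: "k \<in> Hom C A W" "l \<in> Hom C B W" "p \<in> Hom C W A" "q \<in> Hom C W B"
    "p \<cdot> k = Idn C A" "q \<cdot> l = Idn C B" "p \<cdot> l = Zero C B A" "q \<cdot> k = Zero C A B"
    "(k \<cdot> p) \<oplus> (l \<cdot> q) = Idn C W"
    using biproduct_obtain[of A B] f g unfolding Hom_iff by metis
  obtain g' where g': "g' \<in> Hom C B Q" "g \<oplus> g' = Zero C B Q" using g by (rule Add_inverse)
  let ?d = "(f \<cdot> p) \<oplus> (g' \<cdot> q)"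
  have d: "?d \<in> Hom C W Q" using W(3,4) f g' by (simp add: Hom_iff)
  obtain c where c: "is_kernel C ?d c" using kernel_exists d by (auto simp: Hom_iff)
  define Z where "Z = Src C c"
  have c': "c \<in> Hom C Z W" "?d \<cdot> c = Zero C Z Q"
    using c d unfolding is_kernel_def Z_def by (auto simp: Hom_iff)
  have comm: "f \<cdot> u = g \<cdot> v \<longleftrightarrow> (f \<cdot> u) \<oplus> (g' \<cdot> v) = Zero C Y Q"
    if u: "u \<in> Hom C Y A" and v: "v \<in> Hom C Y B" for u v Y
  proof -
    have ty: "f \<cdot> u \<in> Hom C Y Q" "g \<cdot> v \<in> Hom C Y Q" "g' \<cdot> v \<in> Hom C Y Q"
      using Cmp_Hom[OF u f] Cmp_Hom[OF v g] Cmp_Hom[OF v g'(1)] by auto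
    have *: "(g' \<cdot> v) \<oplus> (g \<cdot> v) = Zero C Y Q"
    proof -
      have "(g \<cdot> v) \<oplus> (g' \<cdot> v) = Zero C B Q \<cdot> v"
        using Cmp_Add_left[OF v g g'(1)] g'(2) by simp
      also have "\<dots> = Zero C Y Q" using v g by (simp add: Hom_iff)
      finally show ?thesis using Add_commute[of "g' \<cdot> v" "g \<cdot> v"] ty unfolding Hom_iff by simp
    qed
    have "(f \<cdot> u) \<oplus> (g' \<cdot> v) = (g' \<cdot> v) \<oplus> (f \<cdot> u)"
      using Add_commute[of "f \<cdot> u" "g' \<cdot> v"] ty unfolding Hom_iff by simp
    then show ?thesis using * Add_left_cancel[OF ty(3,1,2)] by metis
  qed
  have pq: "p \<cdot> c \<in> Hom C Z A" "q \<cdot> c \<in> Hom C Z B" using Cmp_Hom[OF c'(1)] W(3,4) by auto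
  have "(f \<cdot> (p \<cdot> c)) \<oplus> (g' \<cdot> (q \<cdot> c)) = ?d \<cdot> c"
    using c'(1) W(3,4) f g'(1) by (simp add: Hom_iff)
  then have eq: "f \<cdot> (p \<cdot> c) = g \<cdot> (q \<cdot> c)" using comm[OF pq] c'(2) by simp
  have "\<exists>!w. w \<in> Hom C Y Z \<and> (p \<cdot> c) \<cdot> w = u \<and> (q \<cdot> c) \<cdot> w = v"
    if u: "u \<in> Hom C Y A" and v: "v \<in> Hom C Y B" and uv: "f \<cdot> u = g \<cdot> v" for Y u v
  proof -
    define h where "h = (k \<cdot> u) \<oplus> (l \<cdot> v)"
    have h: "h \<in> Hom C Y W" unfolding h_def using u v W(1,2) by (simp add: Hom_iff)
    have ph: "p \<cdot> h = u" unfolding h_def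
      using u v W Cmp_reassoc[OF W(5), of u] Cmp_reassoc[OF W(7), of v] by (simp add: Hom_iff)
    have qh: "q \<cdot> h = v" unfolding h_def
      using u v W Cmp_reassoc[OF W(8), of u] Cmp_reassoc[OF W(6), of v] by (simp add: Hom_iff)
    have "?d \<cdot> h = (f \<cdot> (p \<cdot> h)) \<oplus> (g' \<cdot> (q \<cdot> h))"
      using h W(3,4) f g'(1) by (simp add: Hom_iff)
    also have "\<dots> = Zero C Y Q" unfolding ph qh using comm[OF u v] uv by simp
    finally have "?d \<cdot> h = Zero C Y (Tgt C ?d)" using d by (simp add: Hom_iff)
    moreover have "h \<in> Hom C Y (Src C ?d)" using h d by (simp add: Hom_iff)
    ultimately obtain w where w: "w \<in> Hom C Y Z" "c \<cdot> w = h"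
      using kernel_lift[OF c] unfolding Z_def by metis
    show ?thesis
    proof (rule ex1I[of _ w], intro conjI)
      show "w \<in> Hom C Y Z" by (rule w)
      show "(p \<cdot> c) \<cdot> w = u" "(q \<cdot> c) \<cdot> w = v"
        using Cmp_assoc[OF w(1) c'(1) W(3)] Cmp_assoc[OF w(1) c'(1) W(4)] w(2) ph qh by auto
      fix w' assume w': "w' \<in> Hom C Y Z \<and> (p \<cdot> c) \<cdot> w' = u \<and> (q \<cdot> c) \<cdot> w' = v"
      have "c \<cdot> w' = ((k \<cdot> p) \<oplus> (l \<cdot> q)) \<cdot> (c \<cdot> w')"
        unfolding W(9) using w' c' by (simp add: Hom_iff)
      also have "\<dots> = (k \<cdot> ((p \<cdot> c) \<cdot> w')) \<oplus> (l \<cdot> ((q \<cdot> c) \<cdot> w'))"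
        using conjunct1[OF w'] c'(1) W(1-4) by (simp add: Hom_iff)
      also have "\<dots> = c \<cdot> w" using w' w(2) unfolding h_def by simp
      finally show "w' = w"
        using monic_cancel[OF kernel_monic[OF c], of w' w Y] w' w(1) unfolding Z_def by blast
    qed
  qed
  then have "is_pullback C f g (p \<cdot> c) (q \<cdot> c)" unfolding is_pullback_def using f g pq eq by blast
  then show ?thesis using that pq eq by blast
qed

lemma pullback_epic:
  assumes pb: "is_pullback C f g p q" and f: "f \<in> Hom C A Q" and g: "g \<in> Hom C B Q"
    and epi: "is_epic C f"
  shows "is_epic C q"
proof -
  obtain Z where pq: "p \<in> Hom C Z A" "q \<in> Hom C Z B" "f \<cdot> p = g \<cdot> q"
    using pullback_typing[OF pb f g] .
  have "g \<in> Hom C B (Tgt C f)" "Src C f = A" using f g by (auto simp: Hom_iff)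
  then obtain W r y where r: "r \<in> Hom C W B" "is_epic C r" "y \<in> Hom C W A" "f \<cdot> y = g \<cdot> r"
    using epic_lift[OF epi] by metis
  obtain w where w: "w \<in> Hom C W Z" "q \<cdot> w = r"
    using pullback_induced[OF pb pq(1,2) r(3,1,4)] by blast
  then show ?thesis using epic_factor[of q w] r(2) pq(2) w(1) by (simp add: Hom_iff)
qed

section \<open>Equations and exactness for typed arrows\<close>

text \<open>The simplifier nests composites to the right, so in \<open>g \<cdot> (f \<cdot> x)\<close> the left-hand side of a
  known equation for \<open>g \<cdot> f\<close> is not a subterm. This lemma and the next apply such an equation to an
  element \<open>x\<close>.\<close>

lemma Cmp_square:
  assumes "g \<cdot> f = k \<cdot> h" "f \<in> Hom C A B" "g \<in> Hom C B D" "h \<in> Hom C A B'" "k \<in> Hom C B' D"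
    and "x \<in> Hom C Y A"
  shows "g \<cdot> (f \<cdot> x) = k \<cdot> (h \<cdot> x)"
  using Cmp_assoc[OF assms(6,2,3)] Cmp_assoc[OF assms(6,4,5)] assms(1) by simp

lemma Cmp_eq_Cmp:
  assumes "g \<cdot> f = h" "f \<in> Hom C A B" "g \<in> Hom C B D" "x \<in> Hom C Y A"
  shows "g \<cdot> (f \<cdot> x) = h \<cdot> x"
  using Cmp_assoc[OF assms(4,2,3)] assms(1) by simp

lemma Hom_Obj: "f \<in> Hom C A B \<Longrightarrow> A \<in> Obj C" "f \<in> Hom C A B \<Longrightarrow> B \<in> Obj C"
  by (auto simp: Hom_iff)

lemma Cmp_Zero_Hom:
  "f \<in> Hom C A B \<Longrightarrow> Y \<in> Obj C \<Longrightarrow> f \<cdot> Zero C Y A = Zero C Y B"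
  "f \<in> Hom C A B \<Longrightarrow> Y \<in> Obj C \<Longrightarrow> Zero C B Y \<cdot> f = Zero C A Y"
  by (auto simp: Hom_iff)

lemma Zero_Hom: "A \<in> Obj C \<Longrightarrow> B \<in> Obj C \<Longrightarrow> Zero C A B \<in> Hom C A B"
  by (simp add: Hom_iff)

lemma in_image_cmp:
  assumes "f \<in> Hom C A B" "y \<in> Hom C Y A" "f \<cdot> y = x"
  shows "in_image f x"
  using in_imageI[of f y Y] assms by (auto simp: Hom_iff)

lemma monic_factor:
  assumes "is_monic C (g \<cdot> f)" "f \<in> Hom C A B" "g \<in> Hom C B D"
  shows "is_monic C f"
  unfolding monic_iff
proof (intro conjI allI ballI impI)
  show "f \<in> Arr C" using assms(2) by (simp add: Hom_iff)
  fix Y x assume "x \<in> Hom C Y (Src C f)" "f \<cdot> x = Zero C Y (Tgt C f)"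
  then have x: "x \<in> Hom C Y A" "f \<cdot> x = Zero C Y B" using assms(2) by (auto simp: Hom_iff)
  have "(g \<cdot> f) \<cdot> x = g \<cdot> Zero C Y B" using Cmp_assoc[OF x(1) assms(2,3)] x(2) by simp
  also have "\<dots> = Zero C Y D" using Cmp_Zero_Hom(1)[OF assms(3)] Hom_Obj[OF x(1)] by simp
  finally have "x = Zero C Y A"
    by (rule monic_Hom_Zero[OF assms(1) Cmp_Hom[OF assms(2,3)] x(1)])
  then show "x = Zero C Y (Src C f)" using assms(2) by (simp add: Hom_iff)
qed

lemma monicI:
  assumes "f \<in> Hom C A B" "\<And>Y x. \<lbrakk>x \<in> Hom C Y A; f \<cdot> x = Zero C Y B\<rbrakk> \<Longrightarrow> x = Zero C Y A"
  shows "is_monic C f"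
  using assms by (auto simp: monic_iff Hom_def)

lemma exact_monic_lift:
  assumes "is_monic C f" "exact_pair C f g" "f \<in> Hom C A B" "g \<in> Hom C B D"
    and "x \<in> Hom C Y B" "g \<cdot> x = Zero C Y D"
  obtains y where "y \<in> Hom C Y A" "f \<cdot> y = x"
  using kernel_lift[OF monic_exact_kernel[OF assms(1,2)], of x Y] assms(3-6)
  unfolding Hom_iff by metis

lemma exact_Zero_Hom:
  assumes "exact_pair C f g" "f \<in> Hom C A B" "g \<in> Hom C B D"
  shows "g \<cdot> f = Zero C A D"
  using exact_pair_Zero[OF assms(1)] assms(2,3) by (simp add: Hom_iff)

lemma exact_Zero_element:
  assumes "exact_pair C f g" "f \<in> Hom C A B" "g \<in> Hom C B D" "x \<in> Hom C Y A"
  shows "g \<cdot> (f \<cdot> x) = Zero C Y D"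
  using Cmp_eq_Cmp[OF exact_Zero_Hom[OF assms(1-3)] assms(2-4)]
    Cmp_Zero_Hom(2)[OF assms(4)] Hom_Obj[OF assms(3)] by simp

section \<open>Bridges of two-fold extensions\<close>

definition two_extension :: "'o \<Rightarrow> 'm \<Rightarrow> 'o \<Rightarrow> 'm \<Rightarrow> 'o \<Rightarrow> 'm \<Rightarrow> 'o \<Rightarrow> bool" where
  "two_extension P a T b Z c Q \<longleftrightarrow> a \<in> Hom C P T \<and> b \<in> Hom C T Z \<and> c \<in> Hom C Z Q \<and>
     is_monic C a \<and> exact_pair C a b \<and> exact_pair C b c \<and> is_epic C c"

lemma two_extensionD:
  assumes "two_extension P a T b Z c Q"
  shows "a \<in> Hom C P T" "b \<in> Hom C T Z" "c \<in> Hom C Z Q"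
     "is_monic C a" "exact_pair C a b" "exact_pair C b c" "is_epic C c"
  using assms by (auto simp: two_extension_def)

text \<open>A bridge \<open>X\<close> lifts the extension of \<open>Q\<close> by the image of \<open>b\<close> to an extension of \<open>Q\<close> by
  \<open>T\<close>: if \<open>a\<close>, \<open>b\<close> and \<open>c : Z \<rightarrow> Q\<close> form a two-fold extension, then the sequence
  \<open>0 \<rightarrow> T \<rightarrow> X \<rightarrow> Q \<rightarrow> 0\<close> is exact as well. In terms of the long exact
  sequence, its existence says that the connecting map sends the class of \<open>Z\<close> to zero in
  \<open>Ext\<^sup>2(Q, P)\<close>.\<close>

definition bridged :: "'o \<Rightarrow> 'm \<Rightarrow> 'o \<Rightarrow> 'm \<Rightarrow> 'o \<Rightarrow> bool" where
  "bridged P a T b Z \<longleftrightarrow>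
     (\<exists>X m n. m \<in> Hom C T X \<and> n \<in> Hom C X Z \<and> n \<cdot> m = b \<and> short_exact C P (m \<cdot> a) X n Z)"

text \<open>The kernel of \<open>m\<close> lies in the kernel of \<open>b = n \<cdot> m\<close>, which is \<open>P\<close>, and \<open>m\<close> is monic
  on \<open>P\<close>.\<close>

lemma bridge_monic:
  assumes ext: "two_extension P a T b Z c Q"
    and m: "m \<in> Hom C T X" and n: "n \<in> Hom C X Z" and nm: "n \<cdot> m = b" and mono: "is_monic C (m \<cdot> a)"
  shows "is_monic C m"
proof (rule monicI[OF m])
  note E = two_extensionD[OF ext]
  fix Y t assume t: "t \<in> Hom C Y T" "m \<cdot> t = Zero C Y X"
  have "b \<cdot> t = n \<cdot> (m \<cdot> t)" using Cmp_eq_Cmp[OF nm m n t(1)] by simp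
  also have "\<dots> = Zero C Y Z" unfolding t(2) using Cmp_Zero_Hom(1)[OF n] Hom_Obj[OF t(1)] by simp
  finally obtain u where u: "u \<in> Hom C Y P" "a \<cdot> u = t"
    using exact_monic_lift[OF E(4,5,1,2) t(1)] by blast
  have "(m \<cdot> a) \<cdot> u = Zero C Y X" using Cmp_assoc[OF u(1) E(1) m] u(2) t(2) by simp
  then have "u = Zero C Y P" by (rule monic_Hom_Zero[OF mono Cmp_Hom[OF E(1) m] u(1)])
  then show "t = Zero C Y T" using u(2) Cmp_Zero_Hom(1)[OF E(1)] Hom_Obj[OF t(1)] by simp
qed

text \<open>The pullback of \<open>n' : X' \<rightarrow> Z'\<close> along \<open>\<beta>\<close> is again epic, and its kernel is still \<open>P\<close>.\<close>

lemma bridged_pullback: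
  assumes ext: "two_extension P a T b Z c Q" and ext': "two_extension P a' T' b' Z' c' Q"
    and \<alpha>: "\<alpha> \<in> Hom C T T'" and \<beta>: "\<beta> \<in> Hom C Z Z'"
    and sq: "\<alpha> \<cdot> a = a'" "b' \<cdot> \<alpha> = \<beta> \<cdot> b"
    and br: "bridged P a' T' b' Z'"
  shows "bridged P a T b Z"
proof -
  note E = two_extensionD[OF ext] and E' = two_extensionD[OF ext']
  obtain X' m' n' where X': "m' \<in> Hom C T' X'" "n' \<in> Hom C X' Z'" "n' \<cdot> m' = b'"
      "short_exact C P (m' \<cdot> a') X' n' Z'"
    using br unfolding bridged_def by blast
  have se: "m' \<cdot> a' \<in> Hom C P X'" "is_monic C (m' \<cdot> a')" "exact_pair C (m' \<cdot> a') n'" "is_epic C n'"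
    using X'(4) by (auto simp: short_exact_iff)
  obtain p q X where X: "is_pullback C n' \<beta> p q" "p \<in> Hom C X X'" "q \<in> Hom C X Z" "n' \<cdot> p = \<beta> \<cdot> q"
    using pullback_exists[OF X'(2) \<beta>] .
  have "n' \<cdot> (m' \<cdot> \<alpha>) = \<beta> \<cdot> b" using Cmp_eq_Cmp[OF X'(3,1,2) \<alpha>] sq(2) by simp
  then obtain m where m: "m \<in> Hom C T X" "p \<cdot> m = m' \<cdot> \<alpha>" "q \<cdot> m = b"
    using pullback_induced[OF X(1-3) Cmp_Hom[OF \<alpha> X'(1)] E(2)] by blast
  have ma: "m \<cdot> a \<in> Hom C P X" using E(1) m(1) by (rule Cmp_Hom)
  have pma: "p \<cdot> (m \<cdot> a) = m' \<cdot> a'"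
    using Cmp_eq_Cmp[OF m(2,1) X(2) E(1)] Cmp_assoc[OF E(1) \<alpha> X'(1)] sq(1) by simp
  have qma: "q \<cdot> (m \<cdot> a) = Zero C P Z"
    using Cmp_eq_Cmp[OF m(3,1) X(3) E(1)] exact_Zero_Hom[OF E(5,1,2)] by simp
  have "is_monic C (m \<cdot> a)" using monic_factor[of p "m \<cdot> a"] pma se(2) ma X(2) by simp
  moreover have "is_epic C q" using pullback_epic[OF X(1) X'(2) \<beta> se(4)] .
  moreover have "exact_pair C (m \<cdot> a) q"
  proof (rule exact_pairI[OF ma X(3) qma])
    fix Y x assume x: "x \<in> Hom C Y X" "q \<cdot> x = Zero C Y Z"
    have "n' \<cdot> (p \<cdot> x) = \<beta> \<cdot> (q \<cdot> x)" using Cmp_square[OF X(4,2) X'(2) X(3) \<beta> x(1)] .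
    also have "\<dots> = Zero C Y Z'" unfolding x(2) using Cmp_Zero_Hom(1)[OF \<beta>] Hom_Obj[OF x(1)] by simp
    finally obtain u where u: "u \<in> Hom C Y P" "(m' \<cdot> a') \<cdot> u = p \<cdot> x"
      using exact_monic_lift[OF se(2,3,1) X'(2) Cmp_Hom[OF x(1) X(2)]] by blast
    have "p \<cdot> ((m \<cdot> a) \<cdot> u) = p \<cdot> x" using Cmp_eq_Cmp[OF pma ma X(2) u(1)] u(2) by simp
    moreover have "q \<cdot> ((m \<cdot> a) \<cdot> u) = q \<cdot> x"
      using Cmp_eq_Cmp[OF qma ma X(3) u(1)] x(2) Cmp_Zero_Hom(2)[OF u(1)] Hom_Obj[OF X(3)] by simp
    ultimately have "(m \<cdot> a) \<cdot> u = x"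
      by (rule pullback_joint_monic[OF X(1-3) Cmp_Hom[OF u(1) ma] x(1)])
    then show "in_image (m \<cdot> a) x" by (rule in_image_cmp[OF ma u(1)])
  qed
  ultimately have "short_exact C P (m \<cdot> a) X q Z" using ma X(3) by (simp add: short_exact_iff)
  then show ?thesis unfolding bridged_def using m X(3) by blast
qed

text \<open>The new bridge \<open>X'\<close> is the pushout of \<open>m : T \<rightarrow> X\<close> along \<open>\<alpha>\<close>. Its elements are locally sums
  of elements of \<open>T'\<close> and \<open>X\<close>. For surjectivity of \<open>X' \<rightarrow> Z'\<close>, an element of \<open>Z'\<close> is first matched
  with an element of \<open>X\<close> over \<open>Q\<close>; what remains comes from \<open>T'\<close>. For exactness at \<open>X'\<close>, the part in
  \<open>X\<close> of an element of the kernel vanishes in \<open>Q\<close>, so it comes from \<open>T\<close>. The element then comes from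
  \<open>T'\<close>, where exactness of the target extension applies.\<close>

lemma bridged_pushout:
  assumes ext: "two_extension P a T b Z c Q" and ext': "two_extension P a' T' b' Z' c' Q"
    and \<alpha>: "\<alpha> \<in> Hom C T T'" and \<beta>: "\<beta> \<in> Hom C Z Z'"
    and sq: "\<alpha> \<cdot> a = a'" "b' \<cdot> \<alpha> = \<beta> \<cdot> b" "c' \<cdot> \<beta> = c"
    and br: "bridged P a T b Z"
  shows "bridged P a' T' b' Z'"
proof -
  note E = two_extensionD[OF ext] and E' = two_extensionD[OF ext']
  obtain X m n where X: "m \<in> Hom C T X" "n \<in> Hom C X Z" "n \<cdot> m = b"
      "short_exact C P (m \<cdot> a) X n Z"
    using br unfolding bridged_def by blast
  have se: "m \<cdot> a \<in> Hom C P X" "is_monic C (m \<cdot> a)" "exact_pair C (m \<cdot> a) n" "is_epic C n"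
    using X(4) by (auto simp: short_exact_iff)
  have m_monic: "is_monic C m" using bridge_monic[OF ext X(1-3) se(2)] .
  obtain m' \<xi> X' where X': "is_pushout C \<alpha> m m' \<xi>" "m' \<in> Hom C T' X'" "\<xi> \<in> Hom C X X'"
      "m' \<cdot> \<alpha> = \<xi> \<cdot> m"
    using pushout_exists[OF \<alpha> X(1)] .
  have "b' \<cdot> \<alpha> = (\<beta> \<cdot> n) \<cdot> m" using Cmp_assoc[OF X(1,2) \<beta>] X(3) sq(2) by simp
  then obtain n' where n': "n' \<in> Hom C X' Z'" "n' \<cdot> m' = b'" "n' \<cdot> \<xi> = \<beta> \<cdot> n"
    using pushout_induced[OF X'(1-3) E'(2) Cmp_Hom[OF X(2) \<beta>]] by blast
  have m'a': "m' \<cdot> a' \<in> Hom C P X'" using E'(1) X'(2) by (rule Cmp_Hom)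
  have mono: "is_monic C (m' \<cdot> a')"
    using pushout_monic[OF X'(1) \<alpha> X(1) m_monic] E'(1,4) X'(2)
    by (intro monic_Cmp) (auto simp: Hom_iff)
  have zero: "n' \<cdot> (m' \<cdot> a') = Zero C P Z'"
    using Cmp_eq_Cmp[OF n'(2) X'(2) n'(1) E'(1)] exact_Zero_Hom[OF E'(5,1,2)] by simp
  have cn: "c' \<cdot> (\<beta> \<cdot> z) = c \<cdot> z" if "z \<in> Hom C Y Z" for Y z
    using Cmp_eq_Cmp[OF sq(3) \<beta> E'(3) that] .
  have "in_image n' x" if x: "x \<in> Hom C Y Z'" for Y x
  proof -
    have "c' \<cdot> x \<in> Hom C Y (Tgt C c)" "Src C c = Z"
      using Cmp_Hom[OF x E'(3)] E(3) by (auto simp: Hom_iff)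
    then obtain Y1 r1 z where r1: "r1 \<in> Hom C Y1 Y" "is_epic C r1" "z \<in> Hom C Y1 Z"
        "c \<cdot> z = (c' \<cdot> x) \<cdot> r1"
      using epic_lift[OF E(7)] by metis
    have "z \<in> Hom C Y1 (Tgt C n)" "Src C n = X" using r1(3) X(2) by (auto simp: Hom_iff)
    then obtain Y2 r2 y where r2: "r2 \<in> Hom C Y2 Y1" "is_epic C r2" "y \<in> Hom C Y2 X"
        "n \<cdot> y = z \<cdot> r2"
      using epic_lift[OF se(4)] by metis
    let ?r = "r1 \<cdot> r2"
    have r: "?r \<in> Hom C Y2 Y" "is_epic C ?r"
      using Cmp_Hom[OF r2(1) r1(1)] epic_Cmp[OF r2(2) r1(2)] r1(1) r2(1) by (auto simp: Hom_iff)
    have ny: "n \<cdot> y \<in> Hom C Y2 Z" using Cmp_Hom[OF r2(3) X(2)] .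
    have xr: "x \<cdot> ?r \<in> Hom C Y2 Z'" using Cmp_Hom[OF r(1) x] .
    have "c' \<cdot> (x \<cdot> ?r) = (c \<cdot> z) \<cdot> r2" unfolding r1(4)
      using x E'(3) r1(1) r2(1) by (simp add: Hom_iff)
    also have "\<dots> = c' \<cdot> (\<beta> \<cdot> (n \<cdot> y))" unfolding cn[OF ny] unfolding r2(4)
      using E(3) r1(3) r2(1) by (simp add: Hom_iff)
    finally obtain Y3 r3 t where r3: "r3 \<in> Hom C Y3 Y2" "is_epic C r3" "t \<in> Hom C Y3 T'"
        "(x \<cdot> ?r) \<cdot> r3 = ((\<beta> \<cdot> (n \<cdot> y)) \<cdot> r3) \<oplus> (b' \<cdot> t)"
      using exact_difference[OF E'(6,2,3) xr Cmp_Hom[OF ny \<beta>]] by blast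
    have yr: "y \<cdot> r3 \<in> Hom C Y3 X" using Cmp_Hom[OF r3(1) r2(3)] .
    have w: "(\<xi> \<cdot> (y \<cdot> r3)) \<oplus> (m' \<cdot> t) \<in> Hom C Y3 X'"
      using Add_Hom[OF Cmp_Hom[OF yr X'(3)] Cmp_Hom[OF r3(3) X'(2)]] .
    have "n' \<cdot> ((\<xi> \<cdot> (y \<cdot> r3)) \<oplus> (m' \<cdot> t)) = (n' \<cdot> (\<xi> \<cdot> (y \<cdot> r3))) \<oplus> (n' \<cdot> (m' \<cdot> t))"
      using Cmp_Add_right[OF Cmp_Hom[OF yr X'(3)] Cmp_Hom[OF r3(3) X'(2)] n'(1)] .
    also have "n' \<cdot> (m' \<cdot> t) = b' \<cdot> t" using Cmp_eq_Cmp[OF n'(2) X'(2) n'(1) r3(3)] .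
    also have "n' \<cdot> (\<xi> \<cdot> (y \<cdot> r3)) = (\<beta> \<cdot> (n \<cdot> y)) \<cdot> r3"
      using Cmp_eq_Cmp[OF n'(3) X'(3) n'(1) yr] \<beta> X(2) r2(3) r3(1) by (simp add: Hom_iff)
    finally have "in_image n' ((x \<cdot> ?r) \<cdot> r3)"
      using in_image_cmp[OF n'(1) w] r3(4) by simp
    then have "in_image n' (x \<cdot> ?r)" using in_image_cover[OF _ r3(1,2) xr] by blast
    then show ?thesis using in_image_cover[OF _ r x] by blast
  qed
  then have epi: "is_epic C n'" unfolding epic_iff_in_image using n'(1) by (auto simp: Hom_iff)
  have "exact_pair C (m' \<cdot> a') n'"
  proof (rule exact_pairI[OF m'a' n'(1) zero])
    fix Y x assume x: "x \<in> Hom C Y X'" "n' \<cdot> x = Zero C Y Z'"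
    obtain Y1 r1 t y where r1: "r1 \<in> Hom C Y1 Y" "is_epic C r1" "t \<in> Hom C Y1 T'" "y \<in> Hom C Y1 X"
        "x \<cdot> r1 = (m' \<cdot> t) \<oplus> (\<xi> \<cdot> y)"
      using pushout_element[OF X'(1-3) x(1)] .
    have ny: "n \<cdot> y \<in> Hom C Y1 Z" using Cmp_Hom[OF r1(4) X(2)] .
    have "n' \<cdot> (x \<cdot> r1) = Zero C Y1 Z'"
      using Cmp_assoc[OF r1(1) x(1) n'(1)] x(2) Cmp_Zero_Hom(2)[OF r1(1)] Hom_Obj[OF n'(1)] by simp
    then have "(b' \<cdot> t) \<oplus> (\<beta> \<cdot> (n \<cdot> y)) = Zero C Y1 Z'"
      unfolding r1(5) Cmp_Add_right[OF Cmp_Hom[OF r1(3) X'(2)] Cmp_Hom[OF r1(4) X'(3)] n'(1)]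
        Cmp_eq_Cmp[OF n'(2) X'(2) n'(1) r1(3)] Cmp_square[OF n'(3) X'(3) n'(1) X(2) \<beta> r1(4)] .
    then have "c' \<cdot> ((b' \<cdot> t) \<oplus> (\<beta> \<cdot> (n \<cdot> y))) = Zero C Y1 Q"
      using Cmp_Zero_Hom(1)[OF E'(3)] Hom_Obj[OF r1(1)] by simp
    then have "Zero C Y1 Q \<oplus> (c \<cdot> (n \<cdot> y)) = Zero C Y1 Q"
      unfolding Cmp_Add_right[OF Cmp_Hom[OF r1(3) E'(2)] Cmp_Hom[OF ny \<beta>] E'(3)]
        exact_Zero_element[OF E'(6,2,3) r1(3)] cn[OF ny] .
    then have "c \<cdot> (n \<cdot> y) = Zero C Y1 Q" using Cmp_Hom[OF ny E(3)] by (simp add: Hom_iff)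
    then obtain Y2 r2 s where r2: "r2 \<in> Hom C Y2 Y1" "is_epic C r2" "s \<in> Hom C Y2 T"
        "b \<cdot> s = (n \<cdot> y) \<cdot> r2"
      using exact_lift[OF E(6,2,3) ny] by blast
    have yr: "y \<cdot> r2 \<in> Hom C Y2 X" and ms: "m \<cdot> s \<in> Hom C Y2 X"
      using Cmp_Hom[OF r2(1) r1(4)] Cmp_Hom[OF r2(3) X(1)] by auto
    have "n \<cdot> (y \<cdot> r2) = n \<cdot> (m \<cdot> s)"
      using Cmp_assoc[OF r2(1) r1(4) X(2)] Cmp_eq_Cmp[OF X(3,1,2) r2(3)] r2(4) by simp
    then obtain u where u: "u \<in> Hom C Y2 P" "y \<cdot> r2 = (m \<cdot> s) \<oplus> ((m \<cdot> a) \<cdot> u)"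
      using monic_exact_difference[OF se(2,3,1) X(2) yr ms] by blast
    define v where "v = s \<oplus> (a \<cdot> u)"
    have v: "v \<in> Hom C Y2 T" unfolding v_def using r2(3) Cmp_Hom[OF u(1) E(1)] by (rule Add_Hom)
    have yv: "y \<cdot> r2 = m \<cdot> v" unfolding u(2) v_def
      using Cmp_Add_right[OF r2(3) Cmp_Hom[OF u(1) E(1)] X(1)] Cmp_assoc[OF u(1) E(1) X(1)] by simp
    \<comment> \<open>Over the current cover \<open>x\<close> is the image of the element \<open>w\<close> of \<open>T'\<close>.\<close>
    define w where "w = (t \<cdot> r2) \<oplus> (\<alpha> \<cdot> v)"
    have w: "w \<in> Hom C Y2 T'"
      unfolding w_def using Cmp_Hom[OF r2(1) r1(3)] Cmp_Hom[OF v \<alpha>] by (rule Add_Hom)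
    have "(x \<cdot> r1) \<cdot> r2 = (m' \<cdot> (t \<cdot> r2)) \<oplus> (\<xi> \<cdot> (y \<cdot> r2))"
      unfolding r1(5) using r1(3,4) r2(1) X'(2,3) by (simp add: Hom_iff)
    also have "\<xi> \<cdot> (y \<cdot> r2) = m' \<cdot> (\<alpha> \<cdot> v)"
      unfolding yv using Cmp_square[OF X'(4) \<alpha> X'(2) X(1) X'(3) v] by simp
    also have "(m' \<cdot> (t \<cdot> r2)) \<oplus> \<dots> = m' \<cdot> w"
      unfolding w_def using Cmp_Add_right[OF Cmp_Hom[OF r2(1) r1(3)] Cmp_Hom[OF v \<alpha>] X'(2)] by simp
    finally have xw: "(x \<cdot> r1) \<cdot> r2 = m' \<cdot> w" .
    have "b' \<cdot> w = n' \<cdot> ((x \<cdot> r1) \<cdot> r2)"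
      unfolding xw using Cmp_eq_Cmp[OF n'(2) X'(2) n'(1) w] by simp
    also have "\<dots> = (n' \<cdot> x) \<cdot> (r1 \<cdot> r2)" using n'(1) x(1) r1(1) r2(1) by (simp add: Hom_iff)
    also have "\<dots> = Zero C Y2 Z'"
      unfolding x(2) using r1(1) r2(1) n'(1) by (simp add: Hom_iff)
    finally obtain q where q: "q \<in> Hom C Y2 P" "a' \<cdot> q = w"
      using exact_monic_lift[OF E'(4,5,1,2) w] by blast
    have "(m' \<cdot> a') \<cdot> q = (x \<cdot> r1) \<cdot> r2" unfolding xw q(2)[symmetric]
      by (rule Cmp_assoc[OF q(1) E'(1) X'(2)])
    then have "in_image (m' \<cdot> a') ((x \<cdot> r1) \<cdot> r2)" by (rule in_image_cmp[OF m'a' q(1)])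
    then have "in_image (m' \<cdot> a') (x \<cdot> r1)"
      using in_image_cover[OF _ r2(1,2) Cmp_Hom[OF r1(1) x(1)]] by blast
    then show "in_image (m' \<cdot> a') x" using in_image_cover[OF _ r1(1,2) x(1)] by blast
  qed
  then have "short_exact C P (m' \<cdot> a') X' n' Z'"
    using m'a' n'(1) mono epi by (simp add: short_exact_iff)
  then show ?thesis unfolding bridged_def using X'(2) n'(1,2) by blast
qed

lemma zero_two_extension:
  assumes "P \<in> Obj C" "Q \<in> Obj C"
  shows "two_extension P (Idn C P) P (Zero C P Q) Q (Idn C Q) Q"
  unfolding two_extension_def
proof (intro conjI)
  show t: "Idn C P \<in> Hom C P P" "Zero C P Q \<in> Hom C P Q" "Idn C Q \<in> Hom C Q Q"
    using assms by (auto simp: Hom_iff)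
  show "is_monic C (Idn C P)" "is_epic C (Idn C Q)" using assms monic_Idn epic_Idn by auto
  show "exact_pair C (Idn C P) (Zero C P Q)"
  proof (rule exact_pairI[OF t(1,2)])
    show "Zero C P Q \<cdot> Idn C P = Zero C P Q" using assms by simp
    fix Y x assume x: "x \<in> Hom C Y P"
    show "in_image (Idn C P) x" by (rule in_image_cmp[OF t(1) x Idn_Cmp[OF x]])
  qed
  show "exact_pair C (Zero C P Q) (Idn C Q)"
  proof (rule exact_pairI[OF t(2,3)])
    show "Idn C Q \<cdot> Zero C P Q = Zero C P Q" using assms by simp
    fix Y x assume x: "x \<in> Hom C Y Q" "Idn C Q \<cdot> x = Zero C Y Q"
    then have Y: "Y \<in> Obj C" "x = Zero C Y Q" using Idn_Cmp[OF x(1)] by (auto simp: Hom_iff)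
    have "Zero C P Q \<cdot> Zero C Y P = x" using Cmp_Zero_Hom(1)[OF t(2)] Y by simp
    then show "in_image (Zero C P Q) x"
      by (rule in_image_cmp[OF t(2) Zero_Hom[OF Y(1) assms(1)]])
  qed
qed

lemma zero_bridged:
  assumes "P \<in> Obj C" "Q \<in> Obj C"
  shows "bridged P (Idn C P) P (Zero C P Q) Q"
proof -
  obtain W i j p q where W: "i \<in> Hom C P W" "j \<in> Hom C Q W" "p \<in> Hom C W P" "q \<in> Hom C W Q"
    "p \<cdot> i = Idn C P" "q \<cdot> j = Idn C Q" "p \<cdot> j = Zero C Q P" "q \<cdot> i = Zero C P Q"
    "(i \<cdot> p) \<oplus> (j \<cdot> q) = Idn C W"
    using biproduct_obtain[OF assms] .
  have "is_monic C i" using monic_factor[OF _ W(1,3)] W(5) monic_Idn[OF assms(1)] by simp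
  moreover have "is_epic C q" using epic_factor[of q j] W(2,4,6) epic_Idn[OF assms(2)] by (simp add: Hom_iff)
  moreover have "exact_pair C i q"
  proof (rule exact_pairI[OF W(1,4,8)])
    fix Y x assume x: "x \<in> Hom C Y W" "q \<cdot> x = Zero C Y Q"
    have "x = ((i \<cdot> p) \<oplus> (j \<cdot> q)) \<cdot> x" unfolding W(9) using Idn_Cmp[OF x(1)] by simp
    also have "\<dots> = (i \<cdot> (p \<cdot> x)) \<oplus> (j \<cdot> (q \<cdot> x))" using x(1) W(1-4) by (simp add: Hom_iff)
    also have "\<dots> = i \<cdot> (p \<cdot> x)" unfolding x(2) using x(1) W(1-4) by (simp add: Hom_iff)
    finally show "in_image i x" using in_image_cmp[OF W(1) Cmp_Hom[OF x(1) W(3)]] by simp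
  qed
  ultimately have "short_exact C P (i \<cdot> Idn C P) W q Q"
    using W(1,4) Cmp_Idn[OF W(1)] by (simp add: short_exact_iff)
  then show ?thesis unfolding bridged_def using W(1,4,8) by blast
qed

text \<open>A bridge lets \<open>X\<close> replace \<open>Z\<close> once \<open>T\<close> is enlarged to the biproduct \<open>W\<close> of
  \<open>P\<close> and \<open>T\<close>. Because \<open>P\<close> is a summand of \<open>W\<close>, this extension also maps to the trivial one.\<close>

lemma bridge_split_extension:
  assumes ext: "two_extension P a T b Z c Q"
    and m: "m \<in> Hom C T X" and n: "n \<in> Hom C X Z" and nm: "n \<cdot> m = b"
    and se: "short_exact C P (m \<cdot> a) X n Z"
    and W: "k \<in> Hom C P W" "l \<in> Hom C T W" "p \<in> Hom C W P" "q \<in> Hom C W T"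
    "p \<cdot> k = Idn C P" "q \<cdot> l = Idn C T" "p \<cdot> l = Zero C T P" "q \<cdot> k = Zero C P T"
    "(k \<cdot> p) \<oplus> (l \<cdot> q) = Idn C W"
  shows "two_extension P k W (m \<cdot> q) X (c \<cdot> n) Q"
    and "c \<cdot> n \<cdot> m \<cdot> q = Zero C W Q"
proof -
  note E = two_extensionD[OF ext]
  have se': "m \<cdot> a \<in> Hom C P X" "is_monic C (m \<cdot> a)" "exact_pair C (m \<cdot> a) n" "is_epic C n"
    using se by (auto simp: short_exact_iff)
  have m_monic: "is_monic C m" using bridge_monic[OF ext m n nm se'(2)] .
  have mq: "m \<cdot> q \<in> Hom C W X" using Cmp_Hom[OF W(4) m] .
  have cn: "c \<cdot> n \<in> Hom C X Q" using Cmp_Hom[OF n E(3)] .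
  have "c \<cdot> (n \<cdot> (m \<cdot> q)) = c \<cdot> (b \<cdot> q)" using Cmp_eq_Cmp[OF nm m n W(4)] by simp
  also have "\<dots> = Zero C W Q" using exact_Zero_element[OF E(6,2,3) W(4)] .
  finally show zero: "c \<cdot> n \<cdot> m \<cdot> q = Zero C W Q" .
  then have zero': "(c \<cdot> n) \<cdot> (m \<cdot> q) = Zero C W Q" using Cmp_assoc[OF mq n E(3)] by simp
  show "two_extension P k W (m \<cdot> q) X (c \<cdot> n) Q"
    unfolding two_extension_def
  proof (intro conjI W(1) mq cn)
    show "is_monic C k" using monic_factor[OF _ W(1,3)] W(5) monic_Idn Hom_Obj(1)[OF W(1)] by simp
    show "is_epic C (c \<cdot> n)" using epic_Cmp[OF se'(4) E(7)] n E(3) by (simp add: Hom_iff)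
    show "exact_pair C k (m \<cdot> q)"
    proof (rule exact_pairI[OF W(1) mq])
      show "(m \<cdot> q) \<cdot> k = Zero C P X"
        using Cmp_assoc[OF W(1,4) m] W(8) Cmp_Zero_Hom(1)[OF m] Hom_Obj[OF W(1)] by simp
      fix Y x assume x: "x \<in> Hom C Y W" "(m \<cdot> q) \<cdot> x = Zero C Y X"
      then have qx: "q \<cdot> x = Zero C Y T"
        using monic_Hom_Zero[OF m_monic m Cmp_Hom[OF x(1) W(4)]] Cmp_assoc[OF x(1) W(4) m] by simp
      have "x = ((k \<cdot> p) \<oplus> (l \<cdot> q)) \<cdot> x" unfolding W(9) using Idn_Cmp[OF x(1)] by simp
      also have "\<dots> = (k \<cdot> (p \<cdot> x)) \<oplus> (l \<cdot> (q \<cdot> x))" using x(1) W(1-4) by (simp add: Hom_iff)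
      also have "\<dots> = k \<cdot> (p \<cdot> x)" unfolding qx using x(1) W(1-4) by (simp add: Hom_iff)
      finally show "in_image k x" using in_image_cmp[OF W(1) Cmp_Hom[OF x(1) W(3)]] by simp
    qed
    show "exact_pair C (m \<cdot> q) (c \<cdot> n)"
    proof (rule exact_pairI[OF mq cn zero'])
      fix Y x assume x: "x \<in> Hom C Y X" "(c \<cdot> n) \<cdot> x = Zero C Y Q"
      have nx: "n \<cdot> x \<in> Hom C Y Z" using Cmp_Hom[OF x(1) n] .
      have "c \<cdot> (n \<cdot> x) = Zero C Y Q" using Cmp_assoc[OF x(1) n E(3)] x(2) by simp
      then obtain Y1 r t where r: "r \<in> Hom C Y1 Y" "is_epic C r" "t \<in> Hom C Y1 T" "b \<cdot> t = (n \<cdot> x) \<cdot> r"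
        using exact_lift[OF E(6,2,3) nx] by blast
      have "n \<cdot> (x \<cdot> r) = n \<cdot> (m \<cdot> t)"
        using Cmp_assoc[OF r(1) x(1) n] Cmp_eq_Cmp[OF nm m n r(3)] r(4) by simp
      then obtain u where u: "u \<in> Hom C Y1 P" "x \<cdot> r = (m \<cdot> t) \<oplus> ((m \<cdot> a) \<cdot> u)"
        using monic_exact_difference[OF se'(2,3,1) n Cmp_Hom[OF r(1) x(1)] Cmp_Hom[OF r(3) m]] by blast
      define v where "v = t \<oplus> (a \<cdot> u)"
      have v: "v \<in> Hom C Y1 T" unfolding v_def using r(3) Cmp_Hom[OF u(1) E(1)] by (rule Add_Hom)
      have "(m \<cdot> q) \<cdot> (l \<cdot> v) = m \<cdot> v"
        using Cmp_assoc[OF Cmp_Hom[OF v W(2)] W(4) m] Cmp_eq_Cmp[OF W(6,2,4) v] Idn_Cmp[OF v] by simp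
      also have "\<dots> = x \<cdot> r" unfolding u(2) v_def
        using Cmp_Add_right[OF r(3) Cmp_Hom[OF u(1) E(1)] m] Cmp_assoc[OF u(1) E(1) m] by simp
      finally have "in_image (m \<cdot> q) (x \<cdot> r)" by (rule in_image_cmp[OF mq Cmp_Hom[OF v W(2)]])
      then show "in_image (m \<cdot> q) x" using in_image_cover[OF _ r(1,2) x(1)] by blast
    qed
  qed
qed

section \<open>Yoneda classes\<close>

lemma extensions_2_two_extension:
  "xs \<in> extensions C 2 Q P \<longleftrightarrow> (\<exists>a b c T Z. xs = [a, b, c] \<and> two_extension P a T b Z c Q)"
  unfolding extensions_2_iff two_extension_def by blast

lemma extension_rel_1E:
  assumes "(xs, ys) \<in> extension_rel C 1 Q P"
  obtains f A g f' A' g' \<alpha> where "xs = [f, g]" "ys = [f', g']" "short_exact C P f A g Q"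
    "short_exact C P f' A' g' Q" "\<alpha> \<in> Hom C A A'" "\<alpha> \<cdot> f = f'" "g' \<cdot> \<alpha> = g"
proof -
  obtain us where xs: "xs \<in> extensions C 1 Q P" and ys: "ys \<in> extensions C 1 Q P"
    and us: "extension_morphism C 1 Q P xs ys us"
    using assms unfolding extension_rel_def by blast
  obtain f g A where f: "xs = [f, g]" "short_exact C P f A g Q"
    using xs unfolding extensions_1_iff by blast
  obtain f' g' A' where f': "ys = [f', g']" "short_exact C P f' A' g' Q"
    using ys unfolding extensions_1_iff by blast
  have ty: "f \<in> Hom C P A" "g \<in> Hom C A Q" "f' \<in> Hom C P A'" "g' \<in> Hom C A' Q"
    using f(2) f'(2) by (auto simp: short_exact_iff)
  have ST: "Src C f = P" "Tgt C f = A" "Src C f' = P" "Tgt C f' = A'"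
    using ty by (auto simp: Hom_iff)
  obtain \<alpha> where "us = [Idn C P, \<alpha>, Idn C Q]"
    using us unfolding extension_morphism_def
    by (auto simp: length_Suc_conv numeral_3_eq_3)
  then have "\<alpha> \<in> Hom C A A'" "f' \<cdot> Idn C P = \<alpha> \<cdot> f" "g' \<cdot> \<alpha> = Idn C Q \<cdot> g"
    using us f(1) f'(1) ST unfolding extension_morphism_def
    by (auto simp: le_Suc_eq)
  then show ?thesis using that f f' Cmp_Idn[OF ty(3)] Idn_Cmp[OF ty(2)] by metis
qed

lemma extension_rel_2E:
  assumes "(xs, ys) \<in> extension_rel C 2 Q P"
  obtains a T b Z c a' T' b' Z' c' \<alpha> \<beta> where "xs = [a, b, c]" "ys = [a', b', c']"
    "two_extension P a T b Z c Q" "two_extension P a' T' b' Z' c' Q"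
    "\<alpha> \<in> Hom C T T'" "\<beta> \<in> Hom C Z Z'" "\<alpha> \<cdot> a = a'" "b' \<cdot> \<alpha> = \<beta> \<cdot> b" "c' \<cdot> \<beta> = c"
proof -
  obtain us where xs: "xs \<in> extensions C 2 Q P" and ys: "ys \<in> extensions C 2 Q P"
    and us: "extension_morphism C 2 Q P xs ys us"
    using assms unfolding extension_rel_def by blast
  obtain a b c T Z where x: "xs = [a, b, c]" "two_extension P a T b Z c Q"
    using xs unfolding extensions_2_two_extension by blast
  obtain a' b' c' T' Z' where y: "ys = [a', b', c']" "two_extension P a' T' b' Z' c' Q"
    using ys unfolding extensions_2_two_extension by blast
  note E = two_extensionD[OF x(2)] and E' = two_extensionD[OF y(2)]
  have ST: "Src C a = P" "Tgt C a = T" "Src C a' = P" "Tgt C a' = T'"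
    "Src C b = T" "Tgt C b = Z" "Src C b' = T'" "Tgt C b' = Z'"
    using E(1,2) E'(1,2) by (auto simp: Hom_iff)
  have "length us = Suc (Suc (Suc (Suc 0)))" "us ! 0 = Idn C P" "us ! 3 = Idn C Q"
    using us unfolding extension_morphism_def by auto
  then obtain \<alpha> \<beta> where usl: "us = [Idn C P, \<alpha>, \<beta>, Idn C Q]"
    by (auto simp: length_Suc_conv numeral_3_eq_3)
  have i: "us ! i \<in> Hom C (Src C (xs ! i)) (Src C (ys ! i))"
     "us ! (i + 1) \<in> Hom C (Tgt C (xs ! i)) (Tgt C (ys ! i))"
     "ys ! i \<cdot> us ! i = us ! (i + 1) \<cdot> xs ! i" if "i \<le> 2" for i
    using us that unfolding extension_morphism_def by blast+
  have "\<alpha> \<in> Hom C T T'" "a' \<cdot> Idn C P = \<alpha> \<cdot> a"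
    using i(2,3)[of 0] unfolding usl x(1) y(1) by (simp_all add: ST)
  moreover have "\<beta> \<in> Hom C Z Z'" "b' \<cdot> \<alpha> = \<beta> \<cdot> b"
    using i(2,3)[of 1] unfolding usl x(1) y(1) by (simp_all add: ST)
  moreover have "c' \<cdot> \<beta> = Idn C Q \<cdot> c"
    using i(3)[of 2] unfolding usl x(1) y(1) by (simp add: ST numeral_3_eq_3)
  ultimately show ?thesis
    using that x y Cmp_Idn[OF E'(1)] Idn_Cmp[OF E(3)] by metis
qed

lemma extension_rel_2I:
  assumes x: "two_extension P a T b Z c Q" and y: "two_extension P a' T' b' Z' c' Q"
    and \<alpha>: "\<alpha> \<in> Hom C T T'" and \<beta>: "\<beta> \<in> Hom C Z Z'"
    and sq: "\<alpha> \<cdot> a = a'" "b' \<cdot> \<alpha> = \<beta> \<cdot> b" "c' \<cdot> \<beta> = c"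
  shows "([a, b, c], [a', b', c']) \<in> extension_rel C 2 Q P"
proof -
  note E = two_extensionD[OF x] and E' = two_extensionD[OF y]
  have ST: "Src C a = P" "Tgt C a = T" "Src C a' = P" "Tgt C a' = T'"
    "Src C b = T" "Tgt C b = Z" "Src C b' = T'" "Tgt C b' = Z'"
    "Src C c = Z" "Tgt C c = Q" "Src C c' = Z'" "Tgt C c' = Q"
    using E(1,2,3) E'(1,2,3) by (auto simp: Hom_iff)
  have PQ: "Idn C P \<in> Hom C P P" "Idn C Q \<in> Hom C Q Q"
    using Idn_Hom Hom_Obj[OF E(1)] Hom_Obj[OF E(3)] by auto
  have "extension_morphism C 2 Q P [a, b, c] [a', b', c'] [Idn C P, \<alpha>, \<beta>, Idn C Q]"
    unfolding extension_morphism_def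
    using PQ \<alpha> \<beta> sq Cmp_Idn[OF E'(1)] Idn_Cmp[OF E(3)]
    by (auto simp: ST le_Suc_eq numeral_2_eq_2)
  moreover have "[a, b, c] \<in> extensions C 2 Q P" "[a', b', c'] \<in> extensions C 2 Q P"
    using x y unfolding extensions_2_two_extension by blast+
  ultimately show ?thesis unfolding extension_rel_def by blast
qed

text \<open>Everything that is well defined on classes is obtained from this: a function that is
  constant along morphisms of extensions is constant on Yoneda classes. It is applied to predicates and
  to functions whose values are again classes.\<close>

lemma yoneda_equiv_invariant:
  assumes "(xs, ys) \<in> yoneda_equiv C n Q P"
    and "\<And>xs ys. (xs, ys) \<in> extension_rel C n Q P \<Longrightarrow> I xs = I ys"
  shows "I xs = I ys"
proof -
  have "(xs, ys) \<in> (extension_rel C n Q P \<union> (extension_rel C n Q P)\<inverse>)\<^sup>*"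
    using assms(1) by (simp add: yoneda_equiv_def)
  then show ?thesis
    by (induction rule: rtrancl_induct) (use assms(2) in force)+
qed

lemma ext_class_invariant:
  assumes "ys \<in> ext_class C n Q P xs"
    and "\<And>xs ys. (xs, ys) \<in> extension_rel C n Q P \<Longrightarrow> I xs = I ys"
  shows "I ys = I xs"
  using yoneda_equiv_invariant[of xs ys n Q P I] assms by (simp add: ext_class_def)

lemma ext_class_subset: "ys \<in> ext_class C n Q P xs \<Longrightarrow> ys \<in> extensions C n Q P"
  by (auto simp: ext_class_def yoneda_equiv_def)

lemma ext_class_self: "xs \<in> extensions C n Q P \<Longrightarrow> xs \<in> ext_class C n Q P xs"
  by (auto simp: ext_class_def yoneda_equiv_def)

lemma ext_class_eq_iff:
  assumes "xs \<in> extensions C n Q P" "ys \<in> extensions C n Q P"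
  shows "ext_class C n Q P xs = ext_class C n Q P ys \<longleftrightarrow> (xs, ys) \<in> yoneda_equiv C n Q P"
  unfolding ext_class_def by (rule eq_equiv_class_iff[OF equiv_yoneda_equiv assms])

lemma ext_class_eqI:
  assumes "(xs, ys) \<in> extension_rel C n Q P"
  shows "ext_class C n Q P xs = ext_class C n Q P ys"
proof -
  have "xs \<in> extensions C n Q P" "ys \<in> extensions C n Q P"
    using assms by (auto simp: extension_rel_def)
  moreover from this have "(xs, ys) \<in> yoneda_equiv C n Q P"
    using assms by (auto simp: yoneda_equiv_def)
  ultimately show ?thesis by (simp add: ext_class_eq_iff)
qed

text \<open>Transport of bridges along morphisms carries the bridge of the trivial
  extension to every extension of the zero class. In the other direction a bridge yields an extension
  with morphisms to both the given and the trivial extension.\<close>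

lemma bridged_iff_class_zero:
  assumes ext: "two_extension P a T b Z c Q"
  shows "ext_class C 2 Q P [a, b, c] = Ext2_zero C Q P \<longleftrightarrow> bridged P a T b Z"
proof
  note E = two_extensionD[OF ext]
  have PQ: "P \<in> Obj C" "Q \<in> Obj C" using Hom_Obj E(1,3) by auto
  \<comment> \<open>The objects \<open>T\<close> and \<open>Z\<close> are read off from the middle arrow, which makes having a bridge a
    predicate on lists of arrows.\<close>
  let ?I = "\<lambda>xs. bridged P (xs ! 0) (Src C (xs ! 1)) (xs ! 1) (Tgt C (xs ! 1))"
  have I: "?I [a, b, c] = bridged P a T b Z" if "two_extension P a T b Z c Q" for a T b Z c
    using two_extensionD(2)[OF that] by (simp add: Hom_def)
  have inv: "?I xs = ?I ys" if rel: "(xs, ys) \<in> extension_rel C 2 Q P" for xs ys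
  proof -
    obtain a T b Z c a' T' b' Z' c' \<alpha> \<beta> where xs: "xs = [a, b, c]" "ys = [a', b', c']"
      and ex: "two_extension P a T b Z c Q" "two_extension P a' T' b' Z' c' Q"
      and m: "\<alpha> \<in> Hom C T T'" "\<beta> \<in> Hom C Z Z'" "\<alpha> \<cdot> a = a'" "b' \<cdot> \<alpha> = \<beta> \<cdot> b" "c' \<cdot> \<beta> = c"
      using extension_rel_2E[OF rel] .
    show ?thesis unfolding xs I[OF ex(1)] I[OF ex(2)]
      using bridged_pushout[OF ex m] bridged_pullback[OF ex m(1-4)] by blast
  qed
  have mem: "[a, b, c] \<in> extensions C 2 Q P" using ext extensions_2_two_extension by blast
  {
    assume "ext_class C 2 Q P [a, b, c] = Ext2_zero C Q P"
    then have "[a, b, c] \<in> ext_class C 2 Q P [Idn C P, Zero C P Q, Idn C Q]"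
      using ext_class_self[OF mem] by (simp add: Ext2_zero_def)
    then have "?I [a, b, c] = ?I [Idn C P, Zero C P Q, Idn C Q]"
      by (rule ext_class_invariant[where I = ?I]) (rule inv)
    then show "bridged P a T b Z"
      unfolding I[OF ext] I[OF zero_two_extension[OF PQ]] using zero_bridged[OF PQ] by blast
  }
  assume "bridged P a T b Z"
  then obtain X m n where X: "m \<in> Hom C T X" "n \<in> Hom C X Z" "n \<cdot> m = b"
      "short_exact C P (m \<cdot> a) X n Z"
    unfolding bridged_def by blast
  obtain W k l p q where W: "k \<in> Hom C P W" "l \<in> Hom C T W" "p \<in> Hom C W P" "q \<in> Hom C W T"
    "p \<cdot> k = Idn C P" "q \<cdot> l = Idn C T" "p \<cdot> l = Zero C T P" "q \<cdot> k = Zero C P T"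
    "(k \<cdot> p) \<oplus> (l \<cdot> q) = Idn C W"
    using biproduct_obtain[OF PQ(1)] Hom_Obj(2)[OF E(1)] by metis
  note split = bridge_split_extension[OF ext X W]
  have cn: "c \<cdot> n \<in> Hom C X Q" using Cmp_Hom[OF X(2) E(3)] .
  have ap: "a \<cdot> p \<in> Hom C W T" using Cmp_Hom[OF W(3) E(1)] .
  \<comment> \<open>The morphism to the given extension has the middle arrows \<open>(a, 1) : W \<rightarrow> T\<close> and \<open>n\<close>; the one to
    the trivial extension has \<open>p : W \<rightarrow> P\<close> and \<open>c \<cdot> n\<close>.\<close>
  have "([k, m \<cdot> q, c \<cdot> n], [a, b, c]) \<in> extension_rel C 2 Q P"
  proof (rule extension_rel_2I[OF split(1) ext _ X(2)])
    show "(a \<cdot> p) \<oplus> q \<in> Hom C W T" using ap W(4) by (rule Add_Hom)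
    show "((a \<cdot> p) \<oplus> q) \<cdot> k = a"
      using Cmp_Add_left[OF W(1) ap W(4)] Cmp_assoc[OF W(1,3) E(1)] W(5,8) Cmp_Idn[OF E(1)] E(1)
      by (simp add: Hom_iff)
    have "b \<cdot> ((a \<cdot> p) \<oplus> q) = Zero C W Z \<oplus> (b \<cdot> q)"
      unfolding Cmp_Add_right[OF ap W(4) E(2)] exact_Zero_element[OF E(5,1,2) W(3)] ..
    also have "\<dots> = b \<cdot> q" using Cmp_Hom[OF W(4) E(2)] by (simp add: Hom_iff)
    also have "\<dots> = n \<cdot> (m \<cdot> q)" using Cmp_eq_Cmp[OF X(3,1,2) W(4)] by simp
    finally show "b \<cdot> ((a \<cdot> p) \<oplus> q) = n \<cdot> (m \<cdot> q)" .
  qed simp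
  moreover have "([k, m \<cdot> q, c \<cdot> n], [Idn C P, Zero C P Q, Idn C Q]) \<in> extension_rel C 2 Q P"
  proof (rule extension_rel_2I[OF split(1) zero_two_extension[OF PQ] W(3) cn W(5)])
    show "Zero C P Q \<cdot> p = (c \<cdot> n) \<cdot> (m \<cdot> q)"
      using Cmp_Zero_Hom(2)[OF W(3) PQ(2)] Cmp_assoc[OF Cmp_Hom[OF W(4) X(1)] X(2) E(3)] split(2)
      by simp
    show "Idn C Q \<cdot> (c \<cdot> n) = c \<cdot> n" by (rule Idn_Cmp[OF cn])
  qed
  ultimately show "ext_class C 2 Q P [a, b, c] = Ext2_zero C Q P"
    using ext_class_eqI unfolding Ext2_zero_def by metis
qed

section \<open>Splicing\<close>

lemma splice_two_extension:
  assumes "short_exact C P e1 E e2 R" "short_exact C R f1 F f2 Q"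
  shows "two_extension P e1 E (f1 \<cdot> e2) F f2 Q"
proof -
  have e: "e1 \<in> Hom C P E" "e2 \<in> Hom C E R" "is_monic C e1" "exact_pair C e1 e2" "is_epic C e2"
    using assms(1) by (auto simp: short_exact_iff)
  have f: "f1 \<in> Hom C R F" "f2 \<in> Hom C F Q" "is_monic C f1" "exact_pair C f1 f2" "is_epic C f2"
    using assms(2) by (auto simp: short_exact_iff)
  have fe: "f1 \<cdot> e2 \<in> Hom C E F" using e(2) f(1) by (rule Cmp_Hom)
  have "exact_pair C e1 (f1 \<cdot> e2)"
  proof (rule exact_pairI[OF e(1) fe])
    show "(f1 \<cdot> e2) \<cdot> e1 = Zero C P F"
      using Cmp_assoc[OF e(1,2) f(1)] exact_Zero_Hom[OF e(4,1,2)] Cmp_Zero_Hom(1)[OF f(1)]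
        Hom_Obj[OF e(1)] by simp
    fix Y x assume x: "x \<in> Hom C Y E" "(f1 \<cdot> e2) \<cdot> x = Zero C Y F"
    have "e2 \<cdot> x = Zero C Y R"
      using monic_Hom_Zero[OF f(3,1) Cmp_Hom[OF x(1) e(2)]] Cmp_assoc[OF x(1) e(2) f(1)] x(2) by simp
    then obtain y where "y \<in> Hom C Y P" "e1 \<cdot> y = x" using exact_monic_lift[OF e(3,4,1,2) x(1)] by blast
    then show "in_image e1 x" by (rule in_image_cmp[OF e(1)])
  qed
  moreover have "exact_pair C (f1 \<cdot> e2) f2"
  proof (rule exact_pairI[OF fe f(2)])
    show "f2 \<cdot> (f1 \<cdot> e2) = Zero C E Q" using exact_Zero_element[OF f(4,1,2) e(2)] .
    fix Y x assume x: "x \<in> Hom C Y F" "f2 \<cdot> x = Zero C Y Q"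
    obtain y where y: "y \<in> Hom C Y R" "f1 \<cdot> y = x" using exact_monic_lift[OF f(3,4,1,2) x] by blast
    have "y \<in> Hom C Y (Tgt C e2)" "Src C e2 = E" using y(1) e(2) by (auto simp: Hom_iff)
    then obtain Z p z where p: "p \<in> Hom C Z Y" "is_epic C p" "z \<in> Hom C Z E" "e2 \<cdot> z = y \<cdot> p"
      using epic_lift[OF e(5)] by metis
    have "(f1 \<cdot> e2) \<cdot> z = x \<cdot> p"
      using Cmp_assoc[OF p(3) e(2) f(1)] Cmp_eq_Cmp[OF y(2,1) f(1) p(1)] p(4) by simp
    then have "in_image (f1 \<cdot> e2) (x \<cdot> p)" by (rule in_image_cmp[OF fe p(3)])
    then show "in_image (f1 \<cdot> e2) x" using in_image_cover[OF _ p(1,2) x(1)] by blast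
  qed
  ultimately show ?thesis using e f fe by (simp add: two_extension_def)
qed

lemma ext_splice_2 [simp]: "ext_splice C [a, b] [c, d] = [a, c \<cdot> b, d]"
  by (simp add: ext_splice_def)

text \<open>A morphism of one of the two factors, completed by an identity, is a morphism of splices.
  So all representatives have splices in the same class.\<close>

lemma ext_cup_class:
  assumes E: "short_exact C P e1 E e2 R" and F: "short_exact C R f1 F f2 Q"
  shows "ext_cup C 1 1 Q P (ext_class C 1 R P [e1, e2]) (ext_class C 1 Q R [f1, f2])
    = ext_class C 2 Q P [e1, f1 \<cdot> e2, f2]"
proof -
  let ?K = "\<lambda>xs ys. ext_class C 2 Q P (ext_splice C xs ys)"
  have left: "?K xs ys = ?K xs' ys"
    if xs: "(xs, xs') \<in> extension_rel C 1 R P" and ys: "ys \<in> extensions C 1 Q R" for xs xs' ys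
  proof -
    obtain f A g f' A' g' \<alpha> where x: "xs = [f, g]" "xs' = [f', g']" "short_exact C P f A g R"
      "short_exact C P f' A' g' R" "\<alpha> \<in> Hom C A A'" "\<alpha> \<cdot> f = f'" "g' \<cdot> \<alpha> = g"
      using extension_rel_1E[OF xs] .
    obtain h B k where y: "ys = [h, k]" "short_exact C R h B k Q"
      using ys unfolding extensions_1_iff by blast
    have ty: "g' \<in> Hom C A' R" "g \<in> Hom C A R" "h \<in> Hom C R B" "k \<in> Hom C B Q" using x(3,4) y(2) by (auto simp: short_exact_iff)
    have "([f, h \<cdot> g, k], [f', h \<cdot> g', k]) \<in> extension_rel C 2 Q P"
      by (rule extension_rel_2I[OF splice_two_extension[OF x(3) y(2)]
            splice_two_extension[OF x(4) y(2)] x(5) _ x(6)])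
         (use Idn_Hom Hom_Obj[OF ty(4)] Cmp_assoc[OF x(5) ty(1,3)] x(7)
           Idn_Cmp[OF Cmp_Hom[OF ty(2,3)]] Cmp_Idn[OF ty(4)] in auto)
    then show ?thesis unfolding x(1,2) y(1) by (simp add: ext_class_eqI)
  qed
  have right: "?K xs ys = ?K xs ys'"
    if xs: "xs \<in> extensions C 1 R P" and ys: "(ys, ys') \<in> extension_rel C 1 Q R" for xs ys ys'
  proof -
    obtain f A g f' A' g' \<alpha> where y: "ys = [f, g]" "ys' = [f', g']" "short_exact C R f A g Q"
      "short_exact C R f' A' g' Q" "\<alpha> \<in> Hom C A A'" "\<alpha> \<cdot> f = f'" "g' \<cdot> \<alpha> = g"
      using extension_rel_1E[OF ys] .
    obtain h B k where x: "xs = [h, k]" "short_exact C P h B k R"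
      using xs unfolding extensions_1_iff by blast
    have ty: "f' \<in> Hom C R A'" "f \<in> Hom C R A" "h \<in> Hom C P B" "k \<in> Hom C B R"
      using y(3,4) x(2) by (auto simp: short_exact_iff)
    have "([h, f \<cdot> k, g], [h, f' \<cdot> k, g']) \<in> extension_rel C 2 Q P"
      by (rule extension_rel_2I[OF splice_two_extension[OF x(2) y(3)]
            splice_two_extension[OF x(2) y(4)] _ y(5) _ _ y(7)])
         (use Idn_Hom Hom_Obj[OF ty(4)] Cmp_assoc[OF ty(4,2) y(5)] y(6)
           Cmp_Idn[OF Cmp_Hom[OF ty(4,1)]] Idn_Cmp[OF ty(3)] in auto)
    then show ?thesis unfolding y(1,2) x(1) by (simp add: ext_class_eqI)
  qed
  have e: "[e1, e2] \<in> extensions C 1 R P" and f: "[f1, f2] \<in> extensions C 1 Q R"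
    using E F unfolding extensions_1_iff by blast+
  have K: "?K xs ys = ?K [e1, e2] [f1, f2]"
    if xs: "xs \<in> ext_class C 1 R P [e1, e2]" and ys: "ys \<in> ext_class C 1 Q R [f1, f2]" for xs ys
  proof -
    have "?K xs ys = ?K [e1, e2] ys"
      by (rule ext_class_invariant[OF xs]) (rule left[OF _ ext_class_subset[OF ys]])
    also have "\<dots> = ?K [e1, e2] [f1, f2]"
      by (rule ext_class_invariant[OF ys]) (rule right[OF e])
    finally show ?thesis .
  qed
  have "ext_cup C 1 1 Q P (ext_class C 1 R P [e1, e2]) (ext_class C 1 Q R [f1, f2])
      = (\<Union>xs \<in> ext_class C 1 R P [e1, e2]. \<Union>ys \<in> ext_class C 1 Q R [f1, f2]. ?K xs ys)"
    unfolding ext_cup_def one_add_one ..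
  also have "\<dots> = ?K [e1, e2] [f1, f2]"
    using K ext_class_self[OF e] ext_class_self[OF f] by blast
  finally show ?thesis by simp
qed

end

section \<open>Baer sums\<close>

text \<open>The data in the definition of a Baer sum, with sources and targets made explicit. The first and last
  arrows of the sum are \<open>i1 \<cdot> a1\<close> and \<open>c1 \<cdot> p1\<close>, and \<open>b\<close> is diagonal with entries \<open>b1\<close> and \<open>b2\<close>.\<close>

locale Baer_sum_diagram = abelian_category C for C :: "('o, 'm) precat" (structure) +
  fixes P Q T1 Z1 T2 Z2 T Z :: 'o and a1 b1 c1 a2 b2 c2 i1 i2 p1 p2 b :: 'm
  assumes ext1: "two_extension P a1 T1 b1 Z1 c1 Q"
    and ext2: "two_extension P a2 T2 b2 Z2 c2 Q"
    and pushout: "is_pushout C a1 a2 i1 i2" and i1: "i1 \<in> Hom C T1 T" and i2: "i2 \<in> Hom C T2 T"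
    and pullback: "is_pullback C c1 c2 p1 p2" and p1: "p1 \<in> Hom C Z Z1" and p2: "p2 \<in> Hom C Z Z2"
    and b: "b \<in> Hom C T Z"
    and b11: "p1 \<cdot> (b \<cdot> i1) = b1" and b22: "p2 \<cdot> (b \<cdot> i2) = b2"
    and b21: "p2 \<cdot> (b \<cdot> i1) = Zero C T1 Z2" and b12: "p1 \<cdot> (b \<cdot> i2) = Zero C T2 Z1"
begin

lemmas E1 = two_extensionD[OF ext1]
lemmas E2 = two_extensionD[OF ext2]

lemma pushout_square: "i1 \<cdot> a1 = i2 \<cdot> a2"
  using pushout_typing[OF pushout E1(1) E2(1)] by metis

lemma pullback_square: "c1 \<cdot> p1 = c2 \<cdot> p2"
  using pullback_typing[OF pullback E1(3) E2(3)] by metis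

lemma bi_Hom: "b \<cdot> i1 \<in> Hom C T1 Z" "b \<cdot> i2 \<in> Hom C T2 Z"
  using Cmp_Hom[OF i1 b] Cmp_Hom[OF i2 b] by auto

lemma b_components:
  assumes "x1 \<in> Hom C Y T1" "x2 \<in> Hom C Y T2"
  shows "p1 \<cdot> (b \<cdot> ((i1 \<cdot> x1) \<oplus> (i2 \<cdot> x2))) = b1 \<cdot> x1"
    and "p2 \<cdot> (b \<cdot> ((i1 \<cdot> x1) \<oplus> (i2 \<cdot> x2))) = b2 \<cdot> x2"
proof -
  have Y: "Y \<in> Obj C" "Z1 \<in> Obj C" "Z2 \<in> Obj C" using assms p1 p2 by (auto simp: Hom_iff)
  have ix: "i1 \<cdot> x1 \<in> Hom C Y T" "i2 \<cdot> x2 \<in> Hom C Y T"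
    using Cmp_Hom[OF assms(1) i1] Cmp_Hom[OF assms(2) i2] by auto
  have bix: "b \<cdot> (i1 \<cdot> x1) \<in> Hom C Y Z" "b \<cdot> (i2 \<cdot> x2) \<in> Hom C Y Z"
    using Cmp_Hom[OF ix(1) b] Cmp_Hom[OF ix(2) b] by auto
  have "p1 \<cdot> (b \<cdot> (i1 \<cdot> x1)) = b1 \<cdot> x1" "p2 \<cdot> (b \<cdot> (i1 \<cdot> x1)) = Zero C Y Z2"
    using Cmp_assoc[OF assms(1) i1 b] Cmp_eq_Cmp[OF b11 bi_Hom(1) p1 assms(1)]
      Cmp_eq_Cmp[OF b21 bi_Hom(1) p2 assms(1)] Cmp_Zero_Hom(2)[OF assms(1) Y(3)] by auto
  moreover have "p2 \<cdot> (b \<cdot> (i2 \<cdot> x2)) = b2 \<cdot> x2" "p1 \<cdot> (b \<cdot> (i2 \<cdot> x2)) = Zero C Y Z1"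
    using Cmp_assoc[OF assms(2) i2 b] Cmp_eq_Cmp[OF b22 bi_Hom(2) p2 assms(2)]
      Cmp_eq_Cmp[OF b12 bi_Hom(2) p1 assms(2)] Cmp_Zero_Hom(2)[OF assms(2) Y(2)] by auto
  moreover have "b1 \<cdot> x1 \<in> Hom C Y Z1" "b2 \<cdot> x2 \<in> Hom C Y Z2"
    using Cmp_Hom[OF assms(1) E1(2)] Cmp_Hom[OF assms(2) E2(2)] by auto
  ultimately show "p1 \<cdot> (b \<cdot> ((i1 \<cdot> x1) \<oplus> (i2 \<cdot> x2))) = b1 \<cdot> x1"
    "p2 \<cdot> (b \<cdot> ((i1 \<cdot> x1) \<oplus> (i2 \<cdot> x2))) = b2 \<cdot> x2"
    unfolding Cmp_Add_right[OF ix b] Cmp_Add_right[OF bix p1] Cmp_Add_right[OF bix p2]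
    by (auto simp: Hom_iff)
qed

lemma i1_monic: "is_monic C i1"
  using pushout_monic[OF pushout E1(1) E2(1,4)] .

lemma i2_monic: "is_monic C i2"
  using pushout_monic[OF is_pushout_commute[OF pushout] E2(1) E1(1,4)] .

lemma p1_epic: "is_epic C p1"
  using pullback_epic[OF is_pullback_commute[OF pullback] E2(3) E1(3) E2(7)] .

lemma first_arrow: "i1 \<cdot> a1 \<in> Hom C P T" "is_monic C (i1 \<cdot> a1)"
  using Cmp_Hom[OF E1(1) i1] monic_Cmp[OF E1(4) i1_monic] E1(1) i1 by (auto simp: Hom_iff)

lemma last_arrow: "c1 \<cdot> p1 \<in> Hom C Z Q" "is_epic C (c1 \<cdot> p1)"
  using Cmp_Hom[OF p1 E1(3)] epic_Cmp[OF p1_epic E1(7)] E1(3) p1 by (auto simp: Hom_iff)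

text \<open>An element \<open>(t1, t2)\<close> of the kernel of \<open>b\<close> has components in the kernels of \<open>b1\<close> and \<open>b2\<close>, so
  these come from \<open>u1\<close> and \<open>u2\<close> in \<open>P\<close>. As the two copies of \<open>P\<close> are identified in the pushout, the
  element comes from \<open>u1 \<oplus> u2\<close>.\<close>

lemma sum_exact_left: "exact_pair C (i1 \<cdot> a1) b"
proof (rule exact_pairI[OF first_arrow(1) b])
  show "b \<cdot> (i1 \<cdot> a1) = Zero C P Z"
  proof (rule pullback_joint_monic[OF pullback p1 p2 Cmp_Hom[OF first_arrow(1) b]])
    have P: "P \<in> Obj C" "Z \<in> Obj C" using E1(1) b by (auto simp: Hom_iff)
    show "Zero C P Z \<in> Hom C P Z" using P by (simp add: Hom_iff)
    have "p1 \<cdot> (b \<cdot> (i1 \<cdot> a1)) = b1 \<cdot> a1"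
      using Cmp_assoc[OF E1(1) i1 b] Cmp_eq_Cmp[OF b11 bi_Hom(1) p1 E1(1)] by simp
    then show "p1 \<cdot> (b \<cdot> (i1 \<cdot> a1)) = p1 \<cdot> Zero C P Z"
      using exact_Zero_Hom[OF E1(5,1,2)] Cmp_Zero_Hom(1)[OF p1 P(1)] by simp
    have "p2 \<cdot> (b \<cdot> (i1 \<cdot> a1)) = Zero C T1 Z2 \<cdot> a1"
      using Cmp_assoc[OF E1(1) i1 b] Cmp_eq_Cmp[OF b21 bi_Hom(1) p2 E1(1)] by simp
    then show "p2 \<cdot> (b \<cdot> (i1 \<cdot> a1)) = p2 \<cdot> Zero C P Z"
      using Cmp_Zero_Hom(2)[OF E1(1)] Hom_Obj[OF p2] Cmp_Zero_Hom(1)[OF p2 P(1)] by simp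
  qed
  fix Y x assume x: "x \<in> Hom C Y T" "b \<cdot> x = Zero C Y Z"
  obtain W r t1 t2 where r: "r \<in> Hom C W Y" "is_epic C r" "t1 \<in> Hom C W T1" "t2 \<in> Hom C W T2"
    "x \<cdot> r = (i1 \<cdot> t1) \<oplus> (i2 \<cdot> t2)"
    using pushout_element[OF pushout i1 i2 x(1)] .
  have W: "W \<in> Obj C" "Z \<in> Obj C" using r(1) b by (auto simp: Hom_iff)
  have "b \<cdot> (x \<cdot> r) = Zero C W Z"
    using Cmp_assoc[OF r(1) x(1) b] x(2) Cmp_Zero_Hom(2)[OF r(1) W(2)] by simp
  then have "b1 \<cdot> t1 = Zero C W Z1" "b2 \<cdot> t2 = Zero C W Z2"
    using b_components[OF r(3,4)] Cmp_Zero_Hom(1)[OF p1 W(1)] Cmp_Zero_Hom(1)[OF p2 W(1)]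
    unfolding r(5) by auto
  then obtain u1 u2 where u: "u1 \<in> Hom C W P" "a1 \<cdot> u1 = t1" "u2 \<in> Hom C W P" "a2 \<cdot> u2 = t2"
    using exact_monic_lift[OF E1(4,5,1,2) r(3)] exact_monic_lift[OF E2(4,5,1,2) r(4)] by metis
  have "(i1 \<cdot> a1) \<cdot> (u1 \<oplus> u2) = ((i1 \<cdot> a1) \<cdot> u1) \<oplus> ((i2 \<cdot> a2) \<cdot> u2)"
    using Cmp_Add_right[OF u(1,3) first_arrow(1)] pushout_square by simp
  also have "\<dots> = x \<cdot> r"
    using Cmp_assoc[OF u(1) E1(1) i1] Cmp_assoc[OF u(3) E2(1) i2] u(2,4) r(5) by simp
  finally have "in_image (i1 \<cdot> a1) (x \<cdot> r)"
    by (rule in_image_cmp[OF first_arrow(1) Add_Hom[OF u(1,3)]])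
  then show "in_image (i1 \<cdot> a1) x" using in_image_cover[OF _ r(1,2) x(1)] by blast
qed

text \<open>In the pullback both components of a kernel element are killed by \<open>c1\<close> and \<open>c2\<close>, so they
  lift separately, one cover after the other.\<close>

lemma sum_exact_right: "exact_pair C b (c1 \<cdot> p1)"
proof (rule exact_pairI[OF b last_arrow(1)])
  have c1b1: "c1 \<cdot> b1 = Zero C T1 Q" and c2b2: "c2 \<cdot> b2 = Zero C T2 Q"
    using exact_Zero_Hom[OF E1(6,2,3)] exact_Zero_Hom[OF E2(6,2,3)] by auto
  show "(c1 \<cdot> p1) \<cdot> b = Zero C T Q"
  proof (rule pushout_joint_epic[OF pushout i1 i2 Cmp_Hom[OF b last_arrow(1)]])
    have T: "T \<in> Obj C" "Q \<in> Obj C" using E1(3) b by (auto simp: Hom_iff)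
    show "Zero C T Q \<in> Hom C T Q" using T by (simp add: Hom_iff)
    have "((c1 \<cdot> p1) \<cdot> b) \<cdot> i1 = c1 \<cdot> (p1 \<cdot> (b \<cdot> i1))"
      using E1(3) p1 b i1 by (simp add: Hom_iff)
    then show "((c1 \<cdot> p1) \<cdot> b) \<cdot> i1 = Zero C T Q \<cdot> i1"
      using c1b1 b11 Cmp_Zero_Hom(2)[OF i1 T(2)] by simp
    have "((c2 \<cdot> p2) \<cdot> b) \<cdot> i2 = c2 \<cdot> (p2 \<cdot> (b \<cdot> i2))"
      using E2(3) p2 b i2 by (simp add: Hom_iff)
    then show "((c1 \<cdot> p1) \<cdot> b) \<cdot> i2 = Zero C T Q \<cdot> i2"
      using c2b2 b22 pullback_square Cmp_Zero_Hom(2)[OF i2 T(2)] by simp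
  qed
  fix Y z assume z: "z \<in> Hom C Y Z" "(c1 \<cdot> p1) \<cdot> z = Zero C Y Q"
  have pz: "p1 \<cdot> z \<in> Hom C Y Z1" "p2 \<cdot> z \<in> Hom C Y Z2"
    using Cmp_Hom[OF z(1) p1] Cmp_Hom[OF z(1) p2] by auto
  have cz: "c1 \<cdot> (p1 \<cdot> z) = Zero C Y Q" "c2 \<cdot> (p2 \<cdot> z) = Zero C Y Q"
    using z(2) Cmp_assoc[OF z(1) p1 E1(3)] Cmp_assoc[OF z(1) p2 E2(3)] pullback_square by auto
  obtain Y1 r1 t1 where r1: "r1 \<in> Hom C Y1 Y" "is_epic C r1" "t1 \<in> Hom C Y1 T1" "b1 \<cdot> t1 = (p1 \<cdot> z) \<cdot> r1"
    using exact_lift[OF E1(6,2,3) pz(1) cz(1)] .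
  have pzr: "(p2 \<cdot> z) \<cdot> r1 \<in> Hom C Y1 Z2" using Cmp_Hom[OF r1(1) pz(2)] .
  have "c2 \<cdot> ((p2 \<cdot> z) \<cdot> r1) = Zero C Y1 Q"
    using Cmp_eq_Cmp[OF cz(2) pz(2) E2(3) r1(1)] Cmp_Zero_Hom(2)[OF r1(1)] Hom_Obj[OF E2(3)] by simp
  then obtain Y2 r2 t2 where r2: "r2 \<in> Hom C Y2 Y1" "is_epic C r2" "t2 \<in> Hom C Y2 T2"
    "b2 \<cdot> t2 = ((p2 \<cdot> z) \<cdot> r1) \<cdot> r2"
    using exact_lift[OF E2(6,2,3) pzr] by blast
  have t1r: "t1 \<cdot> r2 \<in> Hom C Y2 T1" using Cmp_Hom[OF r2(1) r1(3)] .
  define t where "t = (i1 \<cdot> (t1 \<cdot> r2)) \<oplus> (i2 \<cdot> t2)"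
  have t: "t \<in> Hom C Y2 T" unfolding t_def
    using Cmp_Hom[OF t1r i1] Cmp_Hom[OF r2(3) i2] by (rule Add_Hom)
  have zr: "(z \<cdot> r1) \<cdot> r2 \<in> Hom C Y2 Z" using Cmp_Hom[OF r2(1) Cmp_Hom[OF r1(1) z(1)]] .
  have "b \<cdot> t = (z \<cdot> r1) \<cdot> r2"
  proof (rule pullback_joint_monic[OF pullback p1 p2 Cmp_Hom[OF t b] zr])
    have "p1 \<cdot> (b \<cdot> t) = (b1 \<cdot> t1) \<cdot> r2"
      unfolding t_def b_components(1)[OF t1r r2(3)] using Cmp_assoc[OF r2(1) r1(3) E1(2)] by simp
    also have "\<dots> = p1 \<cdot> ((z \<cdot> r1) \<cdot> r2)"
      unfolding r1(4) using z(1) r1(1) r2(1) p1 by (simp add: Hom_iff)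
    finally show "p1 \<cdot> (b \<cdot> t) = p1 \<cdot> ((z \<cdot> r1) \<cdot> r2)" .
    show "p2 \<cdot> (b \<cdot> t) = p2 \<cdot> ((z \<cdot> r1) \<cdot> r2)"
      unfolding t_def b_components(2)[OF t1r r2(3)] r2(4)
      using z(1) r1(1) r2(1) p2 by (simp add: Hom_iff)
  qed
  then have "in_image b ((z \<cdot> r1) \<cdot> r2)" by (rule in_image_cmp[OF b t])
  then have "in_image b (z \<cdot> r1)" using in_image_cover[OF _ r2(1,2) Cmp_Hom[OF r1(1) z(1)]] by blast
  then show "in_image b z" using in_image_cover[OF _ r1(1,2) z(1)] by blast
qed

lemma sum_two_extension: "two_extension P (i1 \<cdot> a1) T b Z (c1 \<cdot> p1) Q"
  using first_arrow last_arrow b sum_exact_left sum_exact_right by (simp add: two_extension_def)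

lemma is_Baer_sum: "is_Baer_sum C [a1, b1, c1] [a2, b2, c2] [i1 \<cdot> a1, b, c1 \<cdot> p1]"
proof -
  have "Src C i1 = T1" "Src C i2 = T2" "Tgt C p1 = Z1" "Tgt C p2 = Z2" "Tgt C i1 = T" "Src C p1 = Z"
    using i1 i2 p1 p2 by (auto simp: Hom_iff)
  then show ?thesis unfolding is_Baer_sum_def
    using pushout pullback b b11 b22 b21 b12 by blast
qed

end

context abelian_category
begin

lemma Baer_sum_diagram_exists:
  assumes ext1: "two_extension P a1 T1 b1 Z1 c1 Q" and ext2: "two_extension P a2 T2 b2 Z2 c2 Q"
  obtains T Z i1 i2 p1 p2 b
  where "Baer_sum_diagram C P Q T1 Z1 T2 Z2 T Z a1 b1 c1 a2 b2 c2 i1 i2 p1 p2 b"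
proof -
  note E1 = two_extensionD[OF ext1] and E2 = two_extensionD[OF ext2]
  have Ob: "P \<in> Obj C" "Q \<in> Obj C" "T1 \<in> Obj C" "T2 \<in> Obj C" "Z1 \<in> Obj C" "Z2 \<in> Obj C"
    using E1(1-3) E2(1-3) by (auto simp: Hom_iff)
  obtain i1 i2 T where po: "is_pushout C a1 a2 i1 i2" "i1 \<in> Hom C T1 T" "i2 \<in> Hom C T2 T"
    using pushout_exists[OF E1(1) E2(1)] by metis
  obtain p1 p2 Z where pb: "is_pullback C c1 c2 p1 p2" "p1 \<in> Hom C Z Z1" "p2 \<in> Hom C Z Z2"
    using pullback_exists[OF E1(3) E2(3)] by metis
  have z: "Zero C T1 Z2 \<in> Hom C T1 Z2" "Zero C T2 Z1 \<in> Hom C T2 Z1" using Ob by (auto simp: Hom_iff)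
  have "c1 \<cdot> b1 = c2 \<cdot> Zero C T1 Z2"
    using exact_Zero_Hom[OF E1(6,2,3)] Cmp_Zero_Hom(1)[OF E2(3)] Ob by simp
  then obtain w1 where w1: "w1 \<in> Hom C T1 Z" "p1 \<cdot> w1 = b1" "p2 \<cdot> w1 = Zero C T1 Z2"
    using pullback_induced[OF pb E1(2) z(1)] by blast
  have "c1 \<cdot> Zero C T2 Z1 = c2 \<cdot> b2"
    using exact_Zero_Hom[OF E2(6,2,3)] Cmp_Zero_Hom(1)[OF E1(3)] Ob by simp
  then obtain w2 where w2: "w2 \<in> Hom C T2 Z" "p1 \<cdot> w2 = Zero C T2 Z1" "p2 \<cdot> w2 = b2"
    using pullback_induced[OF pb z(2) E2(2)] by blast
  have "w1 \<cdot> a1 = w2 \<cdot> a2"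
  proof (rule pullback_joint_monic[OF pb Cmp_Hom[OF E1(1) w1(1)] Cmp_Hom[OF E2(1) w2(1)]])
    show "p1 \<cdot> (w1 \<cdot> a1) = p1 \<cdot> (w2 \<cdot> a2)" "p2 \<cdot> (w1 \<cdot> a1) = p2 \<cdot> (w2 \<cdot> a2)"
      unfolding Cmp_eq_Cmp[OF w1(2,1) pb(2) E1(1)] Cmp_eq_Cmp[OF w2(2,1) pb(2) E2(1)]
        Cmp_eq_Cmp[OF w1(3,1) pb(3) E1(1)] Cmp_eq_Cmp[OF w2(3,1) pb(3) E2(1)]
      using exact_Zero_Hom[OF E1(5,1,2)] exact_Zero_Hom[OF E2(5,1,2)]
        Cmp_Zero_Hom(2)[OF E1(1)] Cmp_Zero_Hom(2)[OF E2(1)] Ob by auto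
  qed
  then obtain b where b: "b \<in> Hom C T Z" "b \<cdot> i1 = w1" "b \<cdot> i2 = w2"
    using pushout_induced[OF po w1(1) w2(1)] by blast
  have "Baer_sum_diagram C P Q T1 Z1 T2 Z2 T Z a1 b1 c1 a2 b2 c2 i1 i2 p1 p2 b"
    using ext1 ext2 po pb b w1 w2 by unfold_locales auto
  then show ?thesis by (rule that)
qed

lemma is_Baer_sum_diagram:
  assumes ext1: "two_extension P a1 T1 b1 Z1 c1 Q" and ext2: "two_extension P a2 T2 b2 Z2 c2 Q"
    and "is_Baer_sum C [a1, b1, c1] [a2, b2, c2] zs"
  obtains T Z i1 i2 p1 p2 b
  where "Baer_sum_diagram C P Q T1 Z1 T2 Z2 T Z a1 b1 c1 a2 b2 c2 i1 i2 p1 p2 b"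
    "zs = [i1 \<cdot> a1, b, c1 \<cdot> p1]"
proof -
  note E1 = two_extensionD[OF ext1] and E2 = two_extensionD[OF ext2]
  obtain i1 i2 p1 p2 b where *: "is_pushout C a1 a2 i1 i2" "is_pullback C c1 c2 p1 p2"
    "b \<in> Hom C (Tgt C i1) (Src C p1)" "p1 \<cdot> (b \<cdot> i1) = b1" "p2 \<cdot> (b \<cdot> i2) = b2"
    "p2 \<cdot> (b \<cdot> i1) = Zero C (Src C i1) (Tgt C p2)" "p1 \<cdot> (b \<cdot> i2) = Zero C (Src C i2) (Tgt C p1)"
    and zs: "zs = [i1 \<cdot> a1, b, c1 \<cdot> p1]"
    using assms(3) unfolding is_Baer_sum_def list.inject by blast
  obtain T where T: "i1 \<in> Hom C T1 T" "i2 \<in> Hom C T2 T"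
    using pushout_typing[OF *(1) E1(1) E2(1)] by metis
  obtain Z where Z: "p1 \<in> Hom C Z Z1" "p2 \<in> Hom C Z Z2"
    using pullback_typing[OF *(2) E1(3) E2(3)] by metis
  have ST: "Src C i1 = T1" "Src C i2 = T2" "Tgt C p1 = Z1" "Tgt C p2 = Z2" "Tgt C i1 = T" "Src C p1 = Z"
    using T Z by (auto simp: Hom_iff)
  have "Baer_sum_diagram C P Q T1 Z1 T2 Z2 T Z a1 b1 c1 a2 b2 c2 i1 i2 p1 p2 b"
    using ext1 ext2 *(1,2) T Z *(3-7)[unfolded ST] by unfold_locales auto
  then show ?thesis using zs by (rule that)
qed

text \<open>The universal properties of pushout and pullback give the middle arrows, and the square between
  them commutes because it does so in each of the four components. With identity arrows this also shows
  that two Baer sums of the same extensions have the same class.\<close>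

lemma Baer_sum_functorial:
  assumes D: "Baer_sum_diagram C P Q T1 Z1 T2 Z2 T Z a1 b1 c1 a2 b2 c2 i1 i2 p1 p2 b"
    and D': "Baer_sum_diagram C P Q T1' Z1' T2' Z2' T' Z' a1' b1' c1' a2' b2' c2' i1' i2' p1' p2' b'"
    and m1: "\<alpha>1 \<in> Hom C T1 T1'" "\<beta>1 \<in> Hom C Z1 Z1'" "\<alpha>1 \<cdot> a1 = a1'" "b1' \<cdot> \<alpha>1 = \<beta>1 \<cdot> b1" "c1' \<cdot> \<beta>1 = c1"
    and m2: "\<alpha>2 \<in> Hom C T2 T2'" "\<beta>2 \<in> Hom C Z2 Z2'" "\<alpha>2 \<cdot> a2 = a2'" "b2' \<cdot> \<alpha>2 = \<beta>2 \<cdot> b2" "c2' \<cdot> \<beta>2 = c2"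
  shows "([i1 \<cdot> a1, b, c1 \<cdot> p1], [i1' \<cdot> a1', b', c1' \<cdot> p1']) \<in> extension_rel C 2 Q P"
proof -
  interpret D: Baer_sum_diagram C P Q T1 Z1 T2 Z2 T Z a1 b1 c1 a2 b2 c2 i1 i2 p1 p2 b by (rule D)
  interpret D': Baer_sum_diagram C P Q T1' Z1' T2' Z2' T' Z' a1' b1' c1' a2' b2' c2' i1' i2' p1' p2' b'
    by (rule D')
  have i\<alpha>: "i1' \<cdot> \<alpha>1 \<in> Hom C T1 T'" "i2' \<cdot> \<alpha>2 \<in> Hom C T2 T'"
    using Cmp_Hom[OF m1(1) D'.i1] Cmp_Hom[OF m2(1) D'.i2] by auto
  have "(i1' \<cdot> \<alpha>1) \<cdot> a1 = (i2' \<cdot> \<alpha>2) \<cdot> a2"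
    using Cmp_assoc[OF D.E1(1) m1(1) D'.i1] Cmp_assoc[OF D.E2(1) m2(1) D'.i2] m1(3) m2(3)
      D'.pushout_square by simp
  then obtain \<omega> where \<omega>: "\<omega> \<in> Hom C T T'" "\<omega> \<cdot> i1 = i1' \<cdot> \<alpha>1" "\<omega> \<cdot> i2 = i2' \<cdot> \<alpha>2"
    using pushout_induced[OF D.pushout D.i1 D.i2 i\<alpha>] by blast
  have \<beta>p: "\<beta>1 \<cdot> p1 \<in> Hom C Z Z1'" "\<beta>2 \<cdot> p2 \<in> Hom C Z Z2'"
    using Cmp_Hom[OF D.p1 m1(2)] Cmp_Hom[OF D.p2 m2(2)] by auto
  have cp: "c1' \<cdot> (\<beta>1 \<cdot> p1) = c1 \<cdot> p1" "c2' \<cdot> (\<beta>2 \<cdot> p2) = c2 \<cdot> p2"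
    using Cmp_eq_Cmp[OF m1(5,2) D'.E1(3) D.p1] Cmp_eq_Cmp[OF m2(5,2) D'.E2(3) D.p2] by auto
  then obtain \<zeta> where \<zeta>: "\<zeta> \<in> Hom C Z Z'" "p1' \<cdot> \<zeta> = \<beta>1 \<cdot> p1" "p2' \<cdot> \<zeta> = \<beta>2 \<cdot> p2"
    using pullback_induced[OF D'.pullback D'.p1 D'.p2 \<beta>p] D.pullback_square by auto
  have p\<zeta>: "p1' \<cdot> (\<zeta> \<cdot> (b \<cdot> y)) = \<beta>1 \<cdot> (p1 \<cdot> (b \<cdot> y))"
    "p2' \<cdot> (\<zeta> \<cdot> (b \<cdot> y)) = \<beta>2 \<cdot> (p2 \<cdot> (b \<cdot> y))" if "y \<in> Hom C Y T" for Y y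
    using Cmp_square[OF \<zeta>(2,1) D'.p1 D.p1 m1(2) Cmp_Hom[OF that D.b]]
      Cmp_square[OF \<zeta>(3,1) D'.p2 D.p2 m2(2) Cmp_Hom[OF that D.b]] by auto
  have b'i: "p1' \<cdot> (b' \<cdot> (i1' \<cdot> \<alpha>1)) = b1' \<cdot> \<alpha>1" "p2' \<cdot> (b' \<cdot> (i1' \<cdot> \<alpha>1)) = Zero C T1 Z2'"
      "p2' \<cdot> (b' \<cdot> (i2' \<cdot> \<alpha>2)) = b2' \<cdot> \<alpha>2" "p1' \<cdot> (b' \<cdot> (i2' \<cdot> \<alpha>2)) = Zero C T2 Z1'"
    using Cmp_assoc[OF m1(1) D'.i1 D'.b] Cmp_assoc[OF m2(1) D'.i2 D'.b]
      Cmp_eq_Cmp[OF D'.b11 D'.bi_Hom(1) D'.p1 m1(1)] Cmp_eq_Cmp[OF D'.b21 D'.bi_Hom(1) D'.p2 m1(1)]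
      Cmp_eq_Cmp[OF D'.b22 D'.bi_Hom(2) D'.p2 m2(1)] Cmp_eq_Cmp[OF D'.b12 D'.bi_Hom(2) D'.p1 m2(1)]
      Cmp_Zero_Hom(2)[OF m1(1)] Cmp_Zero_Hom(2)[OF m2(1)] Hom_Obj[OF D'.p1] Hom_Obj[OF D'.p2] by auto
  have b\<omega>: "b' \<cdot> \<omega> = \<zeta> \<cdot> b"
  proof (rule pushout_joint_epic[OF D.pushout D.i1 D.i2 Cmp_Hom[OF \<omega>(1) D'.b] Cmp_Hom[OF D.b \<zeta>(1)]])
    have "b' \<cdot> (i1' \<cdot> \<alpha>1) = \<zeta> \<cdot> (b \<cdot> i1)"
      by (rule pullback_joint_monic[OF D'.pullback D'.p1 D'.p2 Cmp_Hom[OF i\<alpha>(1) D'.b]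
            Cmp_Hom[OF D.bi_Hom(1) \<zeta>(1)]])
         (use p\<zeta>[OF D.i1] b'i m1(4) D.b11 D.b21 Cmp_Zero_Hom(1)[OF m2(2)] Hom_Obj[OF D.i1] in auto)
    then show "(b' \<cdot> \<omega>) \<cdot> i1 = (\<zeta> \<cdot> b) \<cdot> i1"
      using Cmp_assoc[OF D.i1 \<omega>(1) D'.b] Cmp_assoc[OF D.i1 D.b \<zeta>(1)] \<omega>(2) by simp
    have "b' \<cdot> (i2' \<cdot> \<alpha>2) = \<zeta> \<cdot> (b \<cdot> i2)"
      by (rule pullback_joint_monic[OF D'.pullback D'.p1 D'.p2 Cmp_Hom[OF i\<alpha>(2) D'.b]
            Cmp_Hom[OF D.bi_Hom(2) \<zeta>(1)]])
         (use p\<zeta>[OF D.i2] b'i m2(4) D.b22 D.b12 Cmp_Zero_Hom(1)[OF m1(2)] Hom_Obj[OF D.i2] in auto)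
    then show "(b' \<cdot> \<omega>) \<cdot> i2 = (\<zeta> \<cdot> b) \<cdot> i2"
      using Cmp_assoc[OF D.i2 \<omega>(1) D'.b] Cmp_assoc[OF D.i2 D.b \<zeta>(1)] \<omega>(3) by simp
  qed
  show ?thesis
  proof (rule extension_rel_2I[OF D.sum_two_extension D'.sum_two_extension \<omega>(1) \<zeta>(1) _ b\<omega>])
    show "\<omega> \<cdot> (i1 \<cdot> a1) = i1' \<cdot> a1'"
      using Cmp_square[OF \<omega>(2) D.i1 \<omega>(1) m1(1) D'.i1 D.E1(1)] m1(3) by simp
    show "(c1' \<cdot> p1') \<cdot> \<zeta> = c1 \<cdot> p1"
      using Cmp_assoc[OF \<zeta>(1) D'.p1 D'.E1(3)] \<zeta>(2) cp(1) by simp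
  qed
qed

text \<open>The union of the classes of all Baer sums of two representatives is a single class, and by
  functoriality it does not change along a morphism of either representative. So the union over all
  representatives is that class.\<close>

lemma Baer_sum_class:
  assumes D: "Baer_sum_diagram C P Q T1 Z1 T2 Z2 T Z a1 b1 c1 a2 b2 c2 i1 i2 p1 p2 b"
  shows "Baer_sum C Q P (ext_class C 2 Q P [a1, b1, c1]) (ext_class C 2 Q P [a2, b2, c2])
     = ext_class C 2 Q P [i1 \<cdot> a1, b, c1 \<cdot> p1]"
proof -
  interpret D: Baer_sum_diagram C P Q T1 Z1 T2 Z2 T Z a1 b1 c1 a2 b2 c2 i1 i2 p1 p2 b by (rule D)
  let ?K = "\<lambda>xs ys. \<Union>zs \<in> {zs. is_Baer_sum C xs ys zs}. ext_class C 2 Q P zs"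
  have K: "?K [a, b, c] [a', b', c'] = ext_class C 2 Q P [i \<cdot> a, d, c \<cdot> p]"
    if D: "Baer_sum_diagram C P Q T Z T' Z' T'' Z'' a b c a' b' c' i i' p p' d"
    for a b c T Z a' b' c' T' Z' T'' Z'' i i' p p' d
  proof -
    interpret D: Baer_sum_diagram C P Q T Z T' Z' T'' Z'' a b c a' b' c' i i' p p' d by (rule D)
    have "ext_class C 2 Q P zs = ext_class C 2 Q P [i \<cdot> a, d, c \<cdot> p]"
      if zs: "is_Baer_sum C [a, b, c] [a', b', c'] zs" for zs
    proof -
      obtain S Y j j' q q' e
        where D2: "Baer_sum_diagram C P Q T Z T' Z' S Y a b c a' b' c' j j' q q' e"
          and zs: "zs = [j \<cdot> a, e, c \<cdot> q]"
        using is_Baer_sum_diagram[OF D.ext1 D.ext2 zs] .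
      have "(zs, [i \<cdot> a, d, c \<cdot> p]) \<in> extension_rel C 2 Q P"
        unfolding zs
        by (rule Baer_sum_functorial[OF D2 D, of "Idn C T" "Idn C Z" "Idn C T'" "Idn C Z'"])
           (use D.E1(1-3) D.E2(1-3) in \<open>auto simp: Hom_iff\<close>)
      then show ?thesis by (rule ext_class_eqI)
    qed
    then show ?thesis using D.is_Baer_sum by blast
  qed
  have left: "?K xs ys = ?K xs' ys"
    if rel: "(xs, xs') \<in> extension_rel C 2 Q P" and ys: "ys \<in> extensions C 2 Q P" for xs xs' ys
  proof -
    obtain a T b Z c a' T' b' Z' c' \<alpha> \<beta> where xs: "xs = [a, b, c]" "xs' = [a', b', c']"
      and ex: "two_extension P a T b Z c Q" "two_extension P a' T' b' Z' c' Q"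
      and m: "\<alpha> \<in> Hom C T T'" "\<beta> \<in> Hom C Z Z'" "\<alpha> \<cdot> a = a'" "b' \<cdot> \<alpha> = \<beta> \<cdot> b" "c' \<cdot> \<beta> = c"
      using extension_rel_2E[OF rel] .
    obtain f g h A B where y: "ys = [f, g, h]" "two_extension P f A g B h Q"
      using ys unfolding extensions_2_two_extension by blast
    obtain S Y i i' p p' d
      where D1: "Baer_sum_diagram C P Q T Z A B S Y a b c f g h i i' p p' d"
      using Baer_sum_diagram_exists[OF ex(1) y(2)] .
    obtain S' Y' j j' q q' e
      where D2: "Baer_sum_diagram C P Q T' Z' A B S' Y' a' b' c' f g h j j' q q' e"
      using Baer_sum_diagram_exists[OF ex(2) y(2)] .
    have "([i \<cdot> a, d, c \<cdot> p], [j \<cdot> a', e, c' \<cdot> q]) \<in> extension_rel C 2 Q P"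
      by (rule Baer_sum_functorial[OF D1 D2 m, of "Idn C A" "Idn C B"])
         (use two_extensionD(1-3)[OF y(2)] in \<open>auto simp: Hom_iff\<close>)
    then show ?thesis unfolding xs y(1) K[OF D1] K[OF D2] by (rule ext_class_eqI)
  qed
  have right: "?K ys xs = ?K ys xs'"
    if rel: "(xs, xs') \<in> extension_rel C 2 Q P" and ys: "ys \<in> extensions C 2 Q P" for xs xs' ys
  proof -
    obtain a T b Z c a' T' b' Z' c' \<alpha> \<beta> where xs: "xs = [a, b, c]" "xs' = [a', b', c']"
      and ex: "two_extension P a T b Z c Q" "two_extension P a' T' b' Z' c' Q"
      and m: "\<alpha> \<in> Hom C T T'" "\<beta> \<in> Hom C Z Z'" "\<alpha> \<cdot> a = a'" "b' \<cdot> \<alpha> = \<beta> \<cdot> b" "c' \<cdot> \<beta> = c"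
      using extension_rel_2E[OF rel] .
    obtain f g h A B where y: "ys = [f, g, h]" "two_extension P f A g B h Q"
      using ys unfolding extensions_2_two_extension by blast
    obtain S Y i i' p p' d
      where D1: "Baer_sum_diagram C P Q A B T Z S Y f g h a b c i i' p p' d"
      using Baer_sum_diagram_exists[OF y(2) ex(1)] .
    obtain S' Y' j j' q q' e
      where D2: "Baer_sum_diagram C P Q A B T' Z' S' Y' f g h a' b' c' j j' q q' e"
      using Baer_sum_diagram_exists[OF y(2) ex(2)] .
    have "([i \<cdot> f, d, h \<cdot> p], [j \<cdot> f, e, h \<cdot> q]) \<in> extension_rel C 2 Q P"
      by (rule Baer_sum_functorial[OF D1 D2 _ _ _ _ _ m, of "Idn C A" "Idn C B"])
         (use two_extensionD(1-3)[OF y(2)] in \<open>auto simp: Hom_iff\<close>)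
    then show ?thesis unfolding xs y(1) K[OF D1] K[OF D2] by (rule ext_class_eqI)
  qed
  let ?X = "ext_class C 2 Q P [a1, b1, c1]" and ?Y = "ext_class C 2 Q P [a2, b2, c2]"
  have mem: "[a1, b1, c1] \<in> extensions C 2 Q P" "[a2, b2, c2] \<in> extensions C 2 Q P"
    using D.ext1 D.ext2 extensions_2_two_extension by blast+
  have const: "?K xs ys = ?K [a1, b1, c1] [a2, b2, c2]" if xs: "xs \<in> ?X" and ys: "ys \<in> ?Y" for xs ys
  proof -
    have "?K xs ys = ?K [a1, b1, c1] ys"
      by (rule ext_class_invariant[OF xs]) (rule left[OF _ ext_class_subset[OF ys]])
    also have "\<dots> = ?K [a1, b1, c1] [a2, b2, c2]"
      by (rule ext_class_invariant[OF ys]) (rule right[OF _ mem(1)])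
    finally show ?thesis .
  qed
  have "Baer_sum C Q P ?X ?Y = (\<Union>xs \<in> ?X. \<Union>ys \<in> ?Y. ?K xs ys)"
    unfolding Baer_sum_def by blast
  also have "\<dots> = (\<Union>xs \<in> ?X. \<Union>ys \<in> ?Y. ?K [a1, b1, c1] [a2, b2, c2])"
    by (intro SUP_cong refl const)
  also have "\<dots> = ?K [a1, b1, c1] [a2, b2, c2]"
    using ext_class_self[OF mem(1)] ext_class_self[OF mem(2)] by blast
  also have "\<dots> = ext_class C 2 Q P [i1 \<cdot> a1, b, c1 \<cdot> p1]" by (rule K[OF D])
  finally show ?thesis .
qed

section \<open>Bridges of a Baer sum and three-by-three diagrams\<close>

lemma Baer_sum_diagram_commute:
  assumes "Baer_sum_diagram C P Q T1 Z1 T2 Z2 T Z a1 b1 c1 a2 b2 c2 i1 i2 p1 p2 b"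
  shows "Baer_sum_diagram C P Q T2 Z2 T1 Z1 T Z a2 b2 c2 a1 b1 c1 i2 i1 p2 p1 b"
proof -
  interpret Baer_sum_diagram C P Q T1 Z1 T2 Z2 T Z a1 b1 c1 a2 b2 c2 i1 i2 p1 p2 b by (rule assms)
  show ?thesis
    using ext1 ext2 is_pushout_commute[OF pushout] is_pullback_commute[OF pullback]
      i1 i2 p1 p2 b b11 b22 b12 b21 by unfold_locales
qed

text \<open>One middle sequence of the \<open>3 \<times> 3\<close> diagram; the other one follows by exchanging the two summands.
  If \<open>x\<close> in \<open>X\<close> vanishes in \<open>F\<close>, its image in \<open>G\<close> vanishes in \<open>Q\<close> and comes from \<open>S\<close>, hence
  locally from \<open>H\<close>. Subtracting this element of \<open>H\<close> leaves an element of the kernel of \<open>n\<close>, which comes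
  from \<open>P\<close> and so from \<open>H\<close> as well.\<close>

lemma bridge_short_exact:
  assumes D: "Baer_sum_diagram C P Q E F H G T Z e1 b1 c1 h1 (g1 \<cdot> h2) g2 i1 i2 p1 p2 b"
    and PHS: "short_exact C P h1 H h2 S" and SGQ: "short_exact C S g1 G g2 Q"
    and m: "m \<in> Hom C T X" and n: "n \<in> Hom C X Z" and nm: "n \<cdot> m = b"
    and se: "short_exact C P (m \<cdot> (i1 \<cdot> e1)) X n Z"
  shows "short_exact C H (m \<cdot> i2) X (p1 \<cdot> n) F"
proof -
  interpret D: Baer_sum_diagram C P Q E F H G T Z e1 b1 c1 h1 "g1 \<cdot> h2" g2 i1 i2 p1 p2 b by (rule D)
  have h: "h1 \<in> Hom C P H" "h2 \<in> Hom C H S" "is_epic C h2"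
    using PHS by (auto simp: short_exact_iff)
  have g: "g1 \<in> Hom C S G" "g2 \<in> Hom C G Q" "is_monic C g1" "exact_pair C g1 g2"
    using SGQ by (auto simp: short_exact_iff)
  have ma: "m \<cdot> (i1 \<cdot> e1) \<in> Hom C P X" "is_monic C (m \<cdot> (i1 \<cdot> e1))" "exact_pair C (m \<cdot> (i1 \<cdot> e1)) n"
    "is_epic C n" using se by (auto simp: short_exact_iff)
  have m_monic: "is_monic C m" using bridge_monic[OF D.sum_two_extension m n nm ma(2)] .
  have v: "m \<cdot> i2 \<in> Hom C H X" "is_monic C (m \<cdot> i2)"
    using Cmp_Hom[OF D.i2 m] monic_Cmp[OF D.i2_monic m_monic] m D.i2 by (auto simp: Hom_iff)
  have s: "p1 \<cdot> n \<in> Hom C X F" "is_epic C (p1 \<cdot> n)"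
    using Cmp_Hom[OF n D.p1] epic_Cmp[OF ma(4) D.p1_epic] n D.p1 by (auto simp: Hom_iff)
  have nv: "n \<cdot> ((m \<cdot> i2) \<cdot> x) = b \<cdot> (i2 \<cdot> x)" if "x \<in> Hom C Y H" for Y x
    using Cmp_assoc[OF that D.i2 m] Cmp_eq_Cmp[OF nm m n Cmp_Hom[OF that D.i2]] by simp
  have "exact_pair C (m \<cdot> i2) (p1 \<cdot> n)"
  proof (rule exact_pairI[OF v(1) s(1)])
    show "(p1 \<cdot> n) \<cdot> (m \<cdot> i2) = Zero C H F"
      using Cmp_assoc[OF v(1) n D.p1] Cmp_eq_Cmp[OF nm m n D.i2] D.b12 by simp
    fix Y x assume x: "x \<in> Hom C Y X" "(p1 \<cdot> n) \<cdot> x = Zero C Y F"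
    have nx: "n \<cdot> x \<in> Hom C Y Z" using Cmp_Hom[OF x(1) n] .
    have p1x: "p1 \<cdot> (n \<cdot> x) = Zero C Y F" using Cmp_assoc[OF x(1) n D.p1] x(2) by simp
    have p2x: "p2 \<cdot> (n \<cdot> x) \<in> Hom C Y G" using Cmp_Hom[OF nx D.p2] .
    have "g2 \<cdot> (p2 \<cdot> (n \<cdot> x)) = c1 \<cdot> (p1 \<cdot> (n \<cdot> x))"
      using Cmp_square[OF D.pullback_square D.p1 D.E1(3) D.p2 g(2) nx] by simp
    also have "\<dots> = Zero C Y Q" unfolding p1x using Cmp_Zero_Hom(1)[OF D.E1(3)] Hom_Obj[OF x(1)] by simp
    finally obtain \<sigma> where \<sigma>: "\<sigma> \<in> Hom C Y S" "g1 \<cdot> \<sigma> = p2 \<cdot> (n \<cdot> x)"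
      using exact_monic_lift[OF g(3,4,1,2) p2x] by blast
    have "\<sigma> \<in> Hom C Y (Tgt C h2)" "Src C h2 = H" using \<sigma>(1) h(2) by (auto simp: Hom_iff)
    then obtain Y1 r y where r: "r \<in> Hom C Y1 Y" "is_epic C r" "y \<in> Hom C Y1 H" "h2 \<cdot> y = \<sigma> \<cdot> r"
      using epic_lift[OF h(3)] by metis
    have xr: "x \<cdot> r \<in> Hom C Y1 X" and vy: "(m \<cdot> i2) \<cdot> y \<in> Hom C Y1 X"
      using Cmp_Hom[OF r(1) x(1)] Cmp_Hom[OF r(3) v(1)] by auto
    have "n \<cdot> (x \<cdot> r) = n \<cdot> ((m \<cdot> i2) \<cdot> y)"
    proof (rule pullback_joint_monic[OF D.pullback D.p1 D.p2 Cmp_Hom[OF xr n] Cmp_Hom[OF vy n]])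
      have "p1 \<cdot> (n \<cdot> (x \<cdot> r)) = Zero C Y1 F"
        using Cmp_assoc[OF r(1) x(1) n] Cmp_eq_Cmp[OF p1x nx D.p1 r(1)] Cmp_Zero_Hom(2)[OF r(1)]
          Hom_Obj[OF D.p1] by simp
      also have "\<dots> = p1 \<cdot> (n \<cdot> ((m \<cdot> i2) \<cdot> y))"
        unfolding nv[OF r(3)]
        using Cmp_assoc[OF r(3) D.i2 D.b] Cmp_eq_Cmp[OF D.b12 D.bi_Hom(2) D.p1 r(3)]
          Cmp_Zero_Hom(2)[OF r(3)] Hom_Obj[OF D.p1] by simp
      finally show "p1 \<cdot> (n \<cdot> (x \<cdot> r)) = p1 \<cdot> (n \<cdot> ((m \<cdot> i2) \<cdot> y))" .
      have "p2 \<cdot> (n \<cdot> (x \<cdot> r)) = g1 \<cdot> (h2 \<cdot> y)"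
        using Cmp_assoc[OF r(1) x(1) n] Cmp_assoc[OF r(1) nx D.p2] \<sigma>(2)
          Cmp_assoc[OF r(1) \<sigma>(1) g(1)] r(4) by simp
      also have "\<dots> = p2 \<cdot> (n \<cdot> ((m \<cdot> i2) \<cdot> y))"
        unfolding nv[OF r(3)]
        using Cmp_assoc[OF r(3) D.i2 D.b] Cmp_eq_Cmp[OF D.b22 D.bi_Hom(2) D.p2 r(3)]
          Cmp_assoc[OF r(3) h(2) g(1)] by simp
      finally show "p2 \<cdot> (n \<cdot> (x \<cdot> r)) = p2 \<cdot> (n \<cdot> ((m \<cdot> i2) \<cdot> y))" .
    qed
    then obtain q where q: "q \<in> Hom C Y1 P" "x \<cdot> r = ((m \<cdot> i2) \<cdot> y) \<oplus> ((m \<cdot> (i1 \<cdot> e1)) \<cdot> q)"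
      using monic_exact_difference[OF ma(2,3,1) n xr vy] by blast
    have "m \<cdot> (i1 \<cdot> e1) = (m \<cdot> i2) \<cdot> h1"
      unfolding D.pushout_square using Cmp_assoc[OF h(1) D.i2 m] by simp
    then have "x \<cdot> r = (m \<cdot> i2) \<cdot> (y \<oplus> (h1 \<cdot> q))"
      unfolding q(2) using Cmp_Add_right[OF r(3) Cmp_Hom[OF q(1) h(1)] v(1)]
        Cmp_assoc[OF q(1) h(1) v(1)] by simp
    then have "in_image (m \<cdot> i2) (x \<cdot> r)"
      using in_image_cmp[OF v(1) Add_Hom[OF r(3) Cmp_Hom[OF q(1) h(1)]]] by simp
    then show "in_image (m \<cdot> i2) x" using in_image_cover[OF _ r(1,2) x(1)] by blast
  qed
  then show ?thesis using v s by (simp add: short_exact_iff)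
qed

text \<open>An element of \<open>X\<close> that vanishes in \<open>Z\<close> vanishes in \<open>F\<close> and in \<open>G\<close>: it comes from \<open>H\<close>,
  and from the kernel of \<open>H \<rightarrow> S\<close>, which is \<open>P\<close>. To reach a given \<open>x\<close> in \<open>Z\<close>, its component in \<open>F\<close> is
  lifted to \<open>X\<close>; the error in \<open>G\<close> vanishes in \<open>Q\<close>, so it comes from \<open>S\<close> and can be corrected by an
  element of \<open>H\<close>, which does not change the component in \<open>F\<close>.\<close>

lemma nine_diagram_bridge:
  assumes D: "Baer_sum_diagram C P Q E F H G T Z e1 (f1 \<cdot> e2) f2 h1 (g1 \<cdot> h2) g2 i1 i2 p1 p2 b"
    and PER: "short_exact C P e1 E e2 R" and PHS: "short_exact C P h1 H h2 S"
    and SGQ: "short_exact C S g1 G g2 Q"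
    and u: "u \<in> Hom C E X" and v: "v \<in> Hom C H X" and s: "s \<in> Hom C X F" and t: "t \<in> Hom C X G"
    and sq: "u \<cdot> e1 = v \<cdot> h1" "s \<cdot> u = f1 \<cdot> e2" "t \<cdot> v = g1 \<cdot> h2" "f2 \<cdot> s = g2 \<cdot> t"
    and HXF: "short_exact C H v X s F" and EXG: "short_exact C E u X t G"
  shows "bridged P (i1 \<cdot> e1) T b Z"
proof -
  interpret D: Baer_sum_diagram C P Q E F H G T Z e1 "f1 \<cdot> e2" f2 h1 "g1 \<cdot> h2" g2 i1 i2 p1 p2 b
    by (rule D)
  have e: "e1 \<in> Hom C P E" "is_monic C e1" using PER by (auto simp: short_exact_iff)
  have h: "h1 \<in> Hom C P H" "h2 \<in> Hom C H S" "is_monic C h1" "exact_pair C h1 h2" "is_epic C h2"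
    using PHS by (auto simp: short_exact_iff)
  have g: "g1 \<in> Hom C S G" "g2 \<in> Hom C G Q" "is_monic C g1" "exact_pair C g1 g2"
    using SGQ by (auto simp: short_exact_iff)
  have vs: "is_monic C v" "exact_pair C v s" "is_epic C s" using HXF by (auto simp: short_exact_iff)
  have ut: "is_monic C u" "exact_pair C u t" using EXG by (auto simp: short_exact_iff)
  obtain m where m: "m \<in> Hom C T X" "m \<cdot> i1 = u" "m \<cdot> i2 = v"
    using pushout_induced[OF D.pushout D.i1 D.i2 u v sq(1)] .
  obtain n where n: "n \<in> Hom C X Z" "p1 \<cdot> n = s" "p2 \<cdot> n = t"
    using pullback_induced[OF D.pullback D.p1 D.p2 s t sq(4)] .
  have nu: "n \<cdot> u = b \<cdot> i1"
  proof (rule pullback_joint_monic[OF D.pullback D.p1 D.p2 Cmp_Hom[OF u n(1)] D.bi_Hom(1)])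
    show "p1 \<cdot> (n \<cdot> u) = p1 \<cdot> (b \<cdot> i1)" using Cmp_eq_Cmp[OF n(2,1) D.p1 u] sq(2) D.b11 by simp
    show "p2 \<cdot> (n \<cdot> u) = p2 \<cdot> (b \<cdot> i1)"
      using Cmp_eq_Cmp[OF n(3,1) D.p2 u] exact_Zero_Hom[OF ut(2) u t] D.b21 by simp
  qed
  have nv: "n \<cdot> v = b \<cdot> i2"
  proof (rule pullback_joint_monic[OF D.pullback D.p1 D.p2 Cmp_Hom[OF v n(1)] D.bi_Hom(2)])
    show "p2 \<cdot> (n \<cdot> v) = p2 \<cdot> (b \<cdot> i2)" using Cmp_eq_Cmp[OF n(3,1) D.p2 v] sq(3) D.b22 by simp
    show "p1 \<cdot> (n \<cdot> v) = p1 \<cdot> (b \<cdot> i2)"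
      using Cmp_eq_Cmp[OF n(2,1) D.p1 v] exact_Zero_Hom[OF vs(2) v s] D.b12 by simp
  qed
  have nm: "n \<cdot> m = b"
    by (rule pushout_joint_epic[OF D.pushout D.i1 D.i2 Cmp_Hom[OF m(1) n(1)] D.b])
       (use Cmp_assoc[OF D.i1 m(1) n(1)] Cmp_assoc[OF D.i2 m(1) n(1)] m(2,3) nu nv in auto)
  have me: "m \<cdot> (i1 \<cdot> e1) = u \<cdot> e1" using Cmp_eq_Cmp[OF m(2) D.i1 m(1) e(1)] .
  have ue: "u \<cdot> e1 \<in> Hom C P X" "is_monic C (u \<cdot> e1)"
    using Cmp_Hom[OF e(1) u] monic_Cmp[OF e(2) ut(1)] e(1) u by (auto simp: Hom_iff)
  have "exact_pair C (u \<cdot> e1) n"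
  proof (rule exact_pairI[OF ue(1) n(1)])
    show "n \<cdot> (u \<cdot> e1) = Zero C P Z"
      using Cmp_eq_Cmp[OF nu u n(1) e(1)] Cmp_assoc[OF e(1) D.i1 D.b]
        exact_Zero_Hom[OF D.sum_exact_left D.first_arrow(1) D.b] by simp
    fix Y x assume x: "x \<in> Hom C Y X" "n \<cdot> x = Zero C Y Z"
    have Y: "Y \<in> Obj C" using Hom_Obj[OF x(1)] by simp
    have sx: "s \<cdot> x = Zero C Y F" and tx: "t \<cdot> x = Zero C Y G"
      using Cmp_eq_Cmp[OF n(2,1) D.p1 x(1)] Cmp_eq_Cmp[OF n(3,1) D.p2 x(1)] x(2)
        Cmp_Zero_Hom(1)[OF D.p1 Y] Cmp_Zero_Hom(1)[OF D.p2 Y] by auto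
    obtain y where y: "y \<in> Hom C Y H" "v \<cdot> y = x" using exact_monic_lift[OF vs(1,2) v s x(1) sx] .
    have "g1 \<cdot> (h2 \<cdot> y) = Zero C Y G" using Cmp_square[OF sq(3) v t h(2) g(1) y(1)] y(2) tx by simp
    then have "h2 \<cdot> y = Zero C Y S" by (rule monic_Hom_Zero[OF g(3,1) Cmp_Hom[OF y(1) h(2)]])
    then obtain q where q: "q \<in> Hom C Y P" "h1 \<cdot> q = y"
      using exact_monic_lift[OF h(3,4,1,2) y(1)] by blast
    have "(u \<cdot> e1) \<cdot> q = x" unfolding sq(1) using Cmp_assoc[OF q(1) h(1) v] q(2) y(2) by simp
    then show "in_image (u \<cdot> e1) x" by (rule in_image_cmp[OF ue(1) q(1)])
  qed
  moreover have "is_epic C n"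
  proof -
    have "in_image n x" if x: "x \<in> Hom C Y Z" for Y x
    proof -
      have px: "p1 \<cdot> x \<in> Hom C Y F" "p2 \<cdot> x \<in> Hom C Y G"
        using Cmp_Hom[OF x D.p1] Cmp_Hom[OF x D.p2] by auto
      have "p1 \<cdot> x \<in> Hom C Y (Tgt C s)" "Src C s = X" using px(1) s by (auto simp: Hom_iff)
      then obtain Y1 r y where r: "r \<in> Hom C Y1 Y" "is_epic C r" "y \<in> Hom C Y1 X" "s \<cdot> y = (p1 \<cdot> x) \<cdot> r"
        using epic_lift[OF vs(3)] by metis
      have xr: "x \<cdot> r \<in> Hom C Y1 Z" using Cmp_Hom[OF r(1) x] .
      have pxr: "p2 \<cdot> (x \<cdot> r) \<in> Hom C Y1 G" and ty: "t \<cdot> y \<in> Hom C Y1 G"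
        using Cmp_Hom[OF xr D.p2] Cmp_Hom[OF r(3) t] by auto
      have "g2 \<cdot> (p2 \<cdot> (x \<cdot> r)) = f2 \<cdot> (s \<cdot> y)"
        using Cmp_square[OF D.pullback_square D.p1 D.E1(3) D.p2 g(2) xr] r(4)
          Cmp_assoc[OF r(1) x D.p1] by simp
      also have "\<dots> = g2 \<cdot> (t \<cdot> y)" using Cmp_square[OF sq(4) s D.E1(3) t g(2) r(3)] .
      finally obtain \<sigma> where \<sigma>: "\<sigma> \<in> Hom C Y1 S" "p2 \<cdot> (x \<cdot> r) = (t \<cdot> y) \<oplus> (g1 \<cdot> \<sigma>)"
        using monic_exact_difference[OF g(3,4,1,2) pxr ty] by blast
      have "\<sigma> \<in> Hom C Y1 (Tgt C h2)" "Src C h2 = H" using \<sigma>(1) h(2) by (auto simp: Hom_iff)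
      then obtain Y2 r' z where r': "r' \<in> Hom C Y2 Y1" "is_epic C r'" "z \<in> Hom C Y2 H" "h2 \<cdot> z = \<sigma> \<cdot> r'"
        using epic_lift[OF h(5)] by metis
      \<comment> \<open>The lift \<open>y\<close> of the first component, corrected by the image of \<open>z\<close>, which vanishes in \<open>F\<close>.\<close>
      define w where "w = (y \<cdot> r') \<oplus> (v \<cdot> z)"
      have yr: "y \<cdot> r' \<in> Hom C Y2 X" and vz: "v \<cdot> z \<in> Hom C Y2 X"
        using Cmp_Hom[OF r'(1) r(3)] Cmp_Hom[OF r'(3) v] by auto
      have w: "w \<in> Hom C Y2 X" unfolding w_def using yr vz by (rule Add_Hom)
      have xrr: "(x \<cdot> r) \<cdot> r' \<in> Hom C Y2 Z" using Cmp_Hom[OF r'(1) xr] .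
      have "n \<cdot> w = (x \<cdot> r) \<cdot> r'"
      proof (rule pullback_joint_monic[OF D.pullback D.p1 D.p2 Cmp_Hom[OF w n(1)] xrr])
        have "p1 \<cdot> (n \<cdot> w) = (s \<cdot> (y \<cdot> r')) \<oplus> (s \<cdot> (v \<cdot> z))"
          unfolding Cmp_eq_Cmp[OF n(2,1) D.p1 w] unfolding w_def by (rule Cmp_Add_right[OF yr vz s])
        also have "s \<cdot> (v \<cdot> z) = Zero C Y2 F" by (rule exact_Zero_element[OF vs(2) v s r'(3)])
        also have "(s \<cdot> (y \<cdot> r')) \<oplus> \<dots> = (s \<cdot> y) \<cdot> r'"
          using s r(3) r'(1) by (simp add: Hom_iff)
        also have "\<dots> = p1 \<cdot> ((x \<cdot> r) \<cdot> r')"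
          unfolding r(4) using D.p1 x r(1) r'(1) by (simp add: Hom_iff)
        finally show "p1 \<cdot> (n \<cdot> w) = p1 \<cdot> ((x \<cdot> r) \<cdot> r')" .
        have "p2 \<cdot> (n \<cdot> w) = (t \<cdot> (y \<cdot> r')) \<oplus> (t \<cdot> (v \<cdot> z))"
          unfolding Cmp_eq_Cmp[OF n(3,1) D.p2 w] unfolding w_def by (rule Cmp_Add_right[OF yr vz t])
        also have "t \<cdot> (v \<cdot> z) = g1 \<cdot> (\<sigma> \<cdot> r')"
          using Cmp_square[OF sq(3) v t h(2) g(1) r'(3)] r'(4) by simp
        also have "(t \<cdot> (y \<cdot> r')) \<oplus> \<dots> = ((t \<cdot> y) \<oplus> (g1 \<cdot> \<sigma>)) \<cdot> r'"
          using t r(3) r'(1) g(1) \<sigma>(1) by (simp add: Hom_iff)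
        also have "\<dots> = p2 \<cdot> ((x \<cdot> r) \<cdot> r')"
          unfolding \<sigma>(2)[symmetric] by (rule Cmp_assoc[OF r'(1) xr D.p2])
        finally show "p2 \<cdot> (n \<cdot> w) = p2 \<cdot> ((x \<cdot> r) \<cdot> r')" .
      qed
      then have "in_image n ((x \<cdot> r) \<cdot> r')" by (rule in_image_cmp[OF n(1) w])
      then have "in_image n (x \<cdot> r)" using in_image_cover[OF _ r'(1,2) xr] by blast
      then show ?thesis using in_image_cover[OF _ r(1,2) x] by blast
    qed
    then show ?thesis unfolding epic_iff_in_image using n(1) by (auto simp: Hom_iff)
  qed
  ultimately have "short_exact C P (m \<cdot> (i1 \<cdot> e1)) X n Z"
    unfolding me using ue n(1) by (simp add: short_exact_iff)
  then show ?thesis unfolding bridged_def using m(1) n(1) nm by blast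
qed

lemma bridge_nine_diagram:
  assumes D: "Baer_sum_diagram C P Q E F H G T Z e1 (f1 \<cdot> e2) f2 h1 (g1 \<cdot> h2) g2 i1 i2 p1 p2 b"
    and PER: "short_exact C P e1 E e2 R" and PHS: "short_exact C P h1 H h2 S"
    and RFQ: "short_exact C R f1 F f2 Q" and SGQ: "short_exact C S g1 G g2 Q"
    and br: "bridged P (i1 \<cdot> e1) T b Z"
  shows "\<exists>X \<in> Obj C. \<exists>u \<in> Hom C E X. \<exists>v \<in> Hom C H X. \<exists>s \<in> Hom C X F. \<exists>t \<in> Hom C X G.
    u \<cdot> e1 = v \<cdot> h1 \<and> s \<cdot> u = f1 \<cdot> e2 \<and> t \<cdot> v = g1 \<cdot> h2 \<and> f2 \<cdot> s = g2 \<cdot> t \<and>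
    short_exact C H v X s F \<and> short_exact C E u X t G"
proof -
  interpret D: Baer_sum_diagram C P Q E F H G T Z e1 "f1 \<cdot> e2" f2 h1 "g1 \<cdot> h2" g2 i1 i2 p1 p2 b
    by (rule D)
  obtain X m n where X: "m \<in> Hom C T X" "n \<in> Hom C X Z" "n \<cdot> m = b"
    "short_exact C P (m \<cdot> (i1 \<cdot> e1)) X n Z"
    using br unfolding bridged_def by blast
  have "short_exact C P (m \<cdot> (i2 \<cdot> h1)) X n Z" using X(4) D.pushout_square by simp
  then have EXG: "short_exact C E (m \<cdot> i1) X (p2 \<cdot> n) G"
    by (rule bridge_short_exact[OF Baer_sum_diagram_commute[OF D] PER RFQ X(1-3)])
  have HXF: "short_exact C H (m \<cdot> i2) X (p1 \<cdot> n) F"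
    by (rule bridge_short_exact[OF D PHS SGQ X])
  have "(m \<cdot> i1) \<cdot> e1 = (m \<cdot> i2) \<cdot> h1"
    using Cmp_assoc[OF D.E1(1) D.i1 X(1)] Cmp_assoc[OF D.E2(1) D.i2 X(1)] D.pushout_square by simp
  moreover have "(p1 \<cdot> n) \<cdot> (m \<cdot> i1) = f1 \<cdot> e2"
    using Cmp_assoc[OF Cmp_Hom[OF D.i1 X(1)] X(2) D.p1] Cmp_eq_Cmp[OF X(3,1,2) D.i1] D.b11 by simp
  moreover have "(p2 \<cdot> n) \<cdot> (m \<cdot> i2) = g1 \<cdot> h2"
    using Cmp_assoc[OF Cmp_Hom[OF D.i2 X(1)] X(2) D.p2] Cmp_eq_Cmp[OF X(3,1,2) D.i2] D.b22 by simp
  moreover have "f2 \<cdot> (p1 \<cdot> n) = g2 \<cdot> (p2 \<cdot> n)"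
    by (rule Cmp_square[OF D.pullback_square D.p1 D.E1(3) D.p2 D.E2(3) X(2)])
  moreover have "X \<in> Obj C" "m \<cdot> i1 \<in> Hom C E X" "m \<cdot> i2 \<in> Hom C H X"
    "p1 \<cdot> n \<in> Hom C X F" "p2 \<cdot> n \<in> Hom C X G"
    using Hom_Obj[OF X(1)] Cmp_Hom[OF D.i1 X(1)] Cmp_Hom[OF D.i2 X(1)]
      Cmp_Hom[OF X(2) D.p1] Cmp_Hom[OF X(2) D.p2] by auto
  ultimately show ?thesis using EXG HXF by blast
qed

end

theorem theorem1p1:
  fixes C :: "('o, 'm) precat"
    and P Q R S E F G H :: 'o
    and e1 e2 h1 h2 f1 f2 g1 g2 :: 'm
  assumes "abelian_category C"
    and PER: "short_exact C P e1 E e2 R"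
    and PHS: "short_exact C P h1 H h2 S"
    and RFQ: "short_exact C R f1 F f2 Q"
    and SGQ: "short_exact C S g1 G g2 Q"
  shows "(\<exists>X \<in> Obj C. \<exists>u \<in> Hom C E X. \<exists>v \<in> Hom C H X. \<exists>s \<in> Hom C X F. \<exists>t \<in> Hom C X G.
            u \<cdot>\<^bsub>C\<^esub> e1 = v \<cdot>\<^bsub>C\<^esub> h1 \<and> s \<cdot>\<^bsub>C\<^esub> u = f1 \<cdot>\<^bsub>C\<^esub> e2 \<and>
            t \<cdot>\<^bsub>C\<^esub> v = g1 \<cdot>\<^bsub>C\<^esub> h2 \<and> f2 \<cdot>\<^bsub>C\<^esub> s = g2 \<cdot>\<^bsub>C\<^esub> t \<and>
            short_exact C H v X s F \<and> short_exact C E u X t G)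
     \<longleftrightarrow>
         Baer_sum C Q P
           (ext_cup C 1 1 Q P (ext_class C 1 R P [e1, e2]) (ext_class C 1 Q R [f1, f2]))
           (ext_cup C 1 1 Q P (ext_class C 1 S P [h1, h2]) (ext_class C 1 Q S [g1, g2]))
         = Ext2_zero C Q P"
    (is "?diagram \<longleftrightarrow> ?sum = _")
proof -
  interpret abelian_category C by fact
  obtain T Z i1 i2 p1 p2 b where
    D: "Baer_sum_diagram C P Q E F H G T Z e1 (f1 \<cdot>\<^bsub>C\<^esub> e2) f2 h1 (g1 \<cdot>\<^bsub>C\<^esub> h2) g2 i1 i2 p1 p2 b"
    using Baer_sum_diagram_exists[OF splice_two_extension[OF PER RFQ] splice_two_extension[OF PHS SGQ]] .
  have "?sum = ext_class C 2 Q P [i1 \<cdot>\<^bsub>C\<^esub> e1, b, f2 \<cdot>\<^bsub>C\<^esub> p1]"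
    unfolding ext_cup_class[OF PER RFQ] ext_cup_class[OF PHS SGQ] by (rule Baer_sum_class[OF D])
  then have "?sum = Ext2_zero C Q P \<longleftrightarrow> bridged P (i1 \<cdot>\<^bsub>C\<^esub> e1) T b Z"
    using bridged_iff_class_zero[OF Baer_sum_diagram.sum_two_extension[OF D]] by simp
  moreover have "?diagram" if "bridged P (i1 \<cdot>\<^bsub>C\<^esub> e1) T b Z"
    by (rule bridge_nine_diagram[OF D PER PHS RFQ SGQ that])
  moreover have "bridged P (i1 \<cdot>\<^bsub>C\<^esub> e1) T b Z" if ?diagram
    using that nine_diagram_bridge[OF D PER PHS SGQ] by blast
  ultimately show ?thesis by blast
qed

end
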